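(* Let $(W,S)$ be a finite Coxeter system of rank $n$ with root system $\Phi$, let $c$ be a Coxeter element with reduced word $\mathbf{c}=(c_1,\dots,c_n)$, and let $\mathbf{w}_\circ(\mathbf{c})=(w_1,\dots,w_N)$ be the $c$-sorting word of the longest element $w_\circ$. Consider the map from the positions of the word $\mathbf{c}\,\mathbf{w}_\circ(\mathbf{c})=(c_1,\dots,c_n,w_1,\dots,w_N)$ to $\Phi_{\geq -1}$ that sends the letter $c_i$ to $-\alpha_{c_i}$ and the letter $w_i$ to $w_1w_2\cdots w_{i-1}(\alpha_{w_i})$. This map is an isomorphism of simplicial complexes from the subword complex $\Delta(\mathbf{c}\,\mathbf{w}_\circ(\mathbf{c}),w_\circ)$ onto the $c$-cluster complex.
   Context: $W$ acts on a real vector space $V$ with basis of simple roots $\{\alpha_s : s\in S\}$, $s$ acting as the reflection in $\alpha_s$; $\Phi$ is the associated (finite) root system, $\Phi^+$ its positive roots, and $\Phi_{\geq -1}=\Phi^+\cup\{-\alpha_s : s\in S\}$ the almost positive roots. A Coxeter element is the product of all elements of $S$ in some order. $w_\circ$ is the longest element of $W$ and $N=\ell(w_\circ)$. The $c$-sorting word $\mathbf{w}_\circ(\mathbf{c})$ is the lexicographically first (as a sequence of positions) subword of the infinite word $\mathbf{c}\mathbf{c}\mathbf{c}\cdots$ which is a reduced expression for $w_\circ$. For a word $Q=(q_1,\dots,q_r)$ in $S$ and $\pi\in W$, the subword complex $\Delta(Q,\pi)$ is the simplicial complex on the set of positions $\{1,\dots,r\}$ of $Q$ whose faces are the subsets $P$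 such that the word obtained from $Q$ by deleting the positions in $P$ contains a subword which is a reduced expression for $\pi$. A generator $s$ is initial in $c$ if $\ell(sc)<\ell(c)$. For $s\in S$, $\Phi_{\langle s\rangle}$ is the root subsystem of the parabolic subgroup generated by $S\setminus\{s\}$, and $(\Phi_{\langle s\rangle})_{\geq-1}$ its almost positive roots. The involution $\sigma_s$ of $\Phi_{\geq -1}$ is given by $\sigma_s(\beta)=\beta$ if $-\beta\in\{\alpha_t: t\in S, t\neq s\}$ and $\sigma_s(\beta)=s(\beta)$ otherwise. The $c$-compatibility relations $\parallel_c$ on $\Phi_{\geq-1}$ (one for each Coxeter element $c$) form the unique family of symmetric relations such that (i) for $s\in S$ and $\beta\in\Phi_{\geq -1}$ with $\beta\neq-\alpha_s$: $-\alpha_s\parallel_c\beta$ iff $\beta\in(\Phi_{\langle s\rangle})_{\geq -1}$; (ii) for $\beta_1,\beta_2\in\Phi_{\geq-1}$ and $s$ initial in $c$: $\beta_1\parallel_c\beta_2$ iff $\sigma_s(\beta_1)\parallel_{scs}\sigma_s(\beta_2)$. The $c$-cluster complex is the simplicial complex on $\Phi_{\geq -1}$ whose faces are the sets of pairwise $c$-compatible almost positive roots (its facets are the $c$-clusters). *)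

theory Defs
  imports
    "HOL-Algebra.Multiplicative_Group"
    "HOL-Algebra.Generated_Groups"
    "HOL-Analysis.Inner_Product"
    "HOL-Library.Sublist"
begin

definition word_prod :: "('a, 'm) monoid_scheme \<Rightarrow> 'a list \<Rightarrow> 'a" where
  "word_prod G u = foldr (\<otimes>\<^bsub>G\<^esub>) u \<one>\<^bsub>G\<^esub>"

text \<open>
  The congruence on words in \<open>S\<close> generated by the relations \<open>(s t)\<^sup>m = 1\<close> with \<open>m = m s t\<close>.
  With \<open>m s s = 1\<close> it contains the relations \<open>s s = 1\<close>, so the quotient monoid is the group
  presented by these generators and relations. Setting \<open>m s t = 0\<close> gives a trivial relation, so
  it encodes infinite order.
\<close>

inductive coxeter_equiv :: "'a set \<Rightarrow> ('a \<Rightarrow> 'a \<Rightarrow> nat) \<Rightarrow> 'a list \<Rightarrow> 'a list \<Rightarrow> bool"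
  for S :: "'a set" and m :: "'a \<Rightarrow> 'a \<Rightarrow> nat" where
  refl: "set u \<subseteq> S \<Longrightarrow> coxeter_equiv S m u u"
| sym: "coxeter_equiv S m u v \<Longrightarrow> coxeter_equiv S m v u"
| trans: "coxeter_equiv S m u v \<Longrightarrow> coxeter_equiv S m v w \<Longrightarrow> coxeter_equiv S m u w"
| rel: "set u \<subseteq> S \<Longrightarrow> set v \<subseteq> S \<Longrightarrow> s \<in> S \<Longrightarrow> t \<in> S \<Longrightarrow>
    coxeter_equiv S m (u @ concat (replicate (m s t) [s, t]) @ v) (u @ v)"

text \<open>
  The group is generated by the involutions \<open>S\<close> and presented by the relations
  \<open>(s t)\<^sup>m = 1\<close> with \<open>m\<close> the order of \<open>s t\<close>. The constant \<open>ord\<close> is \<open>0\<close> on elements of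
  infinite order.
\<close>

locale coxeter_system = group G for G (structure) +
  fixes S :: "'a set"
  assumes gens_in_carrier: "S \<subseteq> carrier G"
    and gens_generate: "generate G S = carrier G"
    and gens_involutions: "\<And>s. s \<in> S \<Longrightarrow> ord s = 2"
    and presentation: "\<And>u v. set u \<subseteq> S \<Longrightarrow> set v \<subseteq> S \<Longrightarrow> word_prod G u = word_prod G v \<Longrightarrow>
      coxeter_equiv S (\<lambda>s t. ord (s \<otimes> t)) u v"

locale finite_coxeter_system = coxeter_system +
  assumes finite_carrier: "finite (carrier G)"

definition cox_length :: "('a, 'm) monoid_scheme \<Rightarrow> 'a set \<Rightarrow> 'a \<Rightarrow> nat" where
  "cox_length G S w = (LEAST k. \<exists>u. set u \<subseteq> S \<and> word_prod G u = w \<and> length u = k)"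

definition reduced_expression ::
  "('a, 'm) monoid_scheme \<Rightarrow> 'a set \<Rightarrow> 'a list \<Rightarrow> 'a \<Rightarrow> bool" where
  "reduced_expression G S u w \<longleftrightarrow>
     set u \<subseteq> S \<and> word_prod G u = w \<and> length u = cox_length G S w"

definition longest_element :: "('a, 'm) monoid_scheme \<Rightarrow> 'a set \<Rightarrow> 'a \<Rightarrow> bool" where
  "longest_element G S w \<longleftrightarrow>
     w \<in> carrier G \<and> (\<forall>x \<in> carrier G. cox_length G S x \<le> cox_length G S w)"

definition coxeter_element :: "('a, 'm) monoid_scheme \<Rightarrow> 'a set \<Rightarrow> 'a \<Rightarrow> bool" where
  "coxeter_element G S c \<longleftrightarrow> (\<exists>u. distinct u \<and> set u = S \<and> word_prod G u = c)"

definition initial_in :: "('a, 'm) monoid_scheme \<Rightarrow> 'a set \<Rightarrow> 'a \<Rightarrow> 'a \<Rightarrow> bool" where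
  "initial_in G S s c \<longleftrightarrow> s \<in> S \<and> cox_length G S (s \<otimes>\<^bsub>G\<^esub> c) < cox_length G S c"

text \<open>A subword of the infinite word \<open>cs cs cs \<dots>\<close> is given by its increasing list of positions
  (counted from \<open>0\<close>).\<close>

definition periodic_subword :: "'a list \<Rightarrow> nat list \<Rightarrow> 'a list" where
  "periodic_subword cs ps = map (\<lambda>p. cs ! (p mod length cs)) ps"

definition reduced_positions ::
  "('a, 'm) monoid_scheme \<Rightarrow> 'a set \<Rightarrow> 'a list \<Rightarrow> 'a \<Rightarrow> nat list \<Rightarrow> bool" where
  "reduced_positions G S cs w ps \<longleftrightarrow>
     sorted_wrt (<) ps \<and> reduced_expression G S (periodic_subword cs ps) w"

definition sorting_word ::
  "('a, 'm) monoid_scheme \<Rightarrow> 'a set \<Rightarrow> 'a list \<Rightarrow> 'a \<Rightarrow> 'a list \<Rightarrow> bool" where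
  "sorting_word G S cs w ws \<longleftrightarrow>
     (\<exists>ps. reduced_positions G S cs w ps
         \<and> (\<forall>qs. reduced_positions G S cs w qs \<longrightarrow> ps = qs \<or> (ps, qs) \<in> lexord less_than)
         \<and> ws = periodic_subword cs ps)"

text \<open>A simplicial complex on a given ground set is represented by its set of faces; positions of a
  word are counted from \<open>0\<close>.\<close>

definition subword_complex ::
  "('a, 'm) monoid_scheme \<Rightarrow> 'a set \<Rightarrow> 'a list \<Rightarrow> 'a \<Rightarrow> nat set set" where
  "subword_complex G S Q \<pi> =
     {P. P \<subseteq> {..<length Q} \<and>
         (\<exists>u. subseq u (nths Q ({..<length Q} - P)) \<and> reduced_expression G S u \<pi>)}"

definition simplicial_isomorphism ::
  "('p \<Rightarrow> 'q) \<Rightarrow> 'p set \<Rightarrow> 'p set set \<Rightarrow> 'q set \<Rightarrow> 'q set set \<Rightarrow> bool" where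
  "simplicial_isomorphism f V K V' K' \<longleftrightarrow>
     bij_betw f V V' \<and> (\<forall>P. P \<subseteq> V \<longrightarrow> (P \<in> K \<longleftrightarrow> f ` P \<in> K'))"

definition parabolic_roots ::
  "('a, 'm) monoid_scheme \<Rightarrow> ('a \<Rightarrow> 'v \<Rightarrow> 'v) \<Rightarrow> ('a \<Rightarrow> 'v) \<Rightarrow> 'a set \<Rightarrow> 'v set" where
  "parabolic_roots G act \<alpha> J = {act w (\<alpha> s) | w s. w \<in> generate G J \<and> s \<in> J}"

text \<open>
  \<open>V = span (\<alpha> ` S)\<close>, with an inner product for which each \<open>s\<close> acts as the orthogonal reflection in
  \<open>\<alpha> s\<close>. The prescribed angles are those of the geometric representation. The lengths of the simple
  roots are free up to the requirement that the only multiples of a root that are roots are plus and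
  minus that root. So both the root system of unit vectors and the crystallographic root systems are
  covered. As \<open>ord (s \<otimes> s) = 1\<close>, the case \<open>s = t\<close> of \<open>simple_angles\<close> holds trivially.
\<close>

locale coxeter_root_system = finite_coxeter_system G S for G (structure) and S +
  fixes act :: "'a \<Rightarrow> 'v::real_inner \<Rightarrow> 'v" and \<alpha> :: "'a \<Rightarrow> 'v"
  assumes simple_inj: "inj_on \<alpha> S"
    and simple_independent: "independent (\<alpha> ` S)"
    and act_one: "\<And>v. v \<in> span (\<alpha> ` S) \<Longrightarrow> act \<one> v = v"
    and act_mult: "\<And>g h v. g \<in> carrier G \<Longrightarrow> h \<in> carrier G \<Longrightarrow> v \<in> span (\<alpha> ` S) \<Longrightarrow>
      act (g \<otimes> h) v = act g (act h v)"
    and act_gen: "\<And>s v. s \<in> S \<Longrightarrow> v \<in> span (\<alpha> ` S) \<Longrightarrow>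
      act s v = v - (2 * inner v (\<alpha> s) / inner (\<alpha> s) (\<alpha> s)) *\<^sub>R \<alpha> s"
    and simple_angles: "\<And>s t. s \<in> S \<Longrightarrow> t \<in> S \<Longrightarrow>
      inner (\<alpha> s) (\<alpha> t) = - cos (pi / real (ord (s \<otimes> t))) * norm (\<alpha> s) * norm (\<alpha> t)"
    and roots_reduced: "\<And>\<beta> k. \<beta> \<in> parabolic_roots G act \<alpha> S \<Longrightarrow>
      k *\<^sub>R \<beta> \<in> parabolic_roots G act \<alpha> S \<Longrightarrow> k = 1 \<or> k = -1"

definition positive_roots ::
  "('a, 'm) monoid_scheme \<Rightarrow> ('a \<Rightarrow> 'v \<Rightarrow> 'v) \<Rightarrow> ('a \<Rightarrow> 'v::real_vector) \<Rightarrow> 'a set \<Rightarrow> 'v set" where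
  "positive_roots G act \<alpha> J =
     {\<beta> \<in> parabolic_roots G act \<alpha> J. \<exists>k. (\<forall>s \<in> J. 0 \<le> k s) \<and> \<beta> = (\<Sum>s \<in> J. k s *\<^sub>R \<alpha> s)}"

definition almost_positive_roots ::
  "('a, 'm) monoid_scheme \<Rightarrow> ('a \<Rightarrow> 'v \<Rightarrow> 'v) \<Rightarrow> ('a \<Rightarrow> 'v::real_vector) \<Rightarrow> 'a set \<Rightarrow> 'v set" where
  "almost_positive_roots G act \<alpha> J = positive_roots G act \<alpha> J \<union> (\<lambda>s. - \<alpha> s) ` J"

definition root_sigma ::
  "'a set \<Rightarrow> ('a \<Rightarrow> 'v \<Rightarrow> 'v) \<Rightarrow> ('a \<Rightarrow> 'v::real_vector) \<Rightarrow> 'a \<Rightarrow> 'v \<Rightarrow> 'v" where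
  "root_sigma S act \<alpha> s \<beta> = (if - \<beta> \<in> \<alpha> ` (S - {s}) then \<beta> else act s \<beta>)"

text \<open>These axioms determine each \<open>cpt c\<close> on pairs of distinct almost positive roots only; they
  say nothing on whether a root is compatible with itself.\<close>

definition compatibility_family ::
  "('a, 'm) monoid_scheme \<Rightarrow> 'a set \<Rightarrow> ('a \<Rightarrow> 'v \<Rightarrow> 'v) \<Rightarrow> ('a \<Rightarrow> 'v::real_vector) \<Rightarrow>
     ('a \<Rightarrow> 'v \<Rightarrow> 'v \<Rightarrow> bool) \<Rightarrow> bool" where
  "compatibility_family G S act \<alpha> cpt \<longleftrightarrow>
     (\<forall>c. coxeter_element G S c \<longrightarrow>
        (\<forall>\<beta>\<^sub>1 \<in> almost_positive_roots G act \<alpha> S. \<forall>\<beta>\<^sub>2 \<in> almost_positive_roots G act \<alpha> S.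
           cpt c \<beta>\<^sub>1 \<beta>\<^sub>2 \<longrightarrow> cpt c \<beta>\<^sub>2 \<beta>\<^sub>1) \<and>
        (\<forall>s \<in> S. \<forall>\<beta> \<in> almost_positive_roots G act \<alpha> S. \<beta> \<noteq> - \<alpha> s \<longrightarrow>
           (cpt c (- \<alpha> s) \<beta> \<longleftrightarrow> \<beta> \<in> almost_positive_roots G act \<alpha> (S - {s}))) \<and>
        (\<forall>s. initial_in G S s c \<longrightarrow>
           (\<forall>\<beta>\<^sub>1 \<in> almost_positive_roots G act \<alpha> S. \<forall>\<beta>\<^sub>2 \<in> almost_positive_roots G act \<alpha> S.
              cpt c \<beta>\<^sub>1 \<beta>\<^sub>2 \<longleftrightarrow>
              cpt (s \<otimes>\<^bsub>G\<^esub> c \<otimes>\<^bsub>G\<^esub> s) (root_sigma S act \<alpha> s \<beta>\<^sub>1) (root_sigma S act \<alpha> s \<beta>\<^sub>2))))"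

definition cluster_complex ::
  "('a, 'm) monoid_scheme \<Rightarrow> 'a set \<Rightarrow> ('a \<Rightarrow> 'v \<Rightarrow> 'v) \<Rightarrow> ('a \<Rightarrow> 'v::real_vector) \<Rightarrow>
     ('a \<Rightarrow> 'v \<Rightarrow> 'v \<Rightarrow> bool) \<Rightarrow> 'a \<Rightarrow> 'v set set" where
  "cluster_complex G S act \<alpha> cpt c =
     {F. F \<subseteq> almost_positive_roots G act \<alpha> S \<and> pairwise (cpt c) F}"

definition letter_root ::
  "('a, 'm) monoid_scheme \<Rightarrow> ('a \<Rightarrow> 'v \<Rightarrow> 'v) \<Rightarrow> ('a \<Rightarrow> 'v::real_vector) \<Rightarrow>
     'a list \<Rightarrow> 'a list \<Rightarrow> nat \<Rightarrow> 'v" where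
  "letter_root G act \<alpha> cs ws p =
     (if p < length cs then - \<alpha> (cs ! p)
      else act (word_prod G (take (p - length cs) ws)) (\<alpha> (ws ! (p - length cs))))"

end

theory Submission
  imports Defs
begin

text \<open>
  Write \<open>E\<close> for the Euler form of the Coxeter element with word \<open>cs\<close>. Rotating the first letter \<open>s\<close> of
  \<open>cs\<close> to the end turns \<open>E x y\<close> into \<open>E (s x) (s y)\<close>, and \<open>E (\<alpha> s)\<close> is a positive multiple of the
  coefficient at \<open>\<alpha> s\<close> if \<open>s\<close> is the first letter. By repeated rotation every positive root becomes
  negative. The time at which this happens orders the positive roots such that \<open>E\<close> is nonnegative on
  (earlier, later) pairs and nonpositive on (later, earlier) pairs, and this is the order of the
  letters of the sorting word. Two positive roots are compatible if and only if \<open>E\<close> is nonnegative on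
  both pairs, since this relation obeys the axioms.

  Deleting letters from the sorting word multiplies the longest element by reflections. Hence the
  facets of the subword complex are the sets of \<open>n\<close> letters for which the letters left over from \<open>cs\<close>
  are the inverse of the product of the reflections in the deleted roots. This description is
  invariant under rotation as well. Rotating a root of a facet to a negative simple root, Carter's
  lemma shows that it is compatible with the other ones. Conversely, rotating a root of a set of
  pairwise compatible roots to a negative simple root, the other ones lie in a parabolic subsystem,
  and by induction on the rank they extend to a facet.
\<close>

section \<open>Reflections and lists\<close>

text \<open>The obstacle is the sorting word: a lexicographic minimum says little about what happens
  when the Coxeter word is rotated. The proof therefore replaces the list by a condition on pairs of
  roots. \<open>euler\<close> keeps the part of the Gram matrix selected by the order of the
  letters, with a halved diagonal, so that it depends on the Coxeter word alone and is transported
  exactly by rotation. Two roots that may stand in either order are orthogonal, so their reflections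
  commute and the choice of the list does not matter. The sign condition for compatibility has the
  following origin. Compatibility with \<open>- \<alpha> s\<close> means that the coefficient at
  \<open>\<alpha> s\<close> vanishes. Before the rotation that produces \<open>- \<alpha> s\<close>,
  the root is \<open>\<alpha> s\<close>, and the Euler form of any \<open>y\<close> with it is a
  negative multiple of the coefficient of \<open>act s y\<close>. For positive roots this is
  nonnegative only if the coefficient vanishes. Coxeter words are allowed to run over a subset of
  \<open>S\<close>. The parabolic subsystems of the induction on the rank then stay in the same
  group and space, and no Coxeter system has to be built for them.\<close>

definition reflection :: "'v::real_inner \<Rightarrow> 'v \<Rightarrow> 'v" where
  "reflection \<beta> v = v - (2 * inner v \<beta> / inner \<beta> \<beta>) *\<^sub>R \<beta>"

lemma reflection_add: "reflection \<beta> (x + y) = reflection \<beta> x + reflection \<beta> y"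
  by (simp add: reflection_def inner_add_left algebra_simps add_divide_distrib)

lemma reflection_scale: "reflection \<beta> (k *\<^sub>R x) = k *\<^sub>R reflection \<beta> x"
  by (simp add: reflection_def algebra_simps)

lemma reflection_self: "reflection \<beta> \<beta> = - \<beta>"
proof (cases "\<beta> = 0")
  case False
  then have "2 * inner \<beta> \<beta> / inner \<beta> \<beta> = 2" by simp
  then show ?thesis by (simp only: reflection_def) (simp add: scaleR_2)
qed (simp add: reflection_def)

lemma inner_reflection: "inner (reflection \<beta> x) (reflection \<beta> y) = inner x y"
proof (cases "\<beta> = 0")
  case False
  then have nz: "inner \<beta> \<beta> \<noteq> 0" by simp
  define a b where "a = 2 * inner x \<beta> / inner \<beta> \<beta>" and "b = 2 * inner y \<beta> / inner \<beta> \<beta>"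
  have ab: "inner x \<beta> = a * inner \<beta> \<beta> / 2" "inner y \<beta> = b * inner \<beta> \<beta> / 2"
    using nz by (simp_all add: a_def b_def)
  have "inner (reflection \<beta> x) (reflection \<beta> y)
      = inner x y - b * inner x \<beta> - a * inner y \<beta> + a * b * inner \<beta> \<beta>"
    unfolding reflection_def a_def[symmetric] b_def[symmetric]
    by (simp add: inner_diff_left inner_diff_right inner_commute[of \<beta> y] right_diff_distrib)
  also have "\<dots> = inner x y" unfolding ab by simp
  finally show ?thesis .
qed (simp add: reflection_def)

lemma reflection_reflection [simp]: "reflection \<beta> (reflection \<beta> x) = x"
proof (cases "\<beta> = 0")
  case False
  then have "inner \<beta> \<beta> \<noteq> 0" by simp
  then have "inner (reflection \<beta> x) \<beta> = - inner x \<beta>"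
    by (simp add: reflection_def inner_diff_left)
  then have "reflection \<beta> (reflection \<beta> x) = reflection \<beta> x + (2 * inner x \<beta> / inner \<beta> \<beta>) *\<^sub>R \<beta>"
    by (simp add: reflection_def)
  then show ?thesis by (simp add: reflection_def)
qed (simp add: reflection_def)

lemma reflection_orthogonal: "inner v \<beta> = 0 \<Longrightarrow> reflection \<beta> v = v"
  by (simp add: reflection_def)

lemma reflection_commute:
  assumes "inner \<beta> \<gamma> = 0" shows "reflection \<beta> (reflection \<gamma> v) = reflection \<gamma> (reflection \<beta> v)"
proof -
  have "inner \<gamma> \<beta> = 0" using assms by (simp add: inner_commute)
  then show ?thesis using assms by (simp add: reflection_def inner_diff_left)
qed

text \<open>One Gram-Schmidt step: \<open>e\<close>, the part of \<open>d\<close> orthogonal to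
  \<open>D\<close>, corrects the projection to \<open>span D\<close>. Only the finite set has to be
  handled, so the ambient space may have any dimension. The projection is needed for Carter's
  lemma.\<close>

lemma orthogonal_projection_exists:
  fixes a :: "'v::real_inner"
  assumes "finite D"
  shows "\<exists>p\<in>span D. \<forall>d\<in>D. inner (a - p) d = 0"
  using assms
proof (induction D arbitrary: a rule: finite_induct)
  case empty
  show ?case by (intro bexI[of _ 0]) auto
next
  case (insert d D)
  obtain p where p: "p \<in> span D" "\<forall>x\<in>D. inner (a - p) x = 0" using insert.IH by blast
  obtain q where q: "q \<in> span D" "\<forall>x\<in>D. inner (d - q) x = 0" using insert.IH by blast
  define e where "e = d - q"
  \<comment> \<open>If \<open>d\<close> already lies in the span of \<open>D\<close>, then
    \<open>e = 0\<close> and division by zero makes \<open>k = 0\<close>, so no correction takes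
    place.\<close>
  define k where "k = inner (a - p) e / inner e e"
  have sp: "p \<in> span (insert d D)" "q \<in> span (insert d D)" "d \<in> span (insert d D)"
    using p q span_mono[of D "insert d D"] by (auto intro: span_base)
  have e: "e \<in> span (insert d D)" using sp by (simp add: e_def span_diff)
  have eD: "inner e x = 0" if "x \<in> D" for x using q that by (simp add: e_def)
  have D: "inner (a - (p + k *\<^sub>R e)) x = 0" if "x \<in> D" for x
  proof -
    have "inner (a - (p + k *\<^sub>R e)) x = inner (a - p) x - k * inner e x"
      by (simp add: inner_diff_left inner_add_left)
    then show ?thesis using p eD that by simp
  qed
  have orth_span: "inner (a - (p + k *\<^sub>R e)) x = 0" if "x \<in> span D" for x
    using that
  proof (induction rule: span_induct_alt)
    case (step c x y)
    then show ?case using D by (simp add: inner_add_right)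
  qed simp
  have "inner (a - (p + k *\<^sub>R e)) e = inner (a - p) e - k * inner e e"
    by (simp add: inner_diff_left inner_add_left)
  also have "\<dots> = 0" by (cases "e = 0") (auto simp: k_def)
  finally have "inner (a - (p + k *\<^sub>R e)) (e + q) = 0"
    using orth_span[OF q(1)] by (simp add: inner_add_right)
  then have "inner (a - (p + k *\<^sub>R e)) d = 0" by (simp add: e_def)
  then show ?case using D sp e by (intro bexI[of _ "p + k *\<^sub>R e"]) (auto intro: span_add span_scale)
qed

lemma foldr_reflection_move:
  "(\<And>e. e \<in> set es \<Longrightarrow> inner e d = 0) \<Longrightarrow>
    foldr reflection (es @ d # fs) v = reflection d (foldr reflection (es @ fs) v)"
proof (induction es)
  case (Cons a es)
  then show ?case using reflection_commute[of a d] by simp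
qed simp

lemma foldr_reflection_fixed:
  "(\<And>d. d \<in> set ds \<Longrightarrow> inner v d = 0) \<Longrightarrow> foldr reflection ds v = v"
  by (induction ds) (auto simp: reflection_orthogonal)

section \<open>Subwords and increasing lists of positions\<close>

lemma nths_cong:
  assumes "\<And>i. i < length xs \<Longrightarrow> i \<in> A \<longleftrightarrow> i \<in> B" shows "nths xs A = nths xs B"
  unfolding nths_def using assms by (intro arg_cong[where f = "map fst"] filter_cong) (auto simp: set_zip)

lemma subseq_nths_mono: "A \<subseteq> B \<Longrightarrow> subseq (nths xs A) (nths xs B)"
proof (induction xs arbitrary: A B)
  case (Cons x xs)
  have "subseq (nths xs {j. Suc j \<in> A}) (nths xs {j. Suc j \<in> B})"
    using Cons by (intro Cons.IH) auto
  then show ?case using Cons.prems by (auto simp: nths_Cons)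
qed simp

lemma subseq_nthsE:
  assumes "subseq u (nths xs A)" obtains B where "B \<subseteq> A" "u = nths xs B"
proof -
  obtain N where "u = nths (nths xs A) N" using assms by (auto simp: subseq_conv_nths)
  then have "u = nths xs {i \<in> A. \<exists>j\<in>N. card {i' \<in> A. i' < i} = j}" by (simp add: nths_nths)
  then show thesis by (intro that[of "{i \<in> A. \<exists>j\<in>N. card {i' \<in> A. i' < i} = j}"]) auto
qed

lemma strict_sorted_split:
  "sorted_wrt (<) ps \<Longrightarrow> ps = filter (\<lambda>q. q < p) ps @ filter (\<lambda>q. \<not> q < (p::nat)) ps"
proof (induction ps)
  case (Cons a ps)
  show ?case
  proof (cases "a < p")
    case False
    then have "filter (\<lambda>q. q < p) ps = []" using Cons.prems by (force simp: filter_empty_conv)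
    then show ?thesis using False Cons by (auto simp: filter_id_conv filter_empty_conv)
  qed (use Cons in simp)
qed simp

lemma strict_sorted_filter_Suc:
  "sorted_wrt (<) ps \<Longrightarrow>
    filter (\<lambda>q. q < Suc p) ps = filter (\<lambda>q. q < p) ps @ (if p \<in> set ps then [p] else [])"
proof (induction ps)
  case (Cons a ps)
  show ?case
  proof (cases "a < p")
    case True
    then show ?thesis using Cons by auto
  next
    case False
    then have "filter (\<lambda>q. q < p) ps = []" "filter (\<lambda>q. q < Suc p) ps = []" "p \<notin> set ps"
      using Cons.prems by (force simp: filter_empty_conv)+
    then show ?thesis using False by auto
  qed
qed simp

lemma strict_sorted_filter_nth:
  assumes "sorted_wrt (<) ps" "i < length ps" shows "filter (\<lambda>q. q < (ps ! i :: nat)) ps = take i ps"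
proof -
  have "filter (\<lambda>q. q < ps ! i) (take i ps @ drop i ps) = take i ps"
  proof -
    have "q < ps ! i" if "q \<in> set (take i ps)" for q
      using that assms by (auto simp: in_set_conv_nth sorted_wrt_iff_nth_less)
    moreover have "\<not> q < ps ! i" if "q \<in> set (drop i ps)" for q
    proof -
      obtain j where "j < length (drop i ps)" "q = drop i ps ! j"
        using \<open>q \<in> set (drop i ps)\<close> by (metis in_set_conv_nth)
      then have j: "j < length ps - i" "q = ps ! (i + j)" using assms(2) by auto
      then have "i + j < length ps" by simp
      then show ?thesis using j assms sorted_wrt_nth_less[of "(<)" ps i "i + j"] by (cases j) auto
    qed
    ultimately show ?thesis unfolding filter_append
      by (metis append_Nil2 filter_False filter_True)
  qed
  then show ?thesis by simp
qed

text \<open>Every letter recurs in each period, so any word still fits after a given position.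
  Chosen positions can thus be completed to a competitor of the sorting word.\<close>

lemma periodic_subword_embed:
  assumes "set u \<subseteq> set cs"
  shows "\<exists>qs. sorted_wrt (<) qs \<and> (\<forall>q\<in>set qs. p < q) \<and> periodic_subword cs qs = u"
  using assms
proof (induction u arbitrary: p)
  case Nil
  show ?case by (intro exI[of _ "[]"]) (simp add: periodic_subword_def)
next
  case (Cons a u)
  then obtain i where i: "i < length cs" "cs ! i = a" by (auto simp: in_set_conv_nth)
  \<comment> \<open>Not the next occurrence of \<open>a\<close>, but one that lies beyond
    \<open>p\<close> for the crude reason that a period has at least one letter.\<close>
  define q where "q = i + length cs * Suc p"
  have "p < 1 * Suc p" by simp
  also have "\<dots> \<le> length cs * Suc p" using i by (intro mult_le_mono1) simp
  also have "\<dots> \<le> q" unfolding q_def by (rule le_add2)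
  finally have q: "p < q" .
  have qa: "cs ! (q mod length cs) = a"
    using i by (simp add: q_def del: mult_Suc_right)
  obtain qs where "sorted_wrt (<) qs" "\<forall>x\<in>set qs. q < x" "periodic_subword cs qs = u"
    using Cons.IH[of q] Cons.prems by auto
  then show ?case
    using q qa by (intro exI[of _ "q # qs"]) (auto simp: periodic_subword_def)
qed

section \<open>Words in a Coxeter group\<close>

context coxeter_system
begin

lemma gen_in_carrier [simp]: "s \<in> S \<Longrightarrow> s \<in> carrier G"
  using gens_in_carrier by blast

lemma gen_square [simp]: "s \<in> S \<Longrightarrow> s \<otimes> s = \<one>"
  using pow_ord_eq_1[of s] gens_involutions[of s] by (simp add: numeral_2_eq_2)

lemma gen_inv [simp]: "s \<in> S \<Longrightarrow> inv s = s"
  by (simp add: inv_equality)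

lemma gen_cancel_left [simp]: "s \<in> S \<Longrightarrow> x \<in> carrier G \<Longrightarrow> s \<otimes> (s \<otimes> x) = x"
  by (simp flip: m_assoc)

lemma gen_cancel_right [simp]: "s \<in> S \<Longrightarrow> x \<in> carrier G \<Longrightarrow> x \<otimes> s \<otimes> s = x"
  by (simp add: m_assoc)

lemma word_prod_Nil [simp]: "word_prod G [] = \<one>"
  by (simp add: word_prod_def)

lemma word_prod_Cons [simp]: "word_prod G (s # u) = s \<otimes> word_prod G u"
  by (simp add: word_prod_def)

lemma word_prod_closed [simp]: "set u \<subseteq> S \<Longrightarrow> word_prod G u \<in> carrier G"
  by (induction u) auto

lemma word_prod_append [simp]:
  "set u \<subseteq> S \<Longrightarrow> set v \<subseteq> S \<Longrightarrow> word_prod G (u @ v) = word_prod G u \<otimes> word_prod G v"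
  by (induction u) (auto simp: m_assoc)

lemma word_prod_rev: "set u \<subseteq> S \<Longrightarrow> word_prod G (rev u) = inv (word_prod G u)"
  by (induction u) (auto simp: inv_mult_group)

lemma word_exists:
  assumes "w \<in> carrier G" shows "\<exists>u. set u \<subseteq> S \<and> word_prod G u = w"
proof -
  have "w \<in> generate G S"
    using assms gens_generate by simp
  then show ?thesis
  proof (induction rule: generate.induct)
    case one
    show ?case by (rule exI[of _ "[]"]) simp
  next
    case (incl h)
    then show ?case by (intro exI[of _ "[h]"]) simp
  next
    case (inv h)
    then show ?case by (intro exI[of _ "[h]"]) simp
  next
    case (eng h1 h2)
    then obtain u v where "set u \<subseteq> S" "word_prod G u = h1" "set v \<subseteq> S" "word_prod G v = h2"
      by blast
    then show ?case by (intro exI[of _ "u @ v"]) auto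
  qed
qed

lemma carrier_induct [consumes 1, case_names one mult]:
  assumes "w \<in> carrier G" and "P \<one>"
    and step: "\<And>s w. s \<in> S \<Longrightarrow> w \<in> carrier G \<Longrightarrow> P w \<Longrightarrow> P (s \<otimes> w)"
  shows "P w"
proof -
  obtain u where u: "set u \<subseteq> S" "word_prod G u = w"
    using word_exists assms(1) by blast
  have "set u \<subseteq> S \<Longrightarrow> P (word_prod G u)"
    by (induction u) (auto intro: assms)
  with u show ?thesis by blast
qed

abbreviation len :: "'a \<Rightarrow> nat" where "len \<equiv> cox_length G S"

lemma len_word_le: "set u \<subseteq> S \<Longrightarrow> len (word_prod G u) \<le> length u"
  unfolding cox_length_def by (rule Least_le) blast

lemma reduced_exists:
  assumes "w \<in> carrier G" obtains u where "reduced_expression G S u w"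
proof -
  have "\<exists>k u. set u \<subseteq> S \<and> word_prod G u = w \<and> length u = k"
    using word_exists[OF assms] by blast
  from LeastI_ex[OF this] obtain u where "set u \<subseteq> S \<and> word_prod G u = w \<and> length u = len w"
    unfolding cox_length_def by blast
  then show thesis using that unfolding reduced_expression_def by blast
qed

lemma len_one [simp]: "len \<one> = 0"
  using len_word_le[of "[]"] by simp

lemma len_mult_le:
  assumes "x \<in> carrier G" "y \<in> carrier G" shows "len (x \<otimes> y) \<le> len x + len y"
proof -
  obtain u v where "reduced_expression G S u x" "reduced_expression G S v y"
    using reduced_exists assms by metis
  then show ?thesis
    using len_word_le[of "u @ v"] by (auto simp: reduced_expression_def)
qed

lemma len_gen_le: "s \<in> S \<Longrightarrow> len s \<le> 1"
  using len_word_le[of "[s]"] by simp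

lemma exists_right_descent:
  assumes "w \<in> carrier G" "w \<noteq> \<one>"
  obtains t where "t \<in> S" "len (w \<otimes> t) < len w"
proof -
  obtain u where u: "reduced_expression G S u w"
    using reduced_exists assms(1) by blast
  then have "u \<noteq> []" using assms(2) by (auto simp: reduced_expression_def)
  then obtain v t where v: "u = v @ [t]" by (metis rev_exhaust)
  with u have S: "set v \<subseteq> S" "t \<in> S" and w: "w = word_prod G v \<otimes> t" "len w = Suc (length v)"
    by (auto simp: reduced_expression_def)
  then have "w \<otimes> t = word_prod G v" by simp
  with S len_word_le[of v] w(2) that show thesis by auto
qed

text \<open>Built from the right because these words act on \<open>\<alpha> s\<close>: the last
  letter acts first, and it has to be \<open>t\<close>, as \<open>s\<close> would merely negate
  \<open>\<alpha> s\<close>.\<close>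

fun alternating :: "nat \<Rightarrow> 'a \<Rightarrow> 'a \<Rightarrow> 'a list" where
  "alternating 0 s t = []"
| "alternating (Suc k) s t = alternating k t s @ [t]"

lemma length_alternating [simp]: "length (alternating k s t) = k"
  by (induction k arbitrary: s t) auto

lemma set_alternating: "set (alternating k s t) \<subseteq> {s, t}"
  by (induction k arbitrary: s t) fastforce+

lemma set_alternating_gens [simp]: "s \<in> S \<Longrightarrow> t \<in> S \<Longrightarrow> set (alternating k s t) \<subseteq> S"
  using set_alternating by fastforce

lemma alternating_Cons: "alternating (Suc k) s t = (if even k then t else s) # alternating k s t"
  by (induction k arbitrary: s t) auto

lemma alternating_add: "\<exists>d. set d \<subseteq> {s, t} \<and> length d = j \<and> alternating (j + k) s t = d @ alternating k s t"
proof (induction j)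
  case (Suc j)
  then obtain d where d: "set d \<subseteq> {s, t}" "length d = j" "alternating (j + k) s t = d @ alternating k s t"
    by blast
  show ?case
    using d by (intro exI[of _ "(if even (j + k) then t else s) # d"])
      (auto simp: alternating_Cons simp del: alternating.simps(2))
qed simp

text \<open>For \<open>k = ord (s \<otimes> t)\<close> the power vanishes and this is the braid
  relation, by which a word ending in \<open>t\<close> may be rewritten to end in
  \<open>s\<close>.\<close>

lemma alternating_swap:
  assumes s: "s \<in> S" and t: "t \<in> S"
  shows "word_prod G (alternating k s t) = word_prod G (alternating k t s) \<otimes> (s \<otimes> t) [^] k"
proof (induction k)
  case (Suc k)
  let ?A = "word_prod G (alternating k s t)" and ?B = "word_prod G (alternating k t s)"
  have cl: "?B \<in> carrier G" "?A \<in> carrier G" "(s \<otimes> t) [^] k \<in> carrier G" "(t \<otimes> s) [^] k \<in> carrier G"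
    using s t by simp_all
  have shift: "s \<otimes> (t \<otimes> s) [^] j = (s \<otimes> t) [^] j \<otimes> s" for j :: nat
    using s t by (induction j) (simp_all flip: m_assoc)
  have "t \<otimes> s = inv (s \<otimes> t)"
    using s t by (simp add: inv_mult_group)
  then have canc: "(t \<otimes> s) [^] k \<otimes> (s \<otimes> t) [^] k = \<one>"
    using s t by (simp add: nat_pow_inv)
  have "?A \<otimes> s \<otimes> (s \<otimes> t) [^] Suc k = ?B \<otimes> ((s \<otimes> t) [^] k \<otimes> s) \<otimes> ((s \<otimes> t) [^] k \<otimes> (s \<otimes> t))"
    using Suc cl s t by (simp add: m_assoc)
  also have "\<dots> = ?B \<otimes> (s \<otimes> ((t \<otimes> s) [^] k \<otimes> (s \<otimes> t) [^] k) \<otimes> (s \<otimes> t))"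
    using cl s t by (simp add: m_assoc shift[symmetric])
  also have "\<dots> = ?B \<otimes> t"
    using cl s t by (simp add: canc m_assoc)
  finally show ?case using s t by simp
qed simp

end

section \<open>Positivity of roots\<close>

context coxeter_root_system
begin

abbreviation V :: "'v set" where "V \<equiv> span (\<alpha> ` S)"

definition coef :: "'a \<Rightarrow> 'v \<Rightarrow> real" where
  "coef s v = representation (\<alpha> ` S) v (\<alpha> s)"

lemma finite_S [simp]: "finite S"
  using finite_carrier gens_in_carrier finite_subset by blast

lemma simple_in_V [simp]: "s \<in> S \<Longrightarrow> \<alpha> s \<in> V"
  by (simp add: span_base)

lemma simple_nonzero [simp]: "s \<in> S \<Longrightarrow> \<alpha> s \<noteq> 0"
  using simple_independent dependent_zero by (metis imageI)

lemma simple_eq_iff [simp]: "s \<in> S \<Longrightarrow> t \<in> S \<Longrightarrow> \<alpha> s = \<alpha> t \<longleftrightarrow> s = t"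
  using simple_inj by (meson inj_on_eq_iff)

lemma coef_add [simp]: "x \<in> V \<Longrightarrow> y \<in> V \<Longrightarrow> coef s (x + y) = coef s x + coef s y"
  by (simp add: coef_def representation_add simple_independent)

lemma coef_scale [simp]: "x \<in> V \<Longrightarrow> coef s (k *\<^sub>R x) = k * coef s x"
  by (simp add: coef_def representation_scale simple_independent)

lemma coef_zero [simp]: "coef s 0 = 0"
  by (simp add: coef_def representation_zero)

lemma coef_uminus [simp]: "x \<in> V \<Longrightarrow> coef s (- x) = - coef s x"
  by (simp add: coef_def representation_neg simple_independent)

lemma coef_diff [simp]: "x \<in> V \<Longrightarrow> y \<in> V \<Longrightarrow> coef s (x - y) = coef s x - coef s y"
  by (simp add: coef_def representation_diff simple_independent)

lemma coef_simple [simp]: "s \<in> S \<Longrightarrow> t \<in> S \<Longrightarrow> coef s (\<alpha> t) = (if s = t then 1 else 0)"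
  by (auto simp: coef_def representation_basis simple_independent)

lemma coef_sum: "(\<And>i. i \<in> A \<Longrightarrow> f i \<in> V) \<Longrightarrow> coef s (sum f A) = (\<Sum>i\<in>A. coef s (f i))"
  by (simp add: coef_def representation_sum simple_independent)

lemma expansion: 
  assumes "v \<in> V" shows "v = (\<Sum>s\<in>S. coef s v *\<^sub>R \<alpha> s)"
proof -
  have "(\<Sum>b\<in>\<alpha> ` S. representation (\<alpha> ` S) v b *\<^sub>R b) = v"
    using assms by (intro sum_representation_eq) (auto simp: simple_independent)
  then show ?thesis
    by (simp add: sum.reindex[OF simple_inj] coef_def)
qed

lemma coef_eqI: 
  assumes "x \<in> V" "y \<in> V" "\<And>s. s \<in> S \<Longrightarrow> coef s x = coef s y" shows "x = y"
  using expansion[OF assms(1)] expansion[OF assms(2)] assms(3) by simp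

lemma coef_combination:
  assumes "J \<subseteq> S" "s \<in> S"
  shows "coef s (\<Sum>t\<in>J. k t *\<^sub>R \<alpha> t) = (if s \<in> J then k s else 0)"
proof -
  have fin: "finite J" using assms finite_subset[OF _ finite_S] by blast
  have "coef s (\<Sum>t\<in>J. k t *\<^sub>R \<alpha> t) = (\<Sum>t\<in>J. if t = s then k t else 0)"
    using assms by (subst coef_sum) (auto intro!: span_scale sum.cong)
  also have "\<dots> = (if s \<in> J then k s else 0)"
    using fin by (simp add: sum.delta)
  finally show ?thesis .
qed

lemma expansion_supported:
  assumes "v \<in> V" "J \<subseteq> S" "\<And>s. s \<in> S - J \<Longrightarrow> coef s v = 0"
  shows "v = (\<Sum>s\<in>J. coef s v *\<^sub>R \<alpha> s)"
proof -
  have "v = (\<Sum>s\<in>S. coef s v *\<^sub>R \<alpha> s)" using assms(1) by (rule expansion)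
  also have "\<dots> = (\<Sum>s\<in>J. coef s v *\<^sub>R \<alpha> s)"
    using assms by (intro sum.mono_neutral_right) auto
  finally show ?thesis .
qed

lemma span_supported:
  assumes "v \<in> span (\<alpha> ` J)" "J \<subseteq> S" "s \<in> S - J"
  shows "coef s v = 0"
proof -
  have "v \<in> V \<and> coef s v = 0"
    using assms(1)
  proof (induction rule: span_induct_alt)
    case (step c x y)
    then have "x \<in> V" "coef s x = 0" using assms by auto
    then show ?case using step by (simp add: span_scale span_add)
  qed (simp add: span_zero)
  then show ?thesis ..
qed

section \<open>The orthogonal action of the group on \<open>V\<close>\<close>

lemma act_gen_reflection: "s \<in> S \<Longrightarrow> v \<in> V \<Longrightarrow> act s v = reflection (\<alpha> s) v"
  by (simp add: act_gen reflection_def)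

lemma reflection_in_V [simp]: "\<beta> \<in> V \<Longrightarrow> v \<in> V \<Longrightarrow> reflection \<beta> v \<in> V"
  by (simp add: reflection_def span_diff span_scale)

lemma act_in_V [simp]: "w \<in> carrier G \<Longrightarrow> v \<in> V \<Longrightarrow> act w v \<in> V"
  by (induction rule: carrier_induct) (auto simp: act_one act_mult act_gen_reflection)

lemma act_add [simp]:
  "w \<in> carrier G \<Longrightarrow> x \<in> V \<Longrightarrow> y \<in> V \<Longrightarrow> act w (x + y) = act w x + act w y"
  by (induction rule: carrier_induct) (auto simp: act_one act_mult act_gen_reflection span_add reflection_add)

lemma act_scale [simp]:
  "w \<in> carrier G \<Longrightarrow> x \<in> V \<Longrightarrow> act w (k *\<^sub>R x) = k *\<^sub>R act w x"
  by (induction rule: carrier_induct) (auto simp: act_one act_mult act_gen_reflection span_scale reflection_scale)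

lemma act_inner [simp]:
  "w \<in> carrier G \<Longrightarrow> x \<in> V \<Longrightarrow> y \<in> V \<Longrightarrow> inner (act w x) (act w y) = inner x y"
  by (induction rule: carrier_induct) (auto simp: act_one act_mult act_gen_reflection inner_reflection)

lemma act_uminus [simp]: "w \<in> carrier G \<Longrightarrow> x \<in> V \<Longrightarrow> act w (- x) = - act w x"
  using act_scale[of w x "-1"] by simp

lemma act_diff: "w \<in> carrier G \<Longrightarrow> x \<in> V \<Longrightarrow> y \<in> V \<Longrightarrow> act w (x - y) = act w x - act w y"
  using act_add[of w x "-y"] by (simp add: span_neg)

lemma act_inv_act [simp]: "w \<in> carrier G \<Longrightarrow> x \<in> V \<Longrightarrow> act (inv w) (act w x) = x"
  by (simp add: act_mult[symmetric] act_one)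

lemma act_act_inv [simp]: "w \<in> carrier G \<Longrightarrow> x \<in> V \<Longrightarrow> act w (act (inv w) x) = x"
  by (simp add: act_mult[symmetric] act_one)

lemma act_gen_gen [simp]: "s \<in> S \<Longrightarrow> x \<in> V \<Longrightarrow> act s (act s x) = x"
  by (simp add: act_gen_reflection)

lemma act_inj: "w \<in> carrier G \<Longrightarrow> x \<in> V \<Longrightarrow> y \<in> V \<Longrightarrow> act w x = act w y \<longleftrightarrow> x = y"
  by (metis act_inv_act)

lemma act_gen_simple [simp]: "s \<in> S \<Longrightarrow> act s (\<alpha> s) = - \<alpha> s"
  by (simp add: act_gen_reflection reflection_self)

lemma act_reflection:
  "w \<in> carrier G \<Longrightarrow> x \<in> V \<Longrightarrow> y \<in> V \<Longrightarrow> act w (reflection x y) = reflection (act w x) (act w y)"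
  by (simp add: reflection_def act_diff span_scale)

lemma coef_act_gen:
  assumes "s \<in> S" "t \<in> S" "s \<noteq> t" "v \<in> V" shows "coef t (act s v) = coef t v"
  using assms by (simp add: act_gen span_scale)

lemma act_sum: "w \<in> carrier G \<Longrightarrow> (\<And>i. i \<in> A \<Longrightarrow> f i \<in> V) \<Longrightarrow> act w (sum f A) = (\<Sum>i\<in>A. act w (f i))"
proof (induction A rule: infinite_finite_induct)
  case (insert x F)
  then show ?case by (simp add: span_sum)
next
  case empty
  then show ?case using act_scale[of w 0 0] by (simp add: span_zero)
next
  case (infinite A)
  then show ?case using act_scale[of w 0 0] by (simp add: span_zero)
qed

abbreviation \<Phi> :: "'v set" where "\<Phi> \<equiv> parabolic_roots G act \<alpha> S"

definition nonneg :: "'v \<Rightarrow> bool" where "nonneg v \<longleftrightarrow> v \<in> V \<and> (\<forall>s\<in>S. 0 \<le> coef s v)"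

lemma nonneg_add: "nonneg x \<Longrightarrow> nonneg y \<Longrightarrow> nonneg (x + y)"
  by (simp add: nonneg_def span_add)

lemma nonneg_scale: "nonneg x \<Longrightarrow> 0 \<le> k \<Longrightarrow> nonneg (k *\<^sub>R x)"
  by (simp add: nonneg_def span_scale)

lemma nonneg_antisym: "nonneg x \<Longrightarrow> nonneg (- x) \<Longrightarrow> x = 0"
  by (rule coef_eqI) (auto simp: nonneg_def span_zero intro!: antisym)

lemma nonneg_simple [simp]: "s \<in> S \<Longrightarrow> nonneg (\<alpha> s)"
  by (simp add: nonneg_def)

text \<open>The lengths of the simple roots are free. After normalization the action of two
  generators on their plane depends on the angle alone.\<close>

definition unit_root :: "'a \<Rightarrow> 'v" where "unit_root s = \<alpha> s /\<^sub>R norm (\<alpha> s)"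

lemma unit_root_in_V [simp]: "s \<in> S \<Longrightarrow> unit_root s \<in> V"
  by (simp add: unit_root_def span_scale)

lemma ord_ge_2: 
  assumes "s \<in> S" "t \<in> S" "s \<noteq> t" shows "2 \<le> ord (s \<otimes> t)"
proof -
  have "ord (s \<otimes> t) \<ge> 1"
    using assms finite_carrier by (intro ord_ge_1) auto
  moreover have "ord (s \<otimes> t) \<noteq> 1"
  proof
    assume "ord (s \<otimes> t) = 1"
    then have "s \<otimes> t = \<one>" using assms ord_eq_1[of "s \<otimes> t"] by simp
    then have "inv t = s" using assms by (intro inv_equality) auto
    then show False using assms by simp
  qed
  ultimately show ?thesis by linarith
qed

lemma act_unit_root:
  assumes "s \<in> S" "t \<in> S"
  shows "act s (unit_root t) = unit_root t + (2 * cos (pi / real (ord (s \<otimes> t)))) *\<^sub>R unit_root s"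
proof -
  have n: "norm (\<alpha> s) \<noteq> 0" "norm (\<alpha> t) \<noteq> 0" using assms by auto
  have i: "inner (\<alpha> s) (\<alpha> s) = norm (\<alpha> s) * norm (\<alpha> s)"
    by (simp add: norm_eq_sqrt_inner)
  have "inner (\<alpha> t) (\<alpha> s) = - cos (pi / real (ord (s \<otimes> t))) * norm (\<alpha> s) * norm (\<alpha> t)"
    using simple_angles[OF assms] by (simp add: inner_commute)
  then show ?thesis
    using n assms by (simp add: act_gen unit_root_def i scaleR_right_distrib) (simp add: field_simps)
qed

text \<open>The coordinates of the successive images obey the three-term recursion of the sine,
  which is \<open>rec\<close>. The factor \<open>sin \<theta>\<close> stays on the left to avoid a
  division, and the parity of \<open>k\<close> tells which generator acted last.\<close>

lemma unit_root_alternating: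
  assumes s: "s \<in> S" and t: "t \<in> S" and "s \<noteq> t" and \<theta>: "\<theta> = pi / real (ord (s \<otimes> t))"
  shows "sin \<theta> *\<^sub>R act (word_prod G (alternating k s t)) (unit_root s) =
    (if even k then sin ((real k + 1) * \<theta>) *\<^sub>R unit_root s + sin (real k * \<theta>) *\<^sub>R unit_root t
     else sin ((real k + 1) * \<theta>) *\<^sub>R unit_root t + sin (real k * \<theta>) *\<^sub>R unit_root s)"
proof (induction k)
  case 0
  then show ?case using s by (simp add: act_one)
next
  case (Suc k)
  have "ord (t \<otimes> s) = ord (s \<otimes> t)"
    using s t ord_inv[of "s \<otimes> t"] by (simp add: inv_mult_group)
  then have ts: "act t (unit_root s) = unit_root s + (2 * cos \<theta>) *\<^sub>R unit_root t"
    and st: "act s (unit_root t) = unit_root t + (2 * cos \<theta>) *\<^sub>R unit_root s"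
    using s t act_unit_root[of s t] act_unit_root[of t s] by (auto simp: \<theta>)
  have neg: "act r (unit_root r) = - unit_root r" if "r \<in> S" for r
    using that by (simp add: unit_root_def)
  have rec: "2 * cos \<theta> * sin ((real k + 1) * \<theta>) - sin (real k * \<theta>) = sin ((real k + 2) * \<theta>)"
    using sin_add[of "(real k + 1) * \<theta>" \<theta>] sin_diff[of "(real k + 1) * \<theta>" \<theta>]
    by (simp add: algebra_simps)
  have suc: "real (Suc k) = real k + 1" "real k + 1 + 1 = real k + 2" by simp_all
  have step: "act r (a *\<^sub>R unit_root q + b *\<^sub>R unit_root r) =
      (2 * cos \<theta> * a - b) *\<^sub>R unit_root r + a *\<^sub>R unit_root q"
    if "q \<in> S" "r \<in> S" "act r (unit_root q) = unit_root q + (2 * cos \<theta>) *\<^sub>R unit_root r" for a b q r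
    using that by (simp add: span_scale neg scaleR_right_distrib scaleR_left_diff_distrib mult.commute)
  let ?r = "if even k then t else s"
  let ?w = "word_prod G (alternating k s t)"
  have w: "?w \<in> carrier G" "?r \<in> S" using s t by auto
  have "act (word_prod G (alternating (Suc k) s t)) (unit_root s) = act ?r (act ?w (unit_root s))"
    unfolding alternating_Cons word_prod_Cons using w s by (intro act_mult) auto
  then have "sin \<theta> *\<^sub>R act (word_prod G (alternating (Suc k) s t)) (unit_root s) =
      act ?r (sin \<theta> *\<^sub>R act ?w (unit_root s))"
    using w s by (simp del: alternating.simps)
  also have "\<dots> = (if even (Suc k) then sin ((real (Suc k) + 1) * \<theta>) *\<^sub>R unit_root s + sin (real (Suc k) * \<theta>) *\<^sub>R unit_root t
     else sin ((real (Suc k) + 1) * \<theta>) *\<^sub>R unit_root t + sin (real (Suc k) * \<theta>) *\<^sub>R unit_root s)"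
    using step[OF s t ts, of "sin ((real k + 1) * \<theta>)" "sin (real k * \<theta>)"]
      step[OF t s st, of "sin ((real k + 1) * \<theta>)" "sin (real k * \<theta>)"] rec
    unfolding Suc.IH suc by (cases "even k") (simp_all only: even_Suc if_True if_False simp_thms)
  finally show ?case .
qed

text \<open>The bound on \<open>k\<close> keeps both angles \<open>real k * \<theta>\<close> and
  \<open>(real k + 1) * \<theta>\<close> between 0 and \<open>pi\<close>, where the sine is
  nonnegative.\<close>

lemma dihedral_nonneg:
  assumes s: "s \<in> S" and t: "t \<in> S" and "s \<noteq> t" and k: "k < ord (s \<otimes> t)"
  shows "\<exists>a b. 0 \<le> a \<and> 0 \<le> b \<and>
    act (word_prod G (alternating k s t)) (\<alpha> s) = a *\<^sub>R \<alpha> s + b *\<^sub>R \<alpha> t"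
proof -
  define \<theta> where "\<theta> = pi / real (ord (s \<otimes> t))"
  have m: "2 \<le> ord (s \<otimes> t)" using ord_ge_2 assms by blast
  then have th: "0 < \<theta>" "\<theta> < pi" by (auto simp: \<theta>_def field_simps)
  have pos: "0 < sin \<theta>" using th by (intro sin_gt_zero) auto
  have nn: "0 \<le> sin (real j * \<theta>)" if "j \<le> ord (s \<otimes> t)" for j
  proof (rule sin_ge_zero)
    show "0 \<le> real j * \<theta>" using th by simp
    have "real j * pi \<le> real (ord (s \<otimes> t)) * pi" using that by simp
    then show "real j * \<theta> \<le> pi"
      using m by (simp add: \<theta>_def field_simps)
  qed
  have n0: "norm (\<alpha> s) > 0" "norm (\<alpha> t) > 0" using s t by auto
  define c d where "c = sin ((real k + 1) * \<theta>)" and "d = sin (real k * \<theta>)"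
  have cd: "0 \<le> c" "0 \<le> d"
    using nn[of "Suc k"] nn[of k] k by (auto simp: c_def d_def algebra_simps)
  let ?w = "word_prod G (alternating k s t)"
  obtain a b where ab: "0 \<le> a" "0 \<le> b" "sin \<theta> *\<^sub>R act ?w (unit_root s) = a *\<^sub>R unit_root s + b *\<^sub>R unit_root t"
    using unit_root_alternating[OF s t \<open>s \<noteq> t\<close> \<theta>_def, of k] cd
    by (cases "even k") (auto simp: c_def d_def add.commute)
  have "\<alpha> s = (norm (\<alpha> s) / sin \<theta>) *\<^sub>R (sin \<theta> *\<^sub>R unit_root s)"
    using n0 pos by (simp add: unit_root_def)
  then have "act ?w (\<alpha> s) = (norm (\<alpha> s) / sin \<theta>) *\<^sub>R (sin \<theta> *\<^sub>R act ?w (unit_root s))"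
  proof -
    assume *: "\<alpha> s = (norm (\<alpha> s) / sin \<theta>) *\<^sub>R (sin \<theta> *\<^sub>R unit_root s)"
    have "act ?w (\<alpha> s) = act ?w ((norm (\<alpha> s) / sin \<theta>) *\<^sub>R (sin \<theta> *\<^sub>R unit_root s))"
      using * by (rule arg_cong)
    also have "\<dots> = (norm (\<alpha> s) / sin \<theta>) *\<^sub>R (sin \<theta> *\<^sub>R act ?w (unit_root s))"
      using s t by (simp only: act_scale span_scale unit_root_in_V word_prod_closed set_alternating_gens)
    finally show ?thesis .
  qed
  also have "\<dots> = (norm (\<alpha> s) / sin \<theta> * a / norm (\<alpha> s)) *\<^sub>R \<alpha> s + (norm (\<alpha> s) / sin \<theta> * b / norm (\<alpha> t)) *\<^sub>R \<alpha> t"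
    unfolding ab by (simp add: unit_root_def scaleR_right_distrib divide_inverse mult.assoc)
  finally show ?thesis
    using ab n0 pos by (intro exI conjI) (auto intro!: divide_nonneg_nonneg mult_nonneg_nonneg)
qed

lemma len_mult_gen: "w \<in> carrier G \<Longrightarrow> s \<in> S \<Longrightarrow> len (w \<otimes> s) \<le> Suc (len w)"
  using len_mult_le[of w s] len_gen_le[of s] by simp

text \<open>Reduction to rank two: given a descent \<open>t\<close>, strip from \<open>w\<close> the
  longest right factor that alternates in \<open>s\<close> and \<open>t\<close>. The remaining
  \<open>v\<close> is shorter and descends along neither of them, so the induction hypothesis
  applies to both, and the factor sends \<open>\<alpha> s\<close> to a nonnegative combination of
  \<open>\<alpha> s\<close> and \<open>\<alpha> t\<close>.\<close>

lemma ascent_nonneg: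
  assumes "w \<in> carrier G" "s \<in> S" "len w \<le> len (w \<otimes> s)"
  shows "nonneg (act w (\<alpha> s))"
  using assms
proof (induction "len w" arbitrary: w s rule: less_induct)
  case less
  note w = \<open>w \<in> carrier G\<close> and s = \<open>s \<in> S\<close>
  show ?case
  proof (cases "w = \<one>")
    case True
    then show ?thesis using s by (simp add: act_one)
  next
    case False
    then obtain t where t: "t \<in> S" "len (w \<otimes> t) < len w"
      using exists_right_descent w by blast
    then have st: "s \<noteq> t" using less by auto
    \<comment> \<open>\<open>P k\<close> means that \<open>w\<close> ends, without loss of length,
      in the alternating word with \<open>k\<close> letters. The descent \<open>t\<close> gives
      \<open>P 1\<close>, and \<open>len w\<close> bounds \<open>k\<close>, so a greatest such
      \<open>k\<close> exists.\<close>
    define P where "P k \<longleftrightarrow> (\<exists>v. v \<in> carrier G \<and> w = v \<otimes> word_prod G (alternating k s t) \<and> len w = len v + k)" for k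
    have "P 1"
      unfolding P_def
    proof (intro exI conjI)
      show "w \<otimes> t \<in> carrier G" using w t by simp
      show "w = w \<otimes> t \<otimes> word_prod G (alternating 1 s t)" using w t by simp
      have "len w \<le> Suc (len (w \<otimes> t))"
        using len_mult_gen[of "w \<otimes> t" t] w t by simp
      then show "len w = len (w \<otimes> t) + 1" using t by simp
    qed
    moreover have bound: "\<forall>k. P k \<longrightarrow> k \<le> len w" unfolding P_def by auto
    ultimately have "P (GREATEST k. P k)" and "1 \<le> (GREATEST k. P k)"
      using GreatestI_nat[of P 1 "len w"] Greatest_le_nat[of P 1 "len w"] by blast+
    moreover have "\<not> P (Suc (GREATEST k. P k))"
      using Greatest_le_nat[of P "Suc (GREATEST k. P k)" "len w"] bound by force
    ultimately obtain k where k: "P k" "1 \<le> k" "\<not> P (Suc k)" by blast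
    then obtain v where v: "v \<in> carrier G" "w = v \<otimes> word_prod G (alternating k s t)" "len w = len v + k"
      unfolding P_def by blast
    obtain j where j: "k = Suc j" using k(2) by (cases k) auto
    \<comment> \<open>By \<open>alternating_Cons\<close>, \<open>a\<close> is the first letter of
      the alternating factor and \<open>b\<close> the letter that would prolong it to the left. A
      descent of \<open>v\<close> along \<open>b\<close> contradicts the maximality of
      \<open>k\<close>; a descent along \<open>a\<close> cancels the first letter and makes
      \<open>w\<close> too short.\<close>
    define a b where "a = (if even j then t else s)" and "b = (if even k then t else s)"
    have ab: "a \<in> S" "b \<in> S" "{a, b} = {s, t}" using s t by (auto simp: a_def b_def j)
    have alt: "set (alternating i s t) \<subseteq> S" for i
      using s t(1) by (rule set_alternating_gens)
    have vb: "len v \<le> len (v \<otimes> b)"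
    proof (rule ccontr)
      assume "\<not> len v \<le> len (v \<otimes> b)"
      moreover have "len v \<le> Suc (len (v \<otimes> b))"
        using len_mult_gen[of "v \<otimes> b" b] v ab by simp
      ultimately have "len w = len (v \<otimes> b) + Suc k" using v by simp
      moreover have "w = (v \<otimes> b) \<otimes> word_prod G (alternating (Suc k) s t)"
        unfolding alternating_Cons word_prod_Cons b_def[symmetric]
        using v ab alt by (simp add: m_assoc)
      ultimately have "P (Suc k)" unfolding P_def using v ab by (intro exI[of _ "v \<otimes> b"]) simp
      with k show False by blast
    qed
    have va: "len v \<le> len (v \<otimes> a)"
    proof (rule ccontr)
      assume *: "\<not> len v \<le> len (v \<otimes> a)"
      have "w = (v \<otimes> a) \<otimes> word_prod G (alternating j s t)"
        using v(1) ab(1) alt[of j] unfolding v(2) j alternating_Cons word_prod_Cons a_def[symmetric]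
        by (simp add: m_assoc)
      then have "len w \<le> len (v \<otimes> a) + j"
        using len_mult_le[of "v \<otimes> a" "word_prod G (alternating j s t)"] len_word_le[OF alt[of j]] v ab alt
        by simp
      with * v j show False by simp
    qed
    have lt: "len v < len w" using v k by simp
    have "nonneg (act v (\<alpha> a))" "nonneg (act v (\<alpha> b))"
      using less.hyps[OF lt] v ab va vb by auto
    then have nn: "nonneg (act v (\<alpha> s))" "nonneg (act v (\<alpha> t))"
      using ab(3) by (auto simp: doubleton_eq_iff)
    \<comment> \<open>Otherwise the factor ends in a full side of the braid relation. Rewritten by
      it, the factor ends in \<open>s\<close>, so that \<open>w \<otimes> s\<close> would be shorter
      than \<open>w\<close>.\<close>
    have "k < ord (s \<otimes> t)"
    proof (rule ccontr)
      let ?m = "ord (s \<otimes> t)"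
      assume "\<not> k < ?m"
      then have km: "k - ?m + ?m = k" by simp
      obtain d where d: "set d \<subseteq> {s, t}" "length d = k - ?m" "alternating k s t = d @ alternating ?m s t"
        using alternating_add[of s t "k - ?m" ?m] km by auto
      have dS: "set d \<subseteq> S" using d s t by auto
      obtain i where i: "?m = Suc i" using ord_ge_2[OF s t(1) st] by (cases ?m) auto
      have "word_prod G (alternating ?m s t) = word_prod G (alternating ?m t s)"
        using alternating_swap[OF s t(1), of ?m] s t by simp
      also have "\<dots> = word_prod G (alternating i s t) \<otimes> s"
        using s t i by simp
      finally have "w = v \<otimes> (word_prod G d \<otimes> (word_prod G (alternating i s t) \<otimes> s))"
        using v(2) d(3) dS alt by simp
      then have "w \<otimes> s = v \<otimes> (word_prod G (d @ alternating i s t))"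
        using v s t dS alt by (simp add: m_assoc)
      then have "len (w \<otimes> s) \<le> len v + len (word_prod G (d @ alternating i s t))"
        using len_mult_le v dS alt by simp
      also have "\<dots> \<le> len v + length (d @ alternating i s t)"
        using len_word_le[of "d @ alternating i s t"] dS alt by simp
      also have "\<dots> < len w" using d i v km by simp
      finally show False using less.prems by simp
    qed
    then obtain x y where xy: "0 \<le> x" "0 \<le> y" 
      "act (word_prod G (alternating k s t)) (\<alpha> s) = x *\<^sub>R \<alpha> s + y *\<^sub>R \<alpha> t"
      using dihedral_nonneg[OF s t(1) st] by blast
    have "act w (\<alpha> s) = act v (x *\<^sub>R \<alpha> s + y *\<^sub>R \<alpha> t)"
      using v s alt[of k] xy by (simp add: act_mult)
    also have "\<dots> = x *\<^sub>R act v (\<alpha> s) + y *\<^sub>R act v (\<alpha> t)"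
      using v s t by (simp add: span_scale)
    finally show ?thesis using nn xy by (simp add: nonneg_add nonneg_scale)
  qed
qed

lemma descent_nonpos:
  assumes "w \<in> carrier G" "s \<in> S" "len (w \<otimes> s) < len w"
  shows "nonneg (- act w (\<alpha> s))"
proof -
  have "nonneg (act (w \<otimes> s) (\<alpha> s))"
    using assms by (intro ascent_nonneg) auto
  then show ?thesis using assms by (simp add: act_mult)
qed

subsection \<open>Inversions and the longest element\<close>

abbreviation Pos :: "'v set" where "Pos \<equiv> positive_roots G act \<alpha> S"

lemma roots_eq: "\<Phi> = {act w (\<alpha> s) | w s. w \<in> carrier G \<and> s \<in> S}"
  by (simp add: parabolic_roots_def gens_generate)

lemma root_in_V [simp]: "\<beta> \<in> \<Phi> \<Longrightarrow> \<beta> \<in> V"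
  by (auto simp: roots_eq)

lemma simple_root [simp]: "s \<in> S \<Longrightarrow> \<alpha> s \<in> \<Phi>"
  unfolding roots_eq by (force simp: act_one)

lemma act_root [simp]:
  assumes "w \<in> carrier G" "\<beta> \<in> \<Phi>" shows "act w \<beta> \<in> \<Phi>"
proof -
  obtain v s where "v \<in> carrier G" "s \<in> S" "\<beta> = act v (\<alpha> s)"
    using assms(2) by (auto simp: roots_eq)
  then have "act w \<beta> = act (w \<otimes> v) (\<alpha> s)" "w \<otimes> v \<in> carrier G" "s \<in> S"
    using assms(1) by (auto simp: act_mult)
  then show ?thesis unfolding roots_eq by blast
qed

lemma uminus_root:
  assumes "\<beta> \<in> \<Phi>" shows "- \<beta> \<in> \<Phi>"
proof -
  obtain v s where "v \<in> carrier G" "s \<in> S" "\<beta> = act v (\<alpha> s)"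
    using assms by (auto simp: roots_eq)
  then have "- \<beta> = act v (act s (\<alpha> s))" by simp
  then show ?thesis using \<open>v \<in> carrier G\<close> \<open>s \<in> S\<close> by (metis act_root gen_in_carrier simple_root)
qed

lemma finite_roots: "finite \<Phi>"
proof -
  have "\<Phi> = (\<lambda>(w, s). act w (\<alpha> s)) ` (carrier G \<times> S)"
    by (auto simp: roots_eq)
  then show ?thesis using finite_carrier by simp
qed

lemma root_nonzero:
  assumes "\<beta> \<in> \<Phi>" shows "\<beta> \<noteq> 0"
proof -
  obtain v s where "v \<in> carrier G" "s \<in> S" "\<beta> = act v (\<alpha> s)"
    using assms by (auto simp: roots_eq)
  then have "inner \<beta> \<beta> = inner (\<alpha> s) (\<alpha> s)" "\<alpha> s \<noteq> 0" by auto
  then show ?thesis by auto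
qed

lemma Pos_iff: "\<beta> \<in> Pos \<longleftrightarrow> \<beta> \<in> \<Phi> \<and> nonneg \<beta>"
proof
  assume "\<beta> \<in> Pos"
  then obtain k where "\<beta> \<in> \<Phi>" "\<forall>s\<in>S. 0 \<le> k s" "\<beta> = (\<Sum>s\<in>S. k s *\<^sub>R \<alpha> s)"
    by (auto simp: positive_roots_def)
  then show "\<beta> \<in> \<Phi> \<and> nonneg \<beta>"
    by (simp add: nonneg_def coef_combination span_sum span_scale)
next
  assume "\<beta> \<in> \<Phi> \<and> nonneg \<beta>"
  then show "\<beta> \<in> Pos"
    using expansion[of \<beta>] by (auto simp: positive_roots_def nonneg_def intro!: exI[of _ "\<lambda>s. coef s \<beta>"])
qed

lemma Pos_root: "\<beta> \<in> Pos \<Longrightarrow> \<beta> \<in> \<Phi>"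
  by (simp add: Pos_iff)

lemma Pos_in_V [simp]: "\<beta> \<in> Pos \<Longrightarrow> \<beta> \<in> V"
  by (simp add: Pos_iff)

lemma Pos_coef: "\<beta> \<in> Pos \<Longrightarrow> s \<in> S \<Longrightarrow> 0 \<le> coef s \<beta>"
  by (simp add: Pos_iff nonneg_def)

lemma finite_Pos [simp]: "finite Pos"
  using finite_roots by (rule finite_subset[rotated]) (auto simp: Pos_iff)

lemma simple_Pos [simp]: "s \<in> S \<Longrightarrow> \<alpha> s \<in> Pos"
  by (simp add: Pos_iff)

lemma Pos_not_uminus: "\<beta> \<in> Pos \<Longrightarrow> - \<beta> \<notin> Pos"
  using nonneg_antisym root_nonzero by (auto simp: Pos_iff)

lemma Pos_or_uminus: 
  assumes "\<beta> \<in> \<Phi>" shows "\<beta> \<in> Pos \<or> - \<beta> \<in> Pos"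
proof -
  obtain w s where ws: "w \<in> carrier G" "s \<in> S" "\<beta> = act w (\<alpha> s)"
    using assms by (auto simp: roots_eq)
  then show ?thesis
    using ascent_nonneg[of w s] descent_nonpos[of w s] assms uminus_root[OF assms]
    by (cases "len w \<le> len (w \<otimes> s)") (auto simp: Pos_iff)
qed

lemma uminus_Pos_iff: "\<beta> \<in> \<Phi> \<Longrightarrow> - \<beta> \<in> Pos \<longleftrightarrow> \<beta> \<notin> Pos"
  using Pos_or_uminus Pos_not_uminus by (metis add.inverse_inverse)

text \<open>The lengths of the simple roots enter here: \<open>roots_reduced\<close> keeps a simple
  root of one orbit from being a multiple of a root in another.\<close>

lemma Pos_proportional:
  assumes "\<beta> \<in> Pos" "s \<in> S" "\<And>t. t \<in> S \<Longrightarrow> t \<noteq> s \<Longrightarrow> coef t \<beta> = 0"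
  shows "\<beta> = \<alpha> s"
proof -
  have eq: "\<beta> = coef s \<beta> *\<^sub>R \<alpha> s"
    using assms by (intro coef_eqI) (auto simp: span_scale)
  then have "coef s \<beta> = 1 \<or> coef s \<beta> = -1"
    using assms by (intro roots_reduced[of "\<alpha> s"]) (auto simp: Pos_iff)
  then show ?thesis using eq Pos_coef[OF assms(1,2)] by auto
qed

text \<open>The reflection changes the coefficient at \<open>\<alpha> s\<close> only. A positive
  root turned negative can therefore have no other nonzero coefficient.\<close>

lemma gen_Pos:
  assumes "s \<in> S" "\<beta> \<in> Pos" "\<beta> \<noteq> \<alpha> s" shows "act s \<beta> \<in> Pos"
proof (rule ccontr)
  assume "act s \<beta> \<notin> Pos"
  then have neg: "- act s \<beta> \<in> Pos"
    using Pos_or_uminus[of "act s \<beta>"] assms by (auto simp: Pos_root)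
  have "coef t \<beta> = 0" if t: "t \<in> S" "t \<noteq> s" for t
    using Pos_coef[OF neg t(1)] Pos_coef[OF assms(2) t(1)] coef_act_gen[OF assms(1) t(1), of \<beta>] assms t
    by simp
  then show False using Pos_proportional assms by blast
qed

text \<open>The inverse of \<open>w\<close> is used because the prefixes of a reduced word of
  \<open>w\<close> enumerate this set, in the same form as the roots attached to the letters of the
  sorting word.\<close>

definition inversions :: "'a \<Rightarrow> 'v set" where
  "inversions w = {\<beta> \<in> Pos. - act (inv w) \<beta> \<in> Pos}"

lemma finite_inversions [simp]: "finite (inversions w)"
  by (rule finite_subset[OF _ finite_Pos]) (auto simp: inversions_def)

lemma inversions_one [simp]: "inversions \<one> = {}"
  by (auto simp: inversions_def act_one Pos_not_uminus)

lemma inversions_mult_gen: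
  assumes w: "w \<in> carrier G" and s: "s \<in> S" and pos: "act w (\<alpha> s) \<in> Pos"
  shows "inversions (w \<otimes> s) = insert (act w (\<alpha> s)) (inversions w)" "act w (\<alpha> s) \<notin> inversions w"
proof -
  show "act w (\<alpha> s) \<notin> inversions w"
    using w s Pos_not_uminus[OF simple_Pos] by (simp add: inversions_def)
  have "\<beta> \<in> inversions (w \<otimes> s) \<longleftrightarrow> \<beta> = act w (\<alpha> s) \<or> \<beta> \<in> inversions w" if b: "\<beta> \<in> Pos" for \<beta>
  proof -
    define \<gamma> where "\<gamma> = act (inv w) \<beta>"
    have g: "\<gamma> \<in> \<Phi>" "\<beta> = act w \<gamma>" using b w by (auto simp: \<gamma>_def Pos_root)
    have eq: "act (inv (w \<otimes> s)) \<beta> = act s \<gamma>"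
      using w s b by (simp add: inv_mult_group act_mult \<gamma>_def)
    have ne: "\<gamma> \<noteq> - \<alpha> s"
      using pos b g w s Pos_not_uminus by auto
    have iff: "\<beta> = act w (\<alpha> s) \<longleftrightarrow> \<gamma> = \<alpha> s" using g w s by (simp add: act_inj)
    show ?thesis
    proof (cases "\<gamma> = \<alpha> s")
      case True
      then show ?thesis using b iff eq s by (simp add: inversions_def)
    next
      case False
      have "- act s \<gamma> \<in> Pos \<longleftrightarrow> - \<gamma> \<in> Pos"
      proof
        assume "- \<gamma> \<in> Pos"
        then show "- act s \<gamma> \<in> Pos"
          using gen_Pos[OF s, of "- \<gamma>"] ne g s by (metis act_uminus add.inverse_inverse gen_in_carrier root_in_V)
      next
        assume *: "- act s \<gamma> \<in> Pos"
        show "- \<gamma> \<in> Pos"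
        proof (rule ccontr)
          assume "- \<gamma> \<notin> Pos"
          then have "\<gamma> \<in> Pos" using g uminus_Pos_iff by blast
          then have "act s \<gamma> \<in> Pos" using gen_Pos s False by blast
          then show False using * Pos_not_uminus by blast
        qed
      qed
      then show ?thesis using b iff eq False by (simp add: inversions_def \<gamma>_def)
    qed
  qed
  moreover have "inversions (w \<otimes> s) \<subseteq> Pos" "inversions w \<subseteq> Pos" by (auto simp: inversions_def)
  ultimately show "inversions (w \<otimes> s) = insert (act w (\<alpha> s)) (inversions w)"
    using pos by blast
qed

lemma inversions_gen_mult:
  assumes w: "w \<in> carrier G" and s: "s \<in> S" and "\<alpha> s \<notin> inversions w"
  shows "inversions (s \<otimes> w) = insert (\<alpha> s) (act s ` inversions w)"
proof -
  have "act (inv w) (\<alpha> s) \<in> \<Phi>" using w s by simp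
  then have pos: "act (inv w) (\<alpha> s) \<in> Pos"
    using assms by (auto simp: inversions_def uminus_Pos_iff)
  have eq: "act (inv (s \<otimes> w)) \<beta> = act (inv w) (act s \<beta>)" if "\<beta> \<in> V" for \<beta>
    using that w s by (simp add: inv_mult_group act_mult)
  have "\<beta> \<in> inversions (s \<otimes> w) \<longleftrightarrow> \<beta> = \<alpha> s \<or> \<beta> \<in> act s ` inversions w" if b: "\<beta> \<in> Pos" for \<beta>
  proof (cases "\<beta> = \<alpha> s")
    case True
    then show ?thesis using pos w s by (simp add: inversions_def eq)
  next
    case False
    then have "act s \<beta> \<in> Pos" using gen_Pos s b by blast
    then have "\<beta> \<in> inversions (s \<otimes> w) \<longleftrightarrow> act s \<beta> \<in> inversions w"
      using b by (simp add: inversions_def eq)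
    also have "\<dots> \<longleftrightarrow> \<beta> \<in> act s ` inversions w"
    proof
      assume "act s \<beta> \<in> inversions w"
      moreover have "\<beta> = act s (act s \<beta>)" using b s by simp
      ultimately show "\<beta> \<in> act s ` inversions w" by (rule rev_image_eqI)
    next
      assume "\<beta> \<in> act s ` inversions w"
      then show "act s \<beta> \<in> inversions w" using s by (auto simp: inversions_def)
    qed
    finally show ?thesis using False by blast
  qed
  moreover have "act s \<gamma> \<in> Pos" if "\<gamma> \<in> inversions w" for \<gamma>
    using that assms gen_Pos[OF s, of \<gamma>] by (auto simp: inversions_def)
  moreover have "inversions (s \<otimes> w) \<subseteq> Pos" by (auto simp: inversions_def)
  moreover have "\<alpha> s \<in> Pos" using s by simp
  ultimately show ?thesis by blast
qed

lemma len_inversions: "w \<in> carrier G \<Longrightarrow> len w = card (inversions w)"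
proof (induction "len w" arbitrary: w rule: less_induct)
  case less
  show ?case
  proof (cases "w = \<one>")
    case False
    then obtain t where t: "t \<in> S" "len (w \<otimes> t) < len w"
      using exists_right_descent less.prems by blast
    define v where "v = w \<otimes> t"
    have v: "v \<in> carrier G" "w = v \<otimes> t" using less.prems t by (auto simp: v_def)
    have "len w = Suc (len v)"
      using len_mult_gen[OF v(1) t(1)] t(2) v(2) unfolding v_def[symmetric] by simp
    moreover have "- act w (\<alpha> t) \<in> Pos"
      using descent_nonpos[OF less.prems t] less.prems t by (simp add: Pos_iff uminus_root)
    then have "act v (\<alpha> t) \<in> Pos" using less.prems t by (simp add: v_def act_mult)
    ultimately show ?thesis
      using less.hyps[OF _ v(1)] inversions_mult_gen[OF v(1) t(1)] unfolding v(2)[symmetric] by simp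
  qed simp
qed

lemma len_ascent: "w \<in> carrier G \<Longrightarrow> s \<in> S \<Longrightarrow> act w (\<alpha> s) \<in> Pos \<Longrightarrow> len (w \<otimes> s) = Suc (len w)"
  by (simp add: len_inversions inversions_mult_gen)

lemma ascent_Pos: "w \<in> carrier G \<Longrightarrow> s \<in> S \<Longrightarrow> len w \<le> len (w \<otimes> s) \<Longrightarrow> act w (\<alpha> s) \<in> Pos"
  using ascent_nonneg by (simp add: Pos_iff)

lemma act_faithful:
  assumes "w \<in> carrier G" "\<And>v. v \<in> V \<Longrightarrow> act w v = v" shows "w = \<one>"
proof (rule ccontr)
  assume "w \<noteq> \<one>"
  then obtain t where "t \<in> S" "len (w \<otimes> t) < len w"
    using exists_right_descent assms by blast
  then have "nonneg (- \<alpha> t)" using descent_nonpos[of w t] assms by simp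
  then show False using \<open>t \<in> S\<close> nonneg_antisym[of "\<alpha> t"] by simp
qed

section \<open>Roots along a word\<close>

fun word_roots :: "'a list \<Rightarrow> 'v list" where
  "word_roots [] = []"
| "word_roots (s # u) = \<alpha> s # map (act s) (word_roots u)"

lemma length_word_roots [simp]: "length (word_roots u) = length u"
  by (induction u) auto

lemma word_roots_nth:
  "set u \<subseteq> S \<Longrightarrow> i < length u \<Longrightarrow> word_roots u ! i = act (word_prod G (take i u)) (\<alpha> (u ! i))"
proof (induction u arbitrary: i)
  case (Cons s u)
  show ?case
  proof (cases i)
    case 0
    then show ?thesis using Cons.prems by (simp add: act_one)
  next
    case (Suc j)
    have "u ! j \<in> S" "set (take j u) \<subseteq> S"
      using Cons.prems Suc by (auto dest: in_set_takeD)
    then show ?thesis using Suc Cons by (simp add: act_mult)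
  qed
qed simp

lemma word_roots_roots: "set u \<subseteq> S \<Longrightarrow> set (word_roots u) \<subseteq> \<Phi>"
  by (induction u) auto

lemma word_roots_snoc:
  "set u \<subseteq> S \<Longrightarrow> s \<in> S \<Longrightarrow> word_roots (u @ [s]) = word_roots u @ [act (word_prod G u) (\<alpha> s)]"
  by (induction u) (auto simp: act_one act_mult)

lemma reduced_word_roots:
  assumes "set u \<subseteq> S" "length u = len (word_prod G u)"
  shows "set (word_roots u) = inversions (word_prod G u) \<and> distinct (word_roots u)"
  using assms
proof (induction u rule: rev_induct)
  case (snoc s u)
  then have S: "set u \<subseteq> S" "s \<in> S" by auto
  let ?w = "word_prod G u"
  have w: "?w \<in> carrier G" using S by simp
  have "len (?w \<otimes> s) = Suc (length u)" using snoc.prems S by simp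
  then have lu: "length u = len ?w" "len ?w \<le> len (?w \<otimes> s)"
    using len_mult_gen[OF w S(2)] len_word_le[OF S(1)] by auto
  then have "act ?w (\<alpha> s) \<in> Pos" using ascent_Pos w S by blast
  then show ?case
    using snoc.IH[OF S(1) lu(1)] inversions_mult_gen[OF w S(2)] S by (simp add: word_roots_snoc)
qed simp

lemma len_inv: 
  assumes "w \<in> carrier G" shows "len (inv w) = len w"
proof -
  have le: "len (inv v) \<le> len v" if "v \<in> carrier G" for v
  proof -
    obtain u where "reduced_expression G S u v" using reduced_exists \<open>v \<in> carrier G\<close> by blast
    then show ?thesis using len_word_le[of "rev u"] by (auto simp: reduced_expression_def word_prod_rev)
  qed
  show ?thesis using le[OF assms] le[of "inv w"] assms by simp
qed

context
  fixes w\<^sub>0 assumes longest: "longest_element G S w\<^sub>0"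
begin

lemma longest_closed [simp]: "w\<^sub>0 \<in> carrier G"
  using longest by (simp add: longest_element_def)

lemma longest_act_simple:
  assumes "s \<in> S" shows "- act w\<^sub>0 (\<alpha> s) \<in> Pos"
proof (rule ccontr)
  assume "- act w\<^sub>0 (\<alpha> s) \<notin> Pos"
  then have "act w\<^sub>0 (\<alpha> s) \<in> Pos" using assms by (simp add: uminus_Pos_iff)
  then have "len (w\<^sub>0 \<otimes> s) = Suc (len w\<^sub>0)" using assms len_ascent by simp
  moreover have "len (w\<^sub>0 \<otimes> s) \<le> len w\<^sub>0" using longest assms by (simp add: longest_element_def)
  ultimately show False by simp
qed

lemma longest_act_Pos:
  assumes "\<beta> \<in> Pos" shows "- act w\<^sub>0 \<beta> \<in> Pos"
proof -
  have sum_nonneg: "nonneg (sum f A)" if "finite A" "\<And>a. a \<in> A \<Longrightarrow> nonneg (f a)" for f and A :: "'a set"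
    using that by (induction A rule: finite_induct) (auto simp: nonneg_add nonneg_def[of 0] span_zero)
  have "act w\<^sub>0 \<beta> = act w\<^sub>0 (\<Sum>s\<in>S. coef s \<beta> *\<^sub>R \<alpha> s)"
    using expansion[of \<beta>] assms by simp
  also have "\<dots> = (\<Sum>s\<in>S. coef s \<beta> *\<^sub>R act w\<^sub>0 (\<alpha> s))"
    by (simp add: act_sum span_scale)
  finally have eq: "- act w\<^sub>0 \<beta> = (\<Sum>s\<in>S. coef s \<beta> *\<^sub>R (- act w\<^sub>0 (\<alpha> s)))"
    by (simp add: sum_negf)
  have "nonneg (- act w\<^sub>0 \<beta>)"
    unfolding eq using longest_act_simple assms
    by (intro sum_nonneg nonneg_scale) (auto simp: Pos_coef Pos_iff)
  moreover have "- act w\<^sub>0 \<beta> \<in> \<Phi>"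
    using assms by (simp add: Pos_root uminus_root)
  ultimately show ?thesis by (simp add: Pos_iff)
qed

lemma longest_inv_act_Pos:
  assumes "\<beta> \<in> \<Phi>" shows "- act (inv w\<^sub>0) \<beta> \<in> Pos \<longleftrightarrow> \<beta> \<in> Pos"
proof -
  define \<gamma> where "\<gamma> = act (inv w\<^sub>0) \<beta>"
  have g: "\<gamma> \<in> \<Phi>" "\<beta> = act w\<^sub>0 \<gamma>" using assms by (auto simp: \<gamma>_def)
  show ?thesis
  proof (cases "\<gamma> \<in> Pos")
    case True
    then show ?thesis
      using longest_act_Pos[OF True] g(2) Pos_not_uminus[OF True] Pos_not_uminus[of \<beta>]
      by (auto simp flip: \<gamma>_def)
  next
    case False
    then have "- \<gamma> \<in> Pos" using g uminus_Pos_iff by blast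
    then show ?thesis
      using longest_act_Pos[of "- \<gamma>"] g by (simp flip: \<gamma>_def)
  qed
qed

lemma inversions_longest: "inversions w\<^sub>0 = Pos"
  using longest_inv_act_Pos by (auto simp: inversions_def Pos_root)

lemma len_longest: "len w\<^sub>0 = card Pos"
  by (simp add: len_inversions inversions_longest)

text \<open>Multiplication by the longest element complements inversion sets. Hence every element is
  a prefix of the longest one.\<close>

lemma len_longest_split:
  assumes v: "v \<in> carrier G" shows "len v + len (inv v \<otimes> w\<^sub>0) = len w\<^sub>0"
proof -
  have "inversions (inv v \<otimes> w\<^sub>0) = Pos - inversions (inv v)"
  proof -
    have "- act (inv (inv v \<otimes> w\<^sub>0)) \<beta> \<in> Pos \<longleftrightarrow> - act v \<beta> \<notin> Pos" if "\<beta> \<in> Pos" for \<beta>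
      using that v longest_inv_act_Pos[of "act v \<beta>"]
      by (simp add: inv_mult_group act_mult uminus_Pos_iff Pos_root)
    then show ?thesis using v by (auto simp: inversions_def)
  qed
  then have "len (inv v \<otimes> w\<^sub>0) = card Pos - card (inversions (inv v))"
    using v by (simp add: len_inversions card_Diff_subset inversions_def)
  moreover have "card (inversions (inv v)) = len v"
    using v len_inversions[of "inv v"] len_inv[of v] by simp
  moreover have "card (inversions (inv v)) \<le> card Pos"
    by (intro card_mono) (auto simp: inversions_def)
  ultimately show ?thesis by (simp add: len_longest)
qed

end

subsection \<open>The Euler form\<close>

text \<open>The span of the simple roots in \<open>J\<close>, put in terms of coefficients because a
  generator changes only one of them.\<close>

definition supported :: "'a set \<Rightarrow> 'v \<Rightarrow> bool" where
  "supported J v \<longleftrightarrow> v \<in> V \<and> (\<forall>s\<in>S - J. coef s v = 0)"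

lemma supported_in_V: "supported J v \<Longrightarrow> v \<in> V"
  by (simp add: supported_def)

lemma supported_simple: "J \<subseteq> S \<Longrightarrow> s \<in> J \<Longrightarrow> supported J (\<alpha> s)"
  by (auto simp: supported_def)

lemma supported_act:
  assumes "s \<in> J" "J \<subseteq> S" "supported J v" shows "supported J (act s v)"
proof -
  have s: "s \<in> S" "v \<in> V" using assms by (auto simp: supported_def)
  have "coef t (act s v) = 0" if "t \<in> S - J" for t
  proof -
    have "t \<in> S" "s \<noteq> t" "coef t v = 0" using that assms by (auto simp: supported_def)
    then show ?thesis using coef_act_gen s by simp
  qed
  then show ?thesis using s by (simp add: supported_def)
qed

lemma supported_act_iff: "s \<in> J \<Longrightarrow> J \<subseteq> S \<Longrightarrow> v \<in> V \<Longrightarrow> supported J (act s v) \<longleftrightarrow> supported J v"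
  using supported_act[of s J v] supported_act[of s J "act s v"] by auto

lemma supported_add: "supported J x \<Longrightarrow> supported J y \<Longrightarrow> supported J (x + y)"
  by (auto simp: supported_def span_add)

lemma supported_uminus [simp]: "supported J (- x) \<longleftrightarrow> supported J x"
  using span_neg[of x] span_neg[of "- x"] by (auto simp: supported_def)

lemma supported_scale: "supported J x \<Longrightarrow> supported J (k *\<^sub>R x)"
  by (auto simp: supported_def span_scale)

lemma supported_zero [simp]: "supported J 0"
  by (auto simp: supported_def span_zero)

lemma supported_sum: "(\<And>i. i \<in> A \<Longrightarrow> supported J (f i)) \<Longrightarrow> supported J (sum f A)"
  by (induction A rule: infinite_finite_induct) (auto simp: supported_add)

lemma supported_word: "set u \<subseteq> J \<Longrightarrow> J \<subseteq> S \<Longrightarrow> supported J v \<Longrightarrow> supported J (act (word_prod G u) v)"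
proof (induction u)
  case (Cons s u)
  then have "s \<in> S" "set u \<subseteq> S" "v \<in> V" by (auto simp: supported_in_V)
  then show ?case using Cons supported_act[of s J] by (simp add: act_mult)
qed (simp add: act_one supported_in_V)

lemma supported_S: "v \<in> V \<Longrightarrow> supported S v"
  by (simp add: supported_def)

lemma supported_expansion: 
  "supported J v \<Longrightarrow> J \<subseteq> S \<Longrightarrow> v = (\<Sum>s\<in>J. coef s v *\<^sub>R \<alpha> s)"
  by (intro expansion_supported) (auto simp: supported_def)

lemma supported_word_diff:
  "set u \<subseteq> S \<Longrightarrow> v \<in> V \<Longrightarrow> supported (set u) (act (word_prod G u) v - v)"
proof (induction u)
  case Nil
  then show ?case by (simp add: act_one)
next
  case (Cons s u)
  let ?y = "act (word_prod G u) v" and ?J = "set (s # u)"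
  have S: "s \<in> S" "set u \<subseteq> S" "?y \<in> V" using Cons by auto
  have "supported (set u) (?y - v)" using Cons by simp
  then have "supported ?J (?y - v)" by (auto simp: supported_def)
  moreover have "act s ?y - ?y = (- (2 * inner ?y (\<alpha> s) / inner (\<alpha> s) (\<alpha> s))) *\<^sub>R \<alpha> s"
    using S by (simp add: act_gen)
  then have "supported ?J (act s ?y - ?y)"
    using Cons.prems by (simp only:) (intro supported_scale supported_simple, auto)
  ultimately have "supported ?J ((act s ?y - ?y) + (?y - v))" by (rule supported_add[rotated])
  then show ?case using S Cons.prems by (simp add: act_mult)
qed

text \<open>The first letter \<open>r\<close> does not occur again, so the rest of the word
  displaces \<open>v\<close> without changing its coefficient at \<open>\<alpha> r\<close>. The
  reflection in \<open>\<alpha> r\<close> must undo this displacement, hence both displacements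
  vanish, and the argument continues with the rest.\<close>

lemma word_fixed_orthogonal:
  "distinct u \<Longrightarrow> set u \<subseteq> S \<Longrightarrow> v \<in> V \<Longrightarrow> act (word_prod G u) v = v \<Longrightarrow> s \<in> set u \<Longrightarrow> inner v (\<alpha> s) = 0"
proof (induction u)
  case (Cons r u)
  let ?y = "act (word_prod G u) v"
  have S: "r \<in> S" "set u \<subseteq> S" "r \<notin> set u" "?y \<in> V" using Cons.prems by auto
  have "act r ?y = v" using Cons.prems S by (simp add: act_mult)
  then have y: "?y = act r v" using S by (metis act_gen_gen)
  then have d: "?y - v = (- (2 * inner v (\<alpha> r) / inner (\<alpha> r) (\<alpha> r))) *\<^sub>R \<alpha> r"
    using S Cons.prems by (simp add: act_gen)
  have "supported (set u) (?y - v)"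
    using supported_word_diff S Cons.prems by blast
  then have "coef r (?y - v) = 0" using S by (simp add: supported_def)
  then have 0: "inner v (\<alpha> r) = 0" unfolding d using S by (simp add: span_scale)
  then have "?y = v" using d by simp
  then show ?case using 0 Cons S by auto
qed simp

text \<open>The Euler form of the Coxeter element, whose symmetrization is the inner product.\<close>

fun euler :: "'a list \<Rightarrow> 'v \<Rightarrow> 'v \<Rightarrow> real" where
  "euler [] x y = 0"
| "euler (s # cs) x y = euler cs x y +
     coef s y * (coef s x * inner (\<alpha> s) (\<alpha> s) / 2 + (\<Sum>t\<in>set cs. coef t x * inner (\<alpha> t) (\<alpha> s)))"

lemma euler_snoc:
  "distinct (cs @ [s]) \<Longrightarrow> euler (cs @ [s]) x y = euler cs x y +
     coef s x * (coef s y * inner (\<alpha> s) (\<alpha> s) / 2 + (\<Sum>t\<in>set cs. coef t y * inner (\<alpha> t) (\<alpha> s)))"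
proof (induction cs)
  case (Cons r cs)
  then have "r \<notin> set cs" "s \<notin> set cs" by auto
  then show ?case using Cons
    by (simp add: algebra_simps inner_commute[of "\<alpha> s" "\<alpha> r"])
qed simp

lemma euler_cong:
  "(\<And>s. s \<in> set cs \<Longrightarrow> coef s x = coef s x') \<Longrightarrow> (\<And>s. s \<in> set cs \<Longrightarrow> coef s y = coef s y') \<Longrightarrow>
    euler cs x y = euler cs x' y'"
  by (induction cs) (auto intro!: sum.cong)

lemma euler_zero_left: "(\<And>s. s \<in> set cs \<Longrightarrow> coef s x = 0) \<Longrightarrow> euler cs x y = 0"
  by (induction cs) auto

lemma euler_zero_right: "(\<And>s. s \<in> set cs \<Longrightarrow> coef s y = 0) \<Longrightarrow> euler cs x y = 0"
  by (induction cs) auto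

lemma euler_uminus_right:
  "y \<in> V \<Longrightarrow> euler cs x (- y) = - euler cs x y"
  by (induction cs) auto

lemma euler_uminus_left:
  "x \<in> V \<Longrightarrow> euler cs (- x) y = - euler cs x y"
  by (induction cs) (auto simp: algebra_simps sum_negf)

lemma inner_simple_supported:
  assumes "s \<notin> set cs" "set (s # cs) \<subseteq> S" "supported (set (s # cs)) x"
  shows "inner x (\<alpha> s) = coef s x * inner (\<alpha> s) (\<alpha> s) + (\<Sum>t\<in>set cs. coef t x * inner (\<alpha> t) (\<alpha> s))"
proof -
  have "inner x (\<alpha> s) = inner (\<Sum>t\<in>set (s # cs). coef t x *\<^sub>R \<alpha> t) (\<alpha> s)"
    using supported_expansion[of "set (s # cs)" x] assms by simp
  also have "\<dots> = (\<Sum>t\<in>insert s (set cs). coef t x * inner (\<alpha> t) (\<alpha> s))"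
    by (simp add: inner_sum_left)
  finally show ?thesis using assms by simp
qed

text \<open>Only the coefficients at \<open>\<alpha> s\<close> change. Thanks to the halved
  diagonal, the factor \<open>coef s (act s y) * K / 2 + X y\<close> of the last letter is
  \<open>- coef s y * K / 2\<close>; the same computation for \<open>x\<close> then restores the
  summand of the first letter.\<close>

lemma euler_rotate:
  assumes "distinct (s # cs)" "set (s # cs) \<subseteq> S" "supported (set (s # cs)) x" "supported (set (s # cs)) y"
  shows "euler (s # cs) x y = euler (cs @ [s]) (act s x) (act s y)"
proof -
  define K where "K = inner (\<alpha> s) (\<alpha> s)"
  define X where "X v = (\<Sum>t\<in>set cs. coef t v * inner (\<alpha> t) (\<alpha> s))" for v
  have s: "s \<in> S" "s \<notin> set cs" "set cs \<subseteq> S" using assms by auto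
  then have K: "K \<noteq> 0" by (simp add: K_def)
  have same: "coef t (act s v) = coef t v" if "t \<in> set cs" "v \<in> V" for t v
    using that s coef_act_gen[of s t v] by auto
  have self: "coef s (act s v) = - coef s v - 2 * X v / K" if "supported (set (s # cs)) v" for v
  proof -
    have "coef s (act s v) = coef s v - 2 * inner v (\<alpha> s) / K"
      using s that by (simp add: act_gen span_scale supported_in_V K_def)
    also have "inner v (\<alpha> s) = coef s v * K + X v"
      using inner_simple_supported[of s cs v] assms that by (simp add: K_def X_def)
    finally show ?thesis using K by (simp add: field_simps)
  qed
  have V: "x \<in> V" "y \<in> V" using assms by (auto simp: supported_in_V)
  have "euler (cs @ [s]) (act s x) (act s y) = euler cs (act s x) (act s y) +
      coef s (act s x) * (coef s (act s y) * K / 2 + X (act s y))"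
    using assms by (subst euler_snoc) (auto simp: K_def X_def)
  also have "euler cs (act s x) (act s y) = euler cs x y"
    using V by (intro euler_cong) (auto simp: same)
  also have "X (act s y) = X y"
    using V by (simp add: X_def same)
  also have "coef s (act s y) * K / 2 + X y = - coef s y * K / 2"
    using self[OF assms(4)] K by (simp add: field_simps)
  also have "coef s (act s x) * (- coef s y * K / 2) = coef s y * (coef s x * K / 2 + X x)"
    unfolding self[OF assms(3)] using K by (simp add: field_simps)
  finally show ?thesis by (simp add: K_def X_def)
qed

lemma euler_first:
  assumes "s \<notin> set cs" "set (s # cs) \<subseteq> S"
  shows "euler (s # cs) (\<alpha> s) y = coef s y * inner (\<alpha> s) (\<alpha> s) / 2"
proof -
  have "coef t (\<alpha> s) = 0" if "t \<in> set cs" for t using that assms by auto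
  then show ?thesis using assms by (simp add: euler_zero_left)
qed

lemma euler_last:
  assumes "distinct (cs @ [s])" "set (cs @ [s]) \<subseteq> S"
  shows "euler (cs @ [s]) x (\<alpha> s) = coef s x * inner (\<alpha> s) (\<alpha> s) / 2"
proof -
  have "coef t (\<alpha> s) = 0" if "t \<in> set cs" for t using that assms by auto
  then show ?thesis using assms by (simp add: euler_snoc euler_zero_right)
qed

lemma euler_first_right:
  assumes "distinct (s # cs)" "set (s # cs) \<subseteq> S" "supported (set (s # cs)) y"
  shows "euler (s # cs) y (\<alpha> s) = - coef s (act s y) * inner (\<alpha> s) (\<alpha> s) / 2"
proof -
  have "euler (s # cs) y (\<alpha> s) = euler (cs @ [s]) (act s y) (- \<alpha> s)"
    using euler_rotate[OF assms, of "\<alpha> s"] assms(2) supported_simple[OF assms(2), of s] by simp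
  also have "\<dots> = - coef s (act s y) * inner (\<alpha> s) (\<alpha> s) / 2"
    using assms by (subst euler_uminus_right) (auto simp: euler_last)
  finally show ?thesis .
qed

lemma euler_last_left:
  assumes "distinct (s # cs)" "set (s # cs) \<subseteq> S" "supported (set (s # cs)) y"
  shows "euler (cs @ [s]) (\<alpha> s) (act s y) = - coef s y * inner (\<alpha> s) (\<alpha> s) / 2"
proof -
  have s: "s \<in> S" "s \<notin> set cs" using assms by auto
  have sup: "supported (set (s # cs)) (- \<alpha> s)"
    using supported_simple[OF assms(2), of s] by simp
  have "act s (- \<alpha> s) = \<alpha> s" using s by simp
  then have "euler (cs @ [s]) (\<alpha> s) (act s y) = euler (s # cs) (- \<alpha> s) y"
    using euler_rotate[OF assms(1,2) sup assms(3)] by simp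
  also have "\<dots> = - euler (s # cs) (\<alpha> s) y"
    using s by (intro euler_uminus_left) simp
  finally show ?thesis unfolding euler_first[OF s(2) assms(2)] by simp
qed

lemma euler_symmetrization:
  "distinct cs \<Longrightarrow> euler cs x y + euler cs y x =
    inner (\<Sum>t\<in>set cs. coef t x *\<^sub>R \<alpha> t) (\<Sum>t\<in>set cs. coef t y *\<^sub>R \<alpha> t)"
proof (induction cs)
  case (Cons s cs)
  define X where "X v = (\<Sum>t\<in>set cs. coef t v *\<^sub>R \<alpha> t)" for v
  have X: "(\<Sum>t\<in>set cs. coef t v * inner (\<alpha> t) (\<alpha> s)) = inner (X v) (\<alpha> s)" for v
    by (simp add: X_def inner_sum_left)
  have "s \<notin> set cs" using Cons.prems by simp
  then have ins: "(\<Sum>t\<in>set (s # cs). coef t v *\<^sub>R \<alpha> t) = coef s v *\<^sub>R \<alpha> s + X v" for v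
    by (simp add: X_def)
  have IH: "euler cs x y + euler cs y x = inner (X x) (X y)"
    using Cons by (simp add: X_def)
  have "inner (coef s x *\<^sub>R \<alpha> s + X x) (coef s y *\<^sub>R \<alpha> s + X y) =
      coef s x * coef s y * inner (\<alpha> s) (\<alpha> s) + coef s x * inner (X y) (\<alpha> s)
      + coef s y * inner (X x) (\<alpha> s) + inner (X x) (X y)"
    by (simp add: inner_add_left inner_add_right inner_commute[of "\<alpha> s" "X y"] distrib_left)
  then show ?case unfolding ins euler.simps X using IH by (simp add: field_simps)
qed simp

lemma euler_orthogonal:
  assumes "distinct cs" "set cs \<subseteq> S" "supported (set cs) x" "supported (set cs) y"
    "euler cs x y = 0" "euler cs y x = 0"
  shows "inner x y = 0"
  using euler_symmetrization[OF assms(1), of x y] supported_expansion[of "set cs"] assms by simp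

lemma euler_remove:
  assumes "coef r x = 0" "coef r y = 0"
  shows "euler (filter (\<lambda>t. t \<noteq> r) cs) x y = euler cs x y"
proof (induction cs)
  case (Cons s cs)
  have "(\<Sum>t\<in>set (filter (\<lambda>t. t \<noteq> r) cs). coef t x * inner (\<alpha> t) (\<alpha> s)) =
      (\<Sum>t\<in>set cs. coef t x * inner (\<alpha> t) (\<alpha> s))"
    using assms by (intro sum.mono_neutral_left) auto
  then show ?case using Cons assms by (cases "s = r") simp_all
qed simp

text \<open>\<open>reach k cs x\<close> says that the positive root \<open>x\<close>, reflected successively in the letters of
  \<open>cs cs cs \<dots>\<close>, first turns negative at the letter in position \<open>k\<close>, counted from \<open>0\<close>.\<close>

fun reach :: "nat \<Rightarrow> 'a list \<Rightarrow> 'v \<Rightarrow> bool" where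
  "reach k [] x \<longleftrightarrow> False"
| "reach 0 (s # cs) x \<longleftrightarrow> x = \<alpha> s"
| "reach (Suc k) (s # cs) x \<longleftrightarrow> x \<in> Pos \<and> x \<noteq> \<alpha> s \<and> reach k (cs @ [s]) (act s x)"

lemma reach_Pos: "set cs \<subseteq> S \<Longrightarrow> reach k cs x \<Longrightarrow> x \<in> Pos"
  by (cases "(k, cs, x)" rule: reach.cases) auto

lemma reach_unique: "reach k cs x \<Longrightarrow> reach l cs x \<Longrightarrow> k = l"
proof (induction k cs x arbitrary: l rule: reach.induct)
  case (2 s cs x)
  then show ?case by (cases l) auto
next
  case (3 k s cs x)
  then show ?case by (cases l) auto
qed simp

lemma reach_supported: "set cs \<subseteq> S \<Longrightarrow> reach k cs x \<Longrightarrow> supported (set cs) x"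
proof (induction k cs x rule: reach.induct)
  case (2 s cs x)
  then show ?case using supported_simple[of "set (s # cs)" s] by simp
next
  case (3 k s cs x)
  then have "supported (set (s # cs)) (act s x)" by simp
  then show ?case using 3 supported_act_iff[of s "set (s # cs)" x] by simp
qed simp

text \<open>Rotation preserves the form, so it suffices to look at the moment when \<open>x\<close>
  is the simple root of the first letter. There the two values are multiples of the coefficients at
  \<open>\<alpha> s\<close> of \<open>y\<close> and, with a minus sign, of \<open>act s y\<close>,
  and both of these roots are positive.\<close>

lemma reach_sorted:
  "distinct cs \<Longrightarrow> set cs \<subseteq> S \<Longrightarrow> reach k cs x \<Longrightarrow> reach l cs y \<Longrightarrow> k < l \<Longrightarrow>
    0 \<le> euler cs x y \<and> euler cs y x \<le> 0"
proof (induction k cs x arbitrary: l y rule: reach.induct)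
  case (2 s cs x)
  then have "y \<in> Pos" "y \<noteq> \<alpha> s" by (cases l, auto)+
  moreover have sup: "supported (set (s # cs)) y" using 2 reach_supported by blast
  ultimately have "0 \<le> coef s y" "0 \<le> coef s (act s y)"
    using 2 gen_Pos[of s y] by (auto simp: Pos_coef)
  moreover have "x = \<alpha> s" "s \<notin> set cs" using 2 by auto
  ultimately show ?case
    unfolding \<open>x = \<alpha> s\<close> euler_first[OF \<open>s \<notin> set cs\<close> "2.prems"(2)] euler_first_right[OF "2.prems"(1,2) sup]
    by simp
next
  case (3 k s cs x)
  then obtain l' where l: "l = Suc l'" by (cases l) auto
  have sup: "supported (set (s # cs)) x" "supported (set (s # cs)) y"
    using 3 reach_supported by blast+
  have "0 \<le> euler (cs @ [s]) (act s x) (act s y) \<and> euler (cs @ [s]) (act s y) (act s x) \<le> 0"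
    using 3 l by (intro "3.IH"[of l']) auto
  then show ?case
    using euler_rotate[of s cs x y] euler_rotate[of s cs y x] 3 sup by (simp del: euler.simps)
qed simp

text \<open>Applied with \<open>a = cs\<close> and \<open>b = []\<close>, when the word has come
  back to itself; the split into two parts carries the induction.\<close>

lemma not_reach_rotate:
  "set (a @ b) \<subseteq> S \<Longrightarrow> x \<in> Pos \<Longrightarrow> \<forall>k. \<not> reach k (a @ b) x \<Longrightarrow>
    act (word_prod G (rev a)) x \<in> Pos \<and> (\<forall>k. \<not> reach k (b @ a) (act (word_prod G (rev a)) x))"
proof (induction a arbitrary: b x)
  case Nil
  then show ?case by (simp add: act_one)
next
  case (Cons s a)
  have S: "s \<in> S" "set a \<subseteq> S" "x \<in> V" using Cons.prems by auto
  have "x \<noteq> \<alpha> s" using Cons.prems(3) by (metis append_Cons reach.simps(2))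
  moreover from this have "\<forall>k. \<not> reach k (a @ (b @ [s])) (act s x)"
    using Cons.prems(2,3) by (metis append_Cons append_assoc reach.simps(3))
  ultimately have "act (word_prod G (rev a)) (act s x) \<in> Pos \<and>
      (\<forall>k. \<not> reach k ((b @ [s]) @ a) (act (word_prod G (rev a)) (act s x)))"
    using Cons.prems S gen_Pos by (intro Cons.IH) auto
  then show ?case using S by (simp add: act_mult)
qed

text \<open>A root that never turns negative would have an orbit of positive roots under the Coxeter
  element. The sum of the orbit is fixed, hence orthogonal to all simple roots in question, and lies
  in their span, so it is zero. As all coefficients are nonnegative, the root itself would be
  zero.\<close>

lemma reach_exists:
  assumes "distinct cs" "set cs \<subseteq> S" "x \<in> Pos" "supported (set cs) x"
  shows "\<exists>k. reach k cs x"
proof (rule ccontr)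
  assume "\<not> ?thesis"
  then have never: "\<forall>k. \<not> reach k cs x" by blast
  \<comment> \<open>The reflections of one full round, with the first letter acting first, multiply
    to the inverse of the Coxeter element.\<close>
  define d where "d = word_prod G (rev cs)"
  have d: "d \<in> carrier G" using assms by (simp add: d_def)
  have V: "x \<in> V" using assms by simp
  have it: "act (d [^] j) x \<in> Pos \<and> (\<forall>k. \<not> reach k cs (act (d [^] j) x)) \<and> supported (set cs) (act (d [^] j) x)"
    for j :: nat
  proof (induction j)
    case 0
    then show ?case using never assms by (simp add: act_one)
  next
    case (Suc j)
    have "act (d [^] Suc j) x = act d (act (d [^] j) x)"
      using d V by (metis act_mult nat_pow_Suc2 nat_pow_closed)
    then show ?case
      using not_reach_rotate[of cs "[]" "act (d [^] j) x"] Suc assms supported_word[of "rev cs" "set cs"]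
      by (simp add: d_def)
  qed
  define h where "h = ord d"
  have h: "0 < h" "d [^] h = \<one>"
    using ord_ge_1[OF finite_carrier d] pow_ord_eq_1[OF d] by (auto simp: h_def)
  define v where "v = (\<Sum>j<h. act (d [^] j) x)"
  have vV: "v \<in> V" using d V by (auto simp: v_def intro!: span_sum)
  have "act d (act (d [^] j) x) = act (d [^] Suc j) x" for j :: nat
    using d V by (metis act_mult nat_pow_Suc2 nat_pow_closed)
  then have "act d v = (\<Sum>j<h. act (d [^] Suc j) x)"
    unfolding v_def using d V by (simp add: act_sum del: nat_pow_Suc)
  also have "\<dots> = (\<Sum>j\<in>{1..h}. act (d [^] j) x)"
    by (rule sum.reindex_bij_witness[of _ "\<lambda>j. j - 1" Suc]) auto
  also have "\<dots> = v"
  proof -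
    have "{1..h} = insert h {1..<h}" "{..<h} = insert 0 {1..<h}" using h by auto
    then show ?thesis using h V by (simp add: v_def act_one)
  qed
  finally have "act (word_prod G (rev cs)) v = v" by (simp add: d_def)
  then have orth: "inner v (\<alpha> s) = 0" if "s \<in> set cs" for s
    using word_fixed_orthogonal[of "rev cs" v s] assms that vV by simp
  have "supported (set cs) v" using it by (auto simp: v_def intro!: supported_sum)
  then have "v = (\<Sum>s\<in>set cs. coef s v *\<^sub>R \<alpha> s)"
    using assms supported_expansion by blast
  then have "inner v v = (\<Sum>s\<in>set cs. coef s v * inner v (\<alpha> s))"
    by (metis (no_types, lifting) inner_scaleR_right inner_sum_right sum.cong)
  then have "v = 0" using orth by simp
  have "coef s x = 0" if s: "s \<in> S" for s
  proof -
    have "(\<Sum>j<h. coef s (act (d [^] j) x)) = 0"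
      using \<open>v = 0\<close> d V coef_sum[of "{..<h}" "\<lambda>j. act (d [^] j) x" s] by (simp add: v_def)
    then have "\<forall>j\<in>{..<h}. coef s (act (d [^] j) x) = 0"
      using it s by (subst (asm) sum_nonneg_eq_0_iff) (auto simp: Pos_coef)
    then have "coef s (act (d [^] (0::nat)) x) = 0" using h by blast
    then show ?thesis using V by (simp add: act_one)
  qed
  then have "x = 0" using V by (intro coef_eqI) (auto simp: span_zero)
  then show False using assms root_nonzero Pos_root by blast
qed

lemma reach_parabolic:
  "set cs \<subseteq> S \<Longrightarrow> reach k cs x \<Longrightarrow> x \<in> parabolic_roots G act \<alpha> (set cs)"
proof (induction k cs x rule: reach.induct)
  case (2 s cs x)
  then have "x = act \<one> (\<alpha> s)" by (simp add: act_one)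
  then show ?case unfolding parabolic_roots_def using generate.one by fastforce
next
  case (3 k s cs x)
  then have "act s x \<in> parabolic_roots G act \<alpha> (set (s # cs))" by simp
  then obtain w t where wt: "act s x = act w (\<alpha> t)" "w \<in> generate G (set (s # cs))" "t \<in> set (s # cs)"
    unfolding parabolic_roots_def by blast
  have s: "s \<in> S" "x \<in> V" "t \<in> S" using 3 wt by auto
  have w: "w \<in> carrier G"
    using wt(2) generate_in_carrier[of "set (s # cs)" w] "3.prems"(1) gens_in_carrier by blast
  have "x = act s (act s x)" using s by simp
  also have "\<dots> = act (s \<otimes> w) (\<alpha> t)" using s w by (simp add: wt(1) act_mult)
  finally have "x = act (s \<otimes> w) (\<alpha> t)" .
  moreover have "s \<otimes> w \<in> generate G (set (s # cs))"
    by (rule generate.eng[OF generate.incl wt(2)]) simp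
  ultimately show ?case unfolding parabolic_roots_def using wt(3) by blast
qed simp

text \<open>A positive root supported on \<open>J\<close> becomes simple while being rotated with a
  word of \<open>J\<close>. This uses reflections from \<open>J\<close> only, so the root belongs to
  the parabolic subsystem.\<close>

lemma positive_roots_parabolic:
  assumes "J \<subseteq> S" shows "positive_roots G act \<alpha> J = {x \<in> Pos. supported J x}"
proof (intro Set.set_eqI iffI)
  fix x assume "x \<in> positive_roots G act \<alpha> J"
  then obtain k where k: "x \<in> parabolic_roots G act \<alpha> J" "\<forall>s\<in>J. 0 \<le> k s" "x = (\<Sum>s\<in>J. k s *\<^sub>R \<alpha> s)"
    by (auto simp: positive_roots_def)
  have "parabolic_roots G act \<alpha> J \<subseteq> \<Phi>"
    unfolding parabolic_roots_def using assms mono_generate[OF assms] by blast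
  then have "x \<in> \<Phi>" using k by blast
  moreover have "coef s x = (if s \<in> J then k s else 0)" if "s \<in> S" for s
    using coef_combination[OF assms that, of k] k by simp
  ultimately show "x \<in> {x \<in> Pos. supported J x}"
    using k by (auto simp: Pos_iff nonneg_def supported_def)
next
  fix x assume x: "x \<in> {x \<in> Pos. supported J x}"
  obtain cs where cs: "set cs = J" "distinct cs"
    using assms finite_distinct_list[OF finite_subset[OF assms finite_S]] by blast
  then obtain k where "reach k cs x" using reach_exists[of cs x] x assms by auto
  then have "x \<in> parabolic_roots G act \<alpha> J" using reach_parabolic[of cs k x] cs assms by simp
  moreover have "x = (\<Sum>s\<in>J. coef s x *\<^sub>R \<alpha> s)" using x assms supported_expansion by blast
  moreover have "\<forall>s\<in>J. 0 \<le> coef s x" using x assms by (auto simp: Pos_coef)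
  ultimately show "x \<in> positive_roots G act \<alpha> J"
    unfolding positive_roots_def by (intro CollectI conjI exI[of _ "\<lambda>s. coef s x"])
qed

subsection \<open>Compatibility\<close>

abbreviation AP :: "'a set \<Rightarrow> 'v set" where "AP J \<equiv> almost_positive_roots G act \<alpha> J"
abbreviation sig :: "'a \<Rightarrow> 'v \<Rightarrow> 'v" where "sig s \<equiv> root_sigma S act \<alpha> s"

lemma AP_eq:
  assumes "J \<subseteq> S" shows "AP J = {x \<in> Pos. supported J x} \<union> (\<lambda>s. - \<alpha> s) ` J"
  unfolding almost_positive_roots_def positive_roots_parabolic[OF assms] ..

lemma neg_simple_not_Pos [simp]: "s \<in> S \<Longrightarrow> - \<alpha> s \<notin> Pos"
  using Pos_not_uminus simple_Pos by blast

lemma AP_V: "J \<subseteq> S \<Longrightarrow> x \<in> AP J \<Longrightarrow> x \<in> V"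
  by (auto simp: AP_eq span_neg)

lemma finite_AP: "J \<subseteq> S \<Longrightarrow> finite (AP J)"
  using finite_subset[OF _ finite_S] by (simp add: AP_eq)

lemma AP_cases:
  assumes "J \<subseteq> S" "s \<in> J" "x \<in> AP J"
  obtains (neg) "x = - \<alpha> s" | (neg_other) t where "t \<in> J" "t \<noteq> s" "x = - \<alpha> t"
    | (simple) "x = \<alpha> s" | (pos) "x \<in> Pos" "x \<noteq> \<alpha> s" "supported J x"
  using assms by (auto simp: AP_eq)

lemma sig_neg [simp]: "s \<in> S \<Longrightarrow> sig s (- \<alpha> s) = \<alpha> s"
  by (auto simp: root_sigma_def)

lemma sig_neg_other [simp]: "t \<in> S \<Longrightarrow> t \<noteq> s \<Longrightarrow> sig s (- \<alpha> t) = - \<alpha> t"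
  by (auto simp: root_sigma_def)

lemma sig_Pos: 
  assumes "s \<in> S" "x \<in> Pos" shows "sig s x = act s x"
proof -
  have "- x \<notin> \<alpha> ` (S - {s})" using assms Pos_not_uminus[of x] by auto
  then show ?thesis by (simp add: root_sigma_def)
qed

lemma sig_simple [simp]: "s \<in> S \<Longrightarrow> sig s (\<alpha> s) = - \<alpha> s"
  by (simp add: sig_Pos)

lemma sig_AP:
  assumes "J \<subseteq> S" "s \<in> J" "x \<in> AP J"
  shows "sig s x \<in> AP J" "sig s (sig s x) = x"
proof -
  have s: "s \<in> S" using assms by auto
  have "sig s x \<in> AP J \<and> sig s (sig s x) = x"
    using assms
  proof (cases rule: AP_cases)
    case neg
    then show ?thesis using assms s by (simp add: AP_eq supported_simple)
  next
    case (neg_other t)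
    then show ?thesis using assms by auto
  next
    case simple
    then show ?thesis using assms s by (simp add: AP_eq)
  next
    case pos
    then have "act s x \<in> Pos" using gen_Pos s by blast
    then show ?thesis using pos assms s by (simp add: sig_Pos AP_eq supported_act)
  qed
  then show "sig s x \<in> AP J" "sig s (sig s x) = x" by auto
qed

lemma inj_on_sig: "J \<subseteq> S \<Longrightarrow> s \<in> J \<Longrightarrow> inj_on (sig s) (AP J)"
  by (rule inj_on_inverseI[of _ "sig s"]) (simp add: sig_AP)

text \<open>The coefficient is required to be nonpositive instead of zero so that
  \<open>- \<alpha> s\<close> is compatible with itself. On all other almost positive roots the
  coefficient is nonnegative, and the two conditions agree.\<close>

definition compat :: "'a list \<Rightarrow> 'v \<Rightarrow> 'v \<Rightarrow> bool" where
  "compat cs x y \<longleftrightarrow> (\<forall>s\<in>set cs. (x = - \<alpha> s \<longrightarrow> coef s y \<le> 0) \<and> (y = - \<alpha> s \<longrightarrow> coef s x \<le> 0)) \<and>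
     (x \<in> Pos \<longrightarrow> y \<in> Pos \<longrightarrow> 0 \<le> euler cs x y \<and> 0 \<le> euler cs y x)"

lemma compat_commute: "compat cs x y \<longleftrightarrow> compat cs y x"
  by (auto simp: compat_def)

lemma compat_neg:
  assumes "set cs \<subseteq> S" "s \<in> set cs" shows "compat cs (- \<alpha> s) y \<longleftrightarrow> coef s y \<le> 0"
  using assms by (auto simp: compat_def subset_iff)

lemma compat_Pos:
  assumes "set cs \<subseteq> S" "x \<in> Pos" "y \<in> Pos"
  shows "compat cs x y \<longleftrightarrow> 0 \<le> euler cs x y \<and> 0 \<le> euler cs y x"
proof -
  have "x \<noteq> - \<alpha> s" "y \<noteq> - \<alpha> s" if "s \<in> set cs" for s
    using assms that neg_simple_not_Pos[of s] by auto
  then show ?thesis using assms by (auto simp: compat_def)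
qed

text \<open>Between positive roots other than \<open>\<alpha> s\<close> this is
  \<open>euler_rotate\<close>, and the coefficients at other simple roots are not affected by
  \<open>s\<close>. What remains are the pairs with \<open>\<alpha> s\<close> or
  \<open>- \<alpha> s\<close>.\<close>

lemma compat_rotate:
  assumes d: "distinct (s # cs)" and S: "set (s # cs) \<subseteq> S"
    and x: "x \<in> AP (set (s # cs))" and y: "y \<in> AP (set (s # cs))"
  shows "compat (s # cs) x y \<longleftrightarrow> compat (cs @ [s]) (sig s x) (sig s y)"
proof -
  let ?J = "set (s # cs)"
  have s: "s \<in> S" "s \<in> ?J" "s \<notin> set cs" using S d by auto
  have S': "set (cs @ [s]) \<subseteq> S" and d': "distinct (cs @ [s])" using S d by auto
  define K where "K = inner (\<alpha> s) (\<alpha> s)"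
  have K: "0 < K" using s by (simp add: K_def)
  have posact: "act s z \<in> Pos" "0 \<le> coef s z" "0 \<le> coef s (act s z)"
    if "z \<in> Pos" "z \<noteq> \<alpha> s" for z
    using gen_Pos[of s z] that s by (auto simp: Pos_coef)
  have e1: "euler (s # cs) (\<alpha> s) z = coef s z * K / 2" "euler (s # cs) z (\<alpha> s) = - coef s (act s z) * K / 2"
      "euler (cs @ [s]) (act s z) (\<alpha> s) = coef s (act s z) * K / 2"
      "euler (cs @ [s]) (\<alpha> s) (act s z) = - coef s z * K / 2"
    if "supported ?J z" for z
    unfolding euler_first[OF s(3) S] euler_first_right[OF d S that] euler_last[OF d' S']
      euler_last_left[OF d S that] K_def by simp_all
  have N: "compat (s # cs) (- \<alpha> t) z \<longleftrightarrow> coef t z \<le> 0" "compat (cs @ [s]) (- \<alpha> t) z \<longleftrightarrow> coef t z \<le> 0"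
    if "t \<in> ?J" for t z
    using compat_neg[OF S that] compat_neg[OF S', of t] that by auto
  have P: "compat (s # cs) z w \<longleftrightarrow> 0 \<le> euler (s # cs) z w \<and> 0 \<le> euler (s # cs) w z"
    "compat (cs @ [s]) z w \<longleftrightarrow> 0 \<le> euler (cs @ [s]) z w \<and> 0 \<le> euler (cs @ [s]) w z"
    if "z \<in> Pos" "w \<in> Pos" for z w
    using that compat_Pos S S' by auto
  have S3: "t \<in> S" if "t \<in> ?J" for t using S that by auto
  have V: "z \<in> V" if "z \<in> AP ?J" for z using AP_V S that by blast
  \<comment> \<open>The rotation exchanges \<open>- \<alpha> s\<close> and
    \<open>\<alpha> s\<close>, so a condition on a coefficient is matched with one on the Euler
    form. Of its two inequalities one always holds, since \<open>z\<close> and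
    \<open>act s z\<close> are positive, and the other one forces a coefficient to vanish.\<close>
  have N1: "compat (s # cs) (- \<alpha> s) z \<longleftrightarrow> compat (cs @ [s]) (\<alpha> s) (sig s z)" if z: "z \<in> AP ?J" for z
    using S s(2) z
  proof (cases rule: AP_cases)
    case neg
    have "compat (cs @ [s]) (\<alpha> s) (\<alpha> s)"
      unfolding P(2)[OF simple_Pos[OF s(1)] simple_Pos[OF s(1)]] euler_last[OF d' S'] using s by simp
    then show ?thesis using neg N(1)[of s z] s by simp
  next
    case (neg_other t)
    then show ?thesis using N[of s] N[of t] compat_commute[of _ "\<alpha> s"] s S3 by simp
  next
    case simple
    then show ?thesis using N[of s] compat_commute[of _ "\<alpha> s"] s by simp
  next
    case pos
    note p = posact[OF pos(1,2)]
    have "compat (cs @ [s]) (\<alpha> s) (act s z) \<longleftrightarrow> coef s z \<le> 0"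
      unfolding P(2)[OF simple_Pos[OF s(1)] p(1)] e1[OF pos(3)] using p K
      by (auto simp: mult_nonneg_nonneg mult_le_0_iff)
    then show ?thesis using N(1)[of s z] s pos by (simp add: sig_Pos)
  qed
  have N2: "compat (s # cs) (\<alpha> s) z \<longleftrightarrow> compat (cs @ [s]) (- \<alpha> s) (sig s z)" if z: "z \<in> AP ?J" for z
    using S s(2) z
  proof (cases rule: AP_cases)
    case neg
    then show ?thesis using N[of s] compat_commute[of _ "\<alpha> s"] s by simp
  next
    case (neg_other t)
    then show ?thesis using N[of s] N[of t] compat_commute[of _ "\<alpha> s"] s S3 by simp
  next
    case simple
    have "compat (s # cs) (\<alpha> s) (\<alpha> s)"
      unfolding P(1)[OF simple_Pos[OF s(1)] simple_Pos[OF s(1)]] euler_first[OF s(3) S] using s by simp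
    then show ?thesis using simple N(2)[of s "- \<alpha> s"] s by simp
  next
    case pos
    note p = posact[OF pos(1,2)]
    have "compat (s # cs) (\<alpha> s) z \<longleftrightarrow> coef s (act s z) \<le> 0"
      unfolding P(1)[OF simple_Pos[OF s(1)] pos(1)] e1[OF pos(3)] using p K
      by (auto simp: mult_nonneg_nonneg mult_le_0_iff)
    then show ?thesis using N(2)[of s "act s z"] s pos by (simp add: sig_Pos)
  qed
  have N3: "compat (s # cs) (- \<alpha> t) z \<longleftrightarrow> compat (cs @ [s]) (- \<alpha> t) (sig s z)"
    if t: "t \<in> ?J" "t \<noteq> s" and z: "z \<in> AP ?J" for t z
  proof -
    have "coef t (sig s z) = coef t z"
      using t s S3[OF t(1)] V[OF z] by (simp add: root_sigma_def coef_act_gen)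
    then show ?thesis using N[OF t(1)] by simp
  qed
  show ?thesis
    using S s(2) x
  proof (cases rule: AP_cases)
    case neg
    then show ?thesis using N1[OF y] s by simp
  next
    case (neg_other t)
    then show ?thesis using N3[OF _ _ y, of t] s S3 by simp
  next
    case simple
    then show ?thesis using N2[OF y] s by simp
  next
    case px: pos
    show ?thesis
      using S s(2) y
    proof (cases rule: AP_cases)
      case neg
      then show ?thesis using N1[OF x] s by (simp add: compat_commute[of _ x] compat_commute[of _ "sig s x"])
    next
      case (neg_other t)
      then show ?thesis using N3[OF _ _ x, of t] s S3
        by (simp add: compat_commute[of _ x] compat_commute[of _ "sig s x"])
    next
      case simple
      then show ?thesis using N2[OF x] s by (simp add: compat_commute[of _ x] compat_commute[of _ "sig s x"])
    next
      case pos
      then show ?thesis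
        using px posact[OF px(1,2)] posact[OF pos(1,2)] s
          euler_rotate[OF d S px(3) pos(3)] euler_rotate[OF d S pos(3) px(3)]
        by (simp add: P sig_Pos del: euler.simps)
    qed
  qed
qed

section \<open>Coxeter words and uniqueness of the compatibility relation\<close>

lemma coef_word:
  assumes "set u \<subseteq> S" "s \<in> S" "s \<notin> set u" "v \<in> V"
  shows "coef s (act (word_prod G u) v) = coef s v"
  using supported_word_diff[of u v] assms by (auto simp: supported_def)

lemma AP_Pos_supported: "J \<subseteq> S \<Longrightarrow> x \<in> AP J \<Longrightarrow> x \<in> Pos \<Longrightarrow> supported J x"
  by (auto simp: AP_eq)

lemma coxeter_elementI: "distinct cs \<Longrightarrow> set cs = S \<Longrightarrow> coxeter_element G S (word_prod G cs)"
  by (auto simp: coxeter_element_def)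

text \<open>The other letters preserve the coefficient of \<open>\<alpha> s\<close> at itself, so
  \<open>\<alpha> s\<close> is no inversion of their product. This makes rotation an instance of
  axiom (ii).\<close>

lemma initial_in_first:
  assumes "distinct (s # cs)" "set (s # cs) \<subseteq> S"
  shows "initial_in G S s (word_prod G (s # cs))"
proof -
  let ?w = "word_prod G cs"
  have s: "s \<in> S" "s \<notin> set cs" "set cs \<subseteq> S" using assms by auto
  have "act (inv ?w) (\<alpha> s) = act (word_prod G (rev cs)) (\<alpha> s)"
    using s by (simp add: word_prod_rev)
  then have "coef s (act (inv ?w) (\<alpha> s)) = 1"
    using s coef_word[of "rev cs" s "\<alpha> s"] by simp
  then have "- act (inv ?w) (\<alpha> s) \<notin> Pos"
    using Pos_coef[of "- act (inv ?w) (\<alpha> s)" s] s by auto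
  then have notin: "\<alpha> s \<notin> inversions ?w" by (simp add: inversions_def)
  then have eq: "inversions (s \<otimes> ?w) = insert (\<alpha> s) (act s ` inversions ?w)"
    using inversions_gen_mult s by simp
  have sub: "inversions ?w \<subseteq> Pos" by (auto simp: inversions_def)
  have "\<alpha> s \<notin> act s ` inversions ?w"
  proof
    assume "\<alpha> s \<in> act s ` inversions ?w"
    then obtain \<beta> where "\<beta> \<in> Pos" "\<alpha> s = act s \<beta>" using sub by blast
    then have "\<beta> = - \<alpha> s" using s by (metis Pos_in_V act_gen_gen act_gen_simple)
    then show False using \<open>\<beta> \<in> Pos\<close> s by simp
  qed
  moreover have "inj_on (act s) (inversions ?w)"
    using sub s by (intro inj_onI) (metis Pos_in_V act_gen_gen subsetD)
  ultimately have "card (inversions (s \<otimes> ?w)) = Suc (card (inversions ?w))"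
    by (simp add: eq card_image)
  then show ?thesis
    using s by (simp add: initial_in_def flip: len_inversions)
qed

text \<open>Coefficients detect letters: a word without \<open>s\<close> preserves the coefficient
  at \<open>\<alpha> s\<close>, whereas the Coxeter element negates it on a suitable vector. So
  every generator occurs, and minimal length leaves no room for repetitions.\<close>

lemma coxeter_word:
  assumes "coxeter_element G S c" "reduced_expression G S cs c"
  shows "distinct cs" "set cs = S" "word_prod G cs = c"
proof -
  obtain u where u: "distinct u" "set u = S" "word_prod G u = c"
    using assms(1) by (auto simp: coxeter_element_def)
  have cs: "set cs \<subseteq> S" "word_prod G cs = c" "length cs = len c"
    using assms(2) by (auto simp: reduced_expression_def)
  have "s \<in> set cs" if s: "s \<in> S" for s
  proof (rule ccontr)
    assume no: "s \<notin> set cs"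
    obtain u1 u2 where u12: "u = u1 @ s # u2" using s u split_list by metis
    then have n: "s \<notin> set u1" "s \<notin> set u2" "set u1 \<subseteq> S" "set u2 \<subseteq> S" using u by auto
    \<comment> \<open>Chosen such that the letters to the right of \<open>s\<close> turn
      \<open>v\<close> into \<open>\<alpha> s\<close>, which \<open>s\<close> then negates.\<close>
    define v where "v = act (word_prod G (rev u2)) (\<alpha> s)"
    have v: "v \<in> V" "coef s v = 1" using n s coef_word[of "rev u2" s "\<alpha> s"] by (auto simp: v_def)
    have "act (word_prod G u2) v = \<alpha> s" using n s by (simp add: v_def word_prod_rev)
    moreover have "c = word_prod G u1 \<otimes> (s \<otimes> word_prod G u2)"
      using u(3) n s by (simp add: u12)
    ultimately have "act c v = - act (word_prod G u1) (\<alpha> s)"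
      using n s v by (simp add: act_mult)
    then have "coef s (act c v) = -1" using n s coef_word[of u1 s "\<alpha> s"] by simp
    moreover have "coef s (act c v) = 1" using cs v s no coef_word[of cs s v] by auto
    ultimately show False by simp
  qed
  then show set: "set cs = S" using cs by auto
  have "length cs \<le> length u" using len_word_le[of u] u cs by simp
  then have "length cs \<le> card (set cs)" using u set distinct_card[OF u(1)] by simp
  then show "distinct cs" using card_length[of cs] card_distinct[of cs] by simp
  show "word_prod G cs = c" by fact
qed

text \<open>Axiom (i) decides the pairs with a negative simple root, and axiom (ii) is followed
  until \<open>x\<close> has become one. The roots stay distinct on the way because
  \<open>sig\<close> is injective; on equal roots the axioms are silent.\<close>

lemma compatibility_unique:
  assumes fam: "compatibility_family G S act \<alpha> cpt"
    and "distinct cs" "set cs = S" "x \<in> AP S" "y \<in> AP S" "x \<noteq> y"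
  shows "cpt (word_prod G cs) x y \<longleftrightarrow> compat cs x y"
proof -
  have sym: "cpt (word_prod G cs) x y \<longleftrightarrow> cpt (word_prod G cs) y x"
    if "distinct cs" "set cs = S" "x \<in> AP S" "y \<in> AP S" for cs x y
    using fam coxeter_elementI[OF that(1,2)] that unfolding compatibility_family_def by blast
  have neg: "cpt (word_prod G cs) (- \<alpha> s) y \<longleftrightarrow> compat cs (- \<alpha> s) y"
    if "distinct cs" "set cs = S" "s \<in> S" "y \<in> AP S" "y \<noteq> - \<alpha> s" for cs s y
  proof -
    have "cpt (word_prod G cs) (- \<alpha> s) y \<longleftrightarrow> y \<in> AP (S - {s})"
      using fam coxeter_elementI[OF that(1,2)] that unfolding compatibility_family_def by blast
    also have "\<dots> \<longleftrightarrow> coef s y \<le> 0"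
      using \<open>y \<in> AP S\<close> \<open>y \<noteq> - \<alpha> s\<close> \<open>s \<in> S\<close> Pos_coef[of y s]
      by (auto simp: AP_eq supported_def)
    also have "\<dots> \<longleftrightarrow> compat cs (- \<alpha> s) y" using compat_neg[of cs s y] that by simp
    finally show ?thesis .
  qed
  have ax: "cpt c x y \<longleftrightarrow> cpt (s \<otimes> c \<otimes> s) (sig s x) (sig s y)"
    if "coxeter_element G S c" "initial_in G S s c" "x \<in> AP S" "y \<in> AP S" for c s x y
    using fam that unfolding compatibility_family_def by blast
  have both: "cpt (word_prod G cs) x y \<longleftrightarrow> compat cs x y"
    if "distinct cs" "set cs = S" "x \<in> AP S" "y \<in> AP S" "x \<noteq> y" "\<exists>s\<in>S. x = - \<alpha> s \<or> y = - \<alpha> s" for cs x y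
    using that(6) neg[OF that(1,2) _ that(4)] neg[OF that(1,2) _ that(3)] that(5) sym[OF that(1-4)]
      compat_commute[of cs x y] by metis
  have pos: "cpt (word_prod G cs) x y \<longleftrightarrow> compat cs x y"
    if "reach k cs x" "distinct cs" "set cs = S" "x \<in> AP S" "y \<in> AP S" "x \<noteq> y" for k cs x y
    using that
  proof (induction k arbitrary: cs x y)
    case k: (0 cs x y)
    then obtain s cs' where cs: "cs = s # cs'" by (cases cs) auto
    have s: "s \<in> S" "x = \<alpha> s" using k cs by auto
    have d: "distinct (s # cs')" "set (s # cs') = S" using k cs by auto
    have d': "distinct (cs' @ [s])" "set (cs' @ [s]) = S" using d by auto
    have xy: "x \<in> AP S" "y \<in> AP S" "x \<noteq> y" using k by auto
    have sg: "sig s x \<in> AP S" "sig s y \<in> AP S" "sig s x \<noteq> sig s y"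
      using sig_AP(1)[OF subset_refl s(1)] inj_on_eq_iff[OF inj_on_sig[OF subset_refl s(1)]] xy by auto
    have sub: "set cs' \<subseteq> S" using d by auto
    have "cpt (word_prod G cs) x y \<longleftrightarrow> cpt (word_prod G (cs' @ [s])) (sig s x) (sig s y)"
      using ax[OF coxeter_elementI[OF d] initial_in_first[OF d(1) equalityD1[OF d(2)]] xy(1,2)] s(1) sub
      unfolding cs by simp
    also have "\<dots> \<longleftrightarrow> compat (cs' @ [s]) (sig s x) (sig s y)"
      using both[OF d' sg] s by auto
    also have "\<dots> \<longleftrightarrow> compat cs x y"
      using compat_rotate[of s cs' x y] d xy s(1) sub unfolding cs by simp
    finally show ?case .
  next
    case k: (Suc k cs x y)
    then obtain s cs' where cs: "cs = s # cs'" by (cases cs) auto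
    have r: "reach (Suc k) (s # cs') x" and s1: "s \<in> S" using k.prems cs by auto
    from r s1 have s: "s \<in> S" "x \<in> Pos" "reach k (cs' @ [s]) (sig s x)" by (auto simp: sig_Pos)
    have d: "distinct (s # cs')" "set (s # cs') = S" using k cs by auto
    have d': "distinct (cs' @ [s])" "set (cs' @ [s]) = S" using d by auto
    have xy: "x \<in> AP S" "y \<in> AP S" "x \<noteq> y" using k by auto
    have sg: "sig s x \<in> AP S" "sig s y \<in> AP S" "sig s x \<noteq> sig s y"
      using sig_AP(1)[OF subset_refl s(1)] inj_on_eq_iff[OF inj_on_sig[OF subset_refl s(1)]] xy by auto
    have sub: "set cs' \<subseteq> S" using d by auto
    have "cpt (word_prod G cs) x y \<longleftrightarrow> cpt (word_prod G (cs' @ [s])) (sig s x) (sig s y)"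
      using ax[OF coxeter_elementI[OF d] initial_in_first[OF d(1) equalityD1[OF d(2)]] xy(1,2)] s(1) sub
      unfolding cs by simp
    also have "\<dots> \<longleftrightarrow> compat (cs' @ [s]) (sig s x) (sig s y)"
      using k.IH[OF s(3) d' sg] .
    also have "\<dots> \<longleftrightarrow> compat cs x y"
      using compat_rotate[of s cs' x y] d xy s(1) sub unfolding cs by simp
    finally show ?case .
  qed
  show ?thesis
  proof (cases "x \<in> Pos")
    case True
    then obtain k where "reach k cs x"
      using reach_exists[of cs x] assms by (auto simp: supported_S)
    then show ?thesis using pos assms by blast
  next
    case False
    then have "\<exists>s\<in>S. x = - \<alpha> s" using assms by (auto simp: AP_eq)
    then show ?thesis using both assms by blast
  qed
qed

subsection \<open>Facets\<close>

definition euler_sorted :: "'a list \<Rightarrow> 'v list \<Rightarrow> bool" where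
  "euler_sorted cs ds \<longleftrightarrow> sorted_wrt (\<lambda>x y. 0 \<le> euler cs x y \<and> euler cs y x \<le> 0) ds"

text \<open>A root that precedes \<open>d\<close> in one list and follows it in the other has both
  values of the Euler form zero. It is therefore orthogonal to \<open>d\<close>, and
  \<open>d\<close> can be moved to the front.\<close>

lemma euler_sorted_unique_product:
  assumes "distinct cs" "set cs \<subseteq> S"
  shows "euler_sorted cs ds \<Longrightarrow> euler_sorted cs es \<Longrightarrow> distinct ds \<Longrightarrow> distinct es \<Longrightarrow>
    set ds = set es \<Longrightarrow> (\<And>x. x \<in> set ds \<Longrightarrow> supported (set cs) x) \<Longrightarrow>
    foldr reflection ds v = foldr reflection es v"
proof (induction ds arbitrary: es)
  case (Cons d ds)
  then obtain e1 e2 where es: "es = e1 @ d # e2" using split_list[of d es] by auto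
  have "insert d (set ds) = insert d (set (e1 @ e2))" "d \<notin> set ds" "d \<notin> set (e1 @ e2)"
    using Cons.prems es by auto
  then have set: "set ds = set (e1 @ e2)" by (simp add: insert_ident)
  have "inner e d = 0" if e: "e \<in> set e1" for e
  proof -
    have "e \<in> set ds" using e set by auto
    then have "0 \<le> euler cs d e" "euler cs e d \<le> 0" using Cons.prems(1) by (auto simp: euler_sorted_def)
    moreover have "0 \<le> euler cs e d" "euler cs d e \<le> 0"
      using Cons.prems(2) e by (auto simp: euler_sorted_def es sorted_wrt_append)
    moreover have "supported (set cs) e" "supported (set cs) d" using Cons.prems(6) \<open>e \<in> set ds\<close> by auto
    ultimately show ?thesis using euler_orthogonal[OF assms, of e d] by simp
  qed
  then have "foldr reflection es v = reflection d (foldr reflection (e1 @ e2) v)"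
    unfolding es by (rule foldr_reflection_move)
  moreover have "foldr reflection ds v = foldr reflection (e1 @ e2) v"
    using Cons.prems set by (intro Cons.IH) (auto simp: es euler_sorted_def sorted_wrt_append)
  ultimately show ?case by simp
qed simp

text \<open>Deleting letters from a reduced word of the longest element amounts to multiplying by the
  reflections in the roots of these letters. So the letters outside of \<open>F\<close> multiply to the longest
  element if and only if the letters of \<open>cs\<close> outside of \<open>F\<close> cancel against the reflections in the
  positive roots of \<open>F\<close>. Euler-sorted lists of the same roots differ by swaps of orthogonal roots
  only, so the choice of \<open>ds\<close> does not matter.\<close>

definition facet :: "'a list \<Rightarrow> 'v set \<Rightarrow> bool" where
  "facet cs F \<longleftrightarrow> F \<subseteq> AP (set cs) \<and> card F = length cs \<and>
     (\<exists>ds. distinct ds \<and> set ds = F \<inter> Pos \<and> euler_sorted cs ds \<and>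
       (\<forall>v\<in>V. act (word_prod G (filter (\<lambda>s. - \<alpha> s \<notin> F) cs)) (foldr reflection ds v) = v))"

lemma facet_sorted:
  assumes "facet cs F" "distinct cs" "set cs \<subseteq> S" "distinct ds" "set ds = F \<inter> Pos" "euler_sorted cs ds" "v \<in> V"
  shows "act (word_prod G (filter (\<lambda>s. - \<alpha> s \<notin> F) cs)) (foldr reflection ds v) = v"
proof -
  obtain es where es: "distinct es" "set es = F \<inter> Pos" "euler_sorted cs es"
    "act (word_prod G (filter (\<lambda>s. - \<alpha> s \<notin> F) cs)) (foldr reflection es v) = v"
    and F: "F \<subseteq> AP (set cs)"
    using assms(1,7) unfolding facet_def by blast
  have "supported (set cs) x" if "x \<in> set ds" for x
    using that assms(3,5) F AP_Pos_supported by blast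
  then have "foldr reflection ds v = foldr reflection es v"
    using assms es by (intro euler_sorted_unique_product[OF assms(2,3)]) auto
  then show ?thesis using es by simp
qed

lemma foldr_reflection_in_V: "set ds \<subseteq> V \<Longrightarrow> v \<in> V \<Longrightarrow> foldr reflection ds v \<in> V"
  by (induction ds) auto

lemma foldr_reflection_conj:
  "s \<in> S \<Longrightarrow> set ds \<subseteq> V \<Longrightarrow> v \<in> V \<Longrightarrow>
    foldr reflection (map (act s) ds) (act s v) = act s (foldr reflection ds v)"
  by (induction ds) (auto simp: act_reflection foldr_reflection_in_V)

text \<open>The word contains \<open>s\<close> if \<open>- \<alpha> s\<close> is absent from the
  facet, and the list contains \<open>\<alpha> s\<close> if it is present. Two flags cover the four
  cases at once, and rotation just swaps and negates them.\<close>

definition act_if :: "bool \<Rightarrow> 'a \<Rightarrow> 'v \<Rightarrow> 'v" where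
  "act_if b s v = (if b then act s v else v)"

lemma act_if_in_V [simp]: "s \<in> S \<Longrightarrow> v \<in> V \<Longrightarrow> act_if b s v \<in> V"
  by (simp add: act_if_def)

lemma act_if_act_if [simp]: "s \<in> S \<Longrightarrow> v \<in> V \<Longrightarrow> act_if b s (act_if b s v) = v"
  by (simp add: act_if_def)

lemma act_if_not: "s \<in> S \<Longrightarrow> v \<in> V \<Longrightarrow> act_if (\<not> b) s v = act_if b s (act s v)"
  by (simp add: act_if_def)

section \<open>Splitting off the rotated letter and its root\<close>

context
  fixes s cs F
  assumes d: "distinct (s # cs)" and S: "set (s # cs) \<subseteq> S" and F: "F \<subseteq> AP (set (s # cs))"
begin

lemma facet_Pos_supported: "x \<in> F \<inter> Pos \<Longrightarrow> supported (set (s # cs)) x"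
  using F S AP_Pos_supported by blast

lemma gen_S: "s \<in> S" "s \<notin> set cs" "set cs \<subseteq> S"
  using S d by auto

lemma filter_word_closed [simp]: "word_prod G (filter P cs) \<in> carrier G"
  using gen_S by (intro word_prod_closed) auto

text \<open>If \<open>s\<close> is the first letter, \<open>\<alpha> s\<close> may precede every
  positive root of the facet; if it is the last letter, \<open>\<alpha> s\<close> may follow them.
  In the two descriptions of a facet below, its reflection can thus be taken as the outermost or the
  innermost one.\<close>

lemma sorted_first:
  assumes "distinct ds" "set ds \<subseteq> F \<inter> Pos - {\<alpha> s}" "euler_sorted (s # cs) ds"
  shows "euler_sorted (s # cs) (\<alpha> s # ds)"
proof -
  have "0 \<le> euler (s # cs) (\<alpha> s) x \<and> euler (s # cs) x (\<alpha> s) \<le> 0" if "x \<in> set ds" for x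
  proof -
    have x: "x \<in> Pos" "x \<noteq> \<alpha> s" "supported (set (s # cs)) x" using that assms facet_Pos_supported by auto
    have "0 \<le> coef s x" "0 \<le> coef s (act s x)" using x gen_Pos[of s x] gen_S Pos_coef by auto
    then show ?thesis
      unfolding euler_first[OF gen_S(2) S] euler_first_right[OF d S x(3)] by simp
  qed
  then show ?thesis using assms(3) by (simp add: euler_sorted_def del: euler.simps)
qed

lemma sorted_last:
  assumes "distinct ds" "set ds \<subseteq> F \<inter> Pos - {\<alpha> s}" "euler_sorted (cs @ [s]) ds"
  shows "euler_sorted (cs @ [s]) (ds @ [\<alpha> s])"
proof -
  have dS: "distinct (cs @ [s])" "set (cs @ [s]) \<subseteq> S" using d S by auto
  have "0 \<le> euler (cs @ [s]) x (\<alpha> s) \<and> euler (cs @ [s]) (\<alpha> s) x \<le> 0" if "x \<in> set ds" for x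
  proof -
    have x: "x \<in> Pos" "x \<noteq> \<alpha> s" "supported (set (s # cs)) x" using that assms facet_Pos_supported by auto
    have sx: "supported (set (s # cs)) (act s x)" using supported_act[OF _ S x(3)] by simp
    have xx: "act s (act s x) = x" using x gen_S by simp
    have "0 \<le> coef s x" "0 \<le> coef s (act s x)" using x gen_Pos[of s x] gen_S Pos_coef by auto
    then show ?thesis
      using euler_last_left[OF d S sx] unfolding euler_last[OF dS] xx by simp
  qed
  then show ?thesis using assms(3) by (simp add: euler_sorted_def sorted_wrt_append)
qed

lemma facet_first_iff:
  "facet (s # cs) F \<longleftrightarrow> card F = Suc (length cs) \<and>
     (\<exists>ds. distinct ds \<and> set ds = F \<inter> Pos - {\<alpha> s} \<and> euler_sorted (s # cs) ds \<and>
       (\<forall>v\<in>V. act_if (- \<alpha> s \<notin> F) s (act (word_prod G (filter (\<lambda>t. - \<alpha> t \<notin> F) cs))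
         (act_if (\<alpha> s \<in> F) s (foldr reflection ds v))) = v))" (is "?L \<longleftrightarrow> ?R")
proof -
  define ext where "ext ds = (if \<alpha> s \<in> F then \<alpha> s # ds else ds)" for ds
  have ext: "distinct (ext ds) \<and> set (ext ds) = F \<inter> Pos \<and> euler_sorted (s # cs) (ext ds)"
    and prod: "v \<in> V \<Longrightarrow> act (word_prod G (filter (\<lambda>t. - \<alpha> t \<notin> F) (s # cs))) (foldr reflection (ext ds) v) =
      act_if (- \<alpha> s \<notin> F) s (act (word_prod G (filter (\<lambda>t. - \<alpha> t \<notin> F) cs))
         (act_if (\<alpha> s \<in> F) s (foldr reflection ds v)))"
    if ds: "distinct ds" "set ds = F \<inter> Pos - {\<alpha> s}" "euler_sorted (s # cs) ds" for ds v
  proof -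
    show "distinct (ext ds) \<and> set (ext ds) = F \<inter> Pos \<and> euler_sorted (s # cs) (ext ds)"
      using sorted_first[OF ds(1) equalityD1[OF ds(2)] ds(3)] ds simple_Pos[OF gen_S(1)]
      by (cases "\<alpha> s \<in> F") (simp_all add: ext_def insert_absorb)
    assume v: "v \<in> V"
    have "set ds \<subseteq> V" using ds(2) Pos_in_V by blast
    then have fv: "foldr reflection ds v \<in> V" using v foldr_reflection_in_V by blast
    then have "foldr reflection (ext ds) v = act_if (\<alpha> s \<in> F) s (foldr reflection ds v)"
      using gen_S by (simp add: ext_def act_if_def act_gen_reflection)
    then show "act (word_prod G (filter (\<lambda>t. - \<alpha> t \<notin> F) (s # cs))) (foldr reflection (ext ds) v) =
      act_if (- \<alpha> s \<notin> F) s (act (word_prod G (filter (\<lambda>t. - \<alpha> t \<notin> F) cs))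
         (act_if (\<alpha> s \<in> F) s (foldr reflection ds v)))"
      using gen_S fv by (simp add: act_if_def[of "- \<alpha> s \<notin> F"] act_mult)
  qed
  show ?thesis
  proof
    assume L: ?L
    then obtain es where es: "distinct es" "set es = F \<inter> Pos" "euler_sorted (s # cs) es"
      unfolding facet_def by blast
    define ds where "ds = filter (\<lambda>x. x \<noteq> \<alpha> s) es"
    have ds: "distinct ds" "set ds = F \<inter> Pos - {\<alpha> s}" "euler_sorted (s # cs) ds"
      using es by (auto simp: ds_def euler_sorted_def intro: sorted_wrt_filter)
    then show ?R
      using L facet_sorted[OF L d S, of "ext ds"] ext[OF ds] prod[OF ds]
      by (intro conjI exI[of _ ds]) (auto simp: facet_def)
  next
    assume R: ?R
    then obtain ds where ds: "distinct ds" "set ds = F \<inter> Pos - {\<alpha> s}" "euler_sorted (s # cs) ds"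
      and eq: "\<forall>v\<in>V. act_if (- \<alpha> s \<notin> F) s (act (word_prod G (filter (\<lambda>t. - \<alpha> t \<notin> F) cs))
         (act_if (\<alpha> s \<in> F) s (foldr reflection ds v))) = v" by blast
    then show ?L
      unfolding facet_def using R F ext[OF ds] prod[OF ds] by (intro conjI exI[of _ "ext ds"]) auto
  qed
qed

lemma facet_last_iff:
  "facet (cs @ [s]) F \<longleftrightarrow> card F = Suc (length cs) \<and>
     (\<exists>ds. distinct ds \<and> set ds = F \<inter> Pos - {\<alpha> s} \<and> euler_sorted (cs @ [s]) ds \<and>
       (\<forall>v\<in>V. act (word_prod G (filter (\<lambda>t. - \<alpha> t \<notin> F) cs)) (act_if (- \<alpha> s \<notin> F) s
         (foldr reflection ds (act_if (\<alpha> s \<in> F) s v))) = v))" (is "?L \<longleftrightarrow> ?R")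
proof -
  have dS: "distinct (cs @ [s])" "set (cs @ [s]) \<subseteq> S" using d S by auto
  define ext where "ext ds = (if \<alpha> s \<in> F then ds @ [\<alpha> s] else ds)" for ds
  have ext: "distinct (ext ds) \<and> set (ext ds) = F \<inter> Pos \<and> euler_sorted (cs @ [s]) (ext ds)"
    and prod: "v \<in> V \<Longrightarrow> act (word_prod G (filter (\<lambda>t. - \<alpha> t \<notin> F) (cs @ [s]))) (foldr reflection (ext ds) v) =
      act (word_prod G (filter (\<lambda>t. - \<alpha> t \<notin> F) cs)) (act_if (- \<alpha> s \<notin> F) s
         (foldr reflection ds (act_if (\<alpha> s \<in> F) s v)))"
    if ds: "distinct ds" "set ds = F \<inter> Pos - {\<alpha> s}" "euler_sorted (cs @ [s]) ds" for ds v
  proof -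
    show "distinct (ext ds) \<and> set (ext ds) = F \<inter> Pos \<and> euler_sorted (cs @ [s]) (ext ds)"
      using sorted_last[OF ds(1) equalityD1[OF ds(2)] ds(3)] ds simple_Pos[OF gen_S(1)]
      by (cases "\<alpha> s \<in> F") (simp_all add: ext_def insert_absorb)
    assume v: "v \<in> V"
    have V: "set ds \<subseteq> V" using ds(2) Pos_in_V by blast
    have eq: "foldr reflection (ext ds) v = foldr reflection ds (act_if (\<alpha> s \<in> F) s v)"
      using gen_S v by (simp add: ext_def act_if_def act_gen_reflection)
    have fv: "foldr reflection ds (act_if (\<alpha> s \<in> F) s v) \<in> V"
      using v gen_S V by (intro foldr_reflection_in_V) auto
    have "set (filter (\<lambda>t. - \<alpha> t \<notin> F) cs) \<subseteq> S" using gen_S by auto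
    then show "act (word_prod G (filter (\<lambda>t. - \<alpha> t \<notin> F) (cs @ [s]))) (foldr reflection (ext ds) v) =
      act (word_prod G (filter (\<lambda>t. - \<alpha> t \<notin> F) cs)) (act_if (- \<alpha> s \<notin> F) s
         (foldr reflection ds (act_if (\<alpha> s \<in> F) s v)))"
      unfolding eq using gen_S fv by (simp add: act_if_def[of "- \<alpha> s \<notin> F"] act_mult act_one)
  qed
  show ?thesis
  proof
    assume L: ?L
    then obtain es where es: "distinct es" "set es = F \<inter> Pos" "euler_sorted (cs @ [s]) es"
      unfolding facet_def by blast
    define ds where "ds = filter (\<lambda>x. x \<noteq> \<alpha> s) es"
    have ds: "distinct ds" "set ds = F \<inter> Pos - {\<alpha> s}" "euler_sorted (cs @ [s]) ds"
      using es by (auto simp: ds_def euler_sorted_def intro: sorted_wrt_filter)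
    then show ?R
      using L facet_sorted[OF L dS, of "ext ds"] ext[OF ds] prod[OF ds]
      by (intro conjI exI[of _ ds]) (auto simp: facet_def)
  next
    assume R: ?R
    then obtain ds where ds: "distinct ds" "set ds = F \<inter> Pos - {\<alpha> s}" "euler_sorted (cs @ [s]) ds"
      and eq: "\<forall>v\<in>V. act (word_prod G (filter (\<lambda>t. - \<alpha> t \<notin> F) cs)) (act_if (- \<alpha> s \<notin> F) s
         (foldr reflection ds (act_if (\<alpha> s \<in> F) s v))) = v" by blast
    then show ?L
      unfolding facet_def using R F ext[OF ds] prod[OF ds] by (intro conjI exI[of _ "ext ds"]) auto
  qed
qed

end

section \<open>Rotation of facets\<close>

lemma inj_on_neg_simple: "J \<subseteq> S \<Longrightarrow> inj_on (\<lambda>t. - \<alpha> t) J"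
  using inj_on_subset[OF simple_inj] by (auto simp: inj_on_def)

lemma sig_image_iff:
  assumes "J \<subseteq> S" "s \<in> J" "F \<subseteq> AP J" "y \<in> AP J"
  shows "y \<in> sig s ` F \<longleftrightarrow> sig s y \<in> F"
proof
  assume "y \<in> sig s ` F"
  then obtain x where "x \<in> F" "y = sig s x" by blast
  then show "sig s y \<in> F" using sig_AP(2)[OF assms(1,2), of x] assms(3) by auto
next
  assume "sig s y \<in> F"
  then show "y \<in> sig s ` F" using sig_AP(2)[OF assms(1,2,4)] by (metis image_eqI)
qed

lemma euler_sorted_rotate:
  assumes "distinct (s # cs)" "set (s # cs) \<subseteq> S" "\<And>x. x \<in> set ds \<Longrightarrow> supported (set (s # cs)) x"
  shows "euler_sorted (cs @ [s]) (map (act s) ds) \<longleftrightarrow> euler_sorted (s # cs) ds"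
proof -
  have "euler (cs @ [s]) (act s x) (act s y) = euler (s # cs) x y" if "x \<in> set ds" "y \<in> set ds" for x y
    using euler_rotate[OF assms(1,2)] assms(3) that by simp
  then show ?thesis
    unfolding euler_sorted_def sorted_wrt_map
    by (auto intro: sorted_wrt_mono_rel[rotated] simp del: euler.simps)
qed

text \<open>An identity of the shape s^a C s^b R = 1 is equivalent to C s^b R s^a = 1. Conjugating
  \<open>R\<close> by \<open>s\<close> reflects the roots of its list and negates both exponents,
  which gives the identity for the rotated word.\<close>

lemma facet_rotate:
  assumes d: "distinct (s # cs)" and S: "set (s # cs) \<subseteq> S" and F: "F \<subseteq> AP (set (s # cs))"
  shows "facet (s # cs) F \<longleftrightarrow> facet (cs @ [s]) (sig s ` F)"
proof -
  let ?J = "set (s # cs)" and ?F = "sig s ` F"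
  have s: "s \<in> S" "s \<in> ?J" "s \<notin> set cs" "set cs \<subseteq> S" using S d by auto
  have F': "?F \<subseteq> AP ?J" using sig_AP(1)[OF S s(2)] F by blast
  note iff = sig_image_iff[OF S s(2) F]
  have APs: "\<alpha> s \<in> AP ?J" "\<And>t. t \<in> ?J \<Longrightarrow> - \<alpha> t \<in> AP ?J"
    using S s supported_simple[OF S] by (auto simp: AP_eq)
  have m1: "(- \<alpha> s \<in> ?F) = (\<alpha> s \<in> F)" "(\<alpha> s \<in> ?F) = (- \<alpha> s \<in> F)"
    using iff[OF APs(1)] iff[OF APs(2)[OF s(2)]] s by auto
  have "(- \<alpha> t \<in> ?F) = (- \<alpha> t \<in> F)" if t: "t \<in> set cs" for t
  proof -
    have "t \<in> S" "t \<noteq> s" "t \<in> ?J" using t s by auto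
    then show ?thesis using iff[OF APs(2)] by simp
  qed
  then have fil: "filter (\<lambda>t. - \<alpha> t \<notin> ?F) cs = filter (\<lambda>t. - \<alpha> t \<notin> F) cs"
    by (intro filter_cong) auto
  have ap: "x \<in> AP ?J" if "x \<in> F" for x using F that by blast
  have m2: "?F \<inter> Pos - {\<alpha> s} = act s ` (F \<inter> Pos - {\<alpha> s})"
  proof (intro Set.set_eqI iffI)
    fix y assume "y \<in> ?F \<inter> Pos - {\<alpha> s}"
    then have y: "y \<in> ?F" "y \<in> Pos" "y \<noteq> \<alpha> s" by auto
    then have "act s y \<in> F" using iff[of y] F' s by (auto simp: sig_Pos)
    moreover have p: "act s y \<in> Pos" using gen_Pos s y by blast
    moreover have "y = act s (act s y)" using y s by simp
    moreover have "act s y \<noteq> \<alpha> s"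
    proof
      assume "act s y = \<alpha> s"
      then have "y = - \<alpha> s" using y s by (metis Pos_in_V act_gen_gen act_gen_simple)
      then show False using y s by simp
    qed
    ultimately show "y \<in> act s ` (F \<inter> Pos - {\<alpha> s})" by blast
  next
    fix y assume "y \<in> act s ` (F \<inter> Pos - {\<alpha> s})"
    then obtain x where x: "x \<in> F" "x \<in> Pos" "x \<noteq> \<alpha> s" "y = act s x" by blast
    then have "y \<in> Pos" using gen_Pos s by blast
    moreover have "y \<in> ?F" using x s sig_Pos[of s x] by (metis image_eqI)
    moreover have "y \<noteq> \<alpha> s"
    proof
      assume "y = \<alpha> s"
      then have "x = - \<alpha> s" using x s by (metis Pos_in_V act_gen_gen act_gen_simple)
      then show False using x s by simp
    qed
    ultimately show "y \<in> ?F \<inter> Pos - {\<alpha> s}" by blast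
  qed
  have card: "card ?F = card F"
    by (rule card_image) (rule inj_on_subset[OF inj_on_sig[OF S s(2)] F])
  define C where "C = word_prod G (filter (\<lambda>t. - \<alpha> t \<notin> F) cs)"
  have C: "C \<in> carrier G" using s by (auto simp: C_def intro!: word_prod_closed)
  \<comment> \<open>\<open>act_if a s\<close> is an involution, so composing \<open>f\<close> with
    it from the left gives the identity if and only if composing from the right does.\<close>
  have eqv: "(\<forall>v\<in>V. act_if a s (act C (act_if b s (foldr reflection ds v))) = v) \<longleftrightarrow>
     (\<forall>v\<in>V. act C (act_if (\<not> b) s (foldr reflection (map (act s) ds) (act_if (\<not> a) s v))) = v)"
    if ds: "set ds \<subseteq> V" for a b ds
  proof -
    define f where "f y = act C (act_if b s (foldr reflection ds y))" for y
    have fV: "f y \<in> V" if "y \<in> V" for y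
      using that s C foldr_reflection_in_V[OF ds] by (simp add: f_def)
    have "act C (act_if (\<not> b) s (foldr reflection (map (act s) ds) (act_if (\<not> a) s v))) = f (act_if a s v)"
      if v: "v \<in> V" for v
    proof -
      have "act_if (\<not> a) s v = act s (act_if a s v)" using v s by (simp add: act_if_def)
      then have "foldr reflection (map (act s) ds) (act_if (\<not> a) s v) = act s (foldr reflection ds (act_if a s v))"
        using foldr_reflection_conj[OF s(1) ds] v s by simp
      then show ?thesis
        using s v foldr_reflection_in_V[OF ds, of "act_if a s v"] by (simp add: f_def act_if_not)
    qed
    then have "?thesis \<longleftrightarrow> ((\<forall>v\<in>V. act_if a s (f v) = v) \<longleftrightarrow> (\<forall>v\<in>V. f (act_if a s v) = v))"
      by (simp add: f_def)
    moreover have "(\<forall>v\<in>V. act_if a s (f v) = v) \<longleftrightarrow> (\<forall>v\<in>V. f (act_if a s v) = v)"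
      using fV s by (metis act_if_act_if act_if_in_V)
    ultimately show ?thesis by blast
  qed
  have sup: "supported ?J x" if "x \<in> F \<inter> Pos - {\<alpha> s}" for x
    using that F AP_Pos_supported[OF S] by blast
  show ?thesis
  proof
    assume "facet (s # cs) F"
    then obtain ds where ds: "distinct ds" "set ds = F \<inter> Pos - {\<alpha> s}" "euler_sorted (s # cs) ds"
      and eq: "\<forall>v\<in>V. act_if (- \<alpha> s \<notin> F) s (act C (act_if (\<alpha> s \<in> F) s (foldr reflection ds v))) = v"
      and c: "card F = Suc (length cs)"
      unfolding facet_first_iff[OF d S F] C_def by blast
    have V: "set ds \<subseteq> V" using ds(2) Pos_in_V by blast
    have "inj_on (act s) (set ds)"
      using V s by (intro inj_onI) (metis act_gen_gen subsetD)
    then have "distinct (map (act s) ds)" using ds(1) by (simp add: distinct_map)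
    moreover have "set (map (act s) ds) = ?F \<inter> Pos - {\<alpha> s}" using ds m2 by simp
    moreover have "euler_sorted (cs @ [s]) (map (act s) ds)"
      using euler_sorted_rotate[OF d S, of ds] ds sup by simp
    ultimately show "facet (cs @ [s]) ?F"
      unfolding facet_last_iff[OF d S F'] m1 fil C_def[symmetric]
      using c card eqv[OF V] eq by (intro conjI exI[of _ "map (act s) ds"]) auto
  next
    assume "facet (cs @ [s]) ?F"
    then obtain es where es: "distinct es" "set es = act s ` (F \<inter> Pos - {\<alpha> s})" "euler_sorted (cs @ [s]) es"
      and eq: "\<forall>v\<in>V. act C (act_if (\<alpha> s \<notin> F) s (foldr reflection es (act_if (- \<alpha> s \<in> F) s v))) = v"
      and c: "card F = Suc (length cs)"
      unfolding facet_last_iff[OF d S F'] m1 fil C_def[symmetric] m2 card by blast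
    define ds where "ds = map (act s) es"
    have esV: "set es \<subseteq> V" using es(2) Pos_in_V s by auto
    have V: "set ds \<subseteq> V" using esV s by (auto simp: ds_def)
    have mm: "map (act s) ds = es" using esV s by (auto simp: ds_def intro!: map_idI)
    have "inj_on (act s) (set es)"
      using esV s by (intro inj_onI) (metis act_gen_gen subsetD)
    then have 1: "distinct ds" using es(1) by (simp add: distinct_map ds_def)
    have 2: "set ds = F \<inter> Pos - {\<alpha> s}"
    proof -
      have "set ds = (\<lambda>x. act s (act s x)) ` (F \<inter> Pos - {\<alpha> s})"
        using es(2) by (simp add: ds_def image_image)
      also have "\<dots> = (\<lambda>x. x) ` (F \<inter> Pos - {\<alpha> s})" using s by (intro image_cong) auto
      finally show ?thesis by simp
    qed
    have 3: "euler_sorted (s # cs) ds"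
      using euler_sorted_rotate[OF d S, of ds] es mm sup 2 by simp
    show "facet (s # cs) F"
      unfolding facet_first_iff[OF d S F] C_def[symmetric]
      using c eqv[OF V, of "- \<alpha> s \<notin> F" "\<alpha> s \<in> F"] eq mm 1 2 3
      by (intro conjI exI[of _ ds]) auto
  qed
qed

text \<open>Carter's lemma: as many reflections as the dimension of the space of displacements of their
  product have roots that span this space.\<close>

lemma facet_neg_simple:
  assumes fac: "facet cs F" and d: "distinct cs" and S: "set cs \<subseteq> S"
    and s: "s \<in> set cs" "- \<alpha> s \<in> F" and y: "y \<in> F" "y \<in> Pos"
  shows "coef s y = 0"
proof -
  obtain ds where F: "F \<subseteq> AP (set cs)" "card F = length cs" and ds: "distinct ds" "set ds = F \<inter> Pos"
    and eq: "\<And>v. v \<in> V \<Longrightarrow> act (word_prod G (filter (\<lambda>s. - \<alpha> s \<notin> F) cs)) (foldr reflection ds v) = v"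
    using fac unfolding facet_def by blast
  define u where "u = filter (\<lambda>s. - \<alpha> s \<notin> F) cs"
  define K where "K = set u"
  have u: "distinct u" "set u \<subseteq> S" "K \<subseteq> S" using d S by (auto simp: u_def K_def)
  have fin: "finite F" using F finite_AP[OF S] finite_subset by blast
  have Kn: "K = {t \<in> set cs. - \<alpha> t \<notin> F}" by (auto simp: K_def u_def)
  note inj = inj_on_neg_simple[OF S]
  \<comment> \<open>The set \<open>F\<close> has one element for each letter of \<open>cs\<close>.
    Those that are negative simple delete their letters, so as many letters remain as there are
    positive roots.\<close>
  have cardK: "card (set ds) = card K"
  proof -
    have "F = (F \<inter> Pos) \<union> (\<lambda>t. - \<alpha> t) ` (set cs - K)"
      using F(1) S by (auto simp: AP_eq Kn)
    moreover have "(F \<inter> Pos) \<inter> (\<lambda>t. - \<alpha> t) ` (set cs - K) = {}" using S by auto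
    ultimately have "card F = card (F \<inter> Pos) + card ((\<lambda>t. - \<alpha> t) ` (set cs - K))"
      using fin by (metis card_Un_disjoint finite_Int finite_imageI finite_Diff List.finite_set)
    also have "card ((\<lambda>t. - \<alpha> t) ` (set cs - K)) = card (set cs - K)"
      using inj by (intro card_image) (auto intro: inj_on_subset)
    also have "card (set cs - K) = card (set cs) - card K"
      using Kn by (intro card_Diff_subset) (auto simp: K_def)
    also have "card (set cs) = length cs" using d by (rule distinct_card)
    finally have "length cs = card (set ds) + (length cs - card K)" using F(2) ds by simp
    moreover have "card K \<le> length cs"
      using card_mono[of "set cs" K] Kn distinct_card[OF d] by auto
    ultimately show ?thesis by simp
  qed
  have dsV: "set ds \<subseteq> V" using ds(2) Pos_in_V by blast
  \<comment> \<open>The component of a simple root from \<open>K\<close> orthogonal to the roots in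
    \<open>ds\<close> is fixed by their reflections, hence by the word \<open>u\<close>. By
    \<open>word_fixed_orthogonal\<close> it is then orthogonal to the simple root too, and so it is
    zero.\<close>
  have sub: "\<alpha> ` K \<subseteq> span (set ds)"
  proof
    fix a assume "a \<in> \<alpha> ` K"
    then obtain t where t: "t \<in> K" "a = \<alpha> t" by blast
    obtain p where p: "p \<in> span (set ds)" "\<forall>x\<in>set ds. inner (a - p) x = 0"
      using orthogonal_projection_exists[of "set ds" a] by blast
    have pV: "p \<in> V" using p(1) dsV span_minimal[OF dsV subspace_span] by blast
    then have qV: "a - p \<in> V" using t u by (auto simp: span_diff)
    have "foldr reflection ds (a - p) = a - p" using p by (intro foldr_reflection_fixed) auto
    then have "act (word_prod G u) (a - p) = a - p" using eq[OF qV] by (simp add: u_def)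
    then have "inner (a - p) a = 0"
      using word_fixed_orthogonal[of u "a - p" t] u qV t by (simp add: K_def)
    moreover have "inner (a - p) z = 0" if "z \<in> span (set ds)" for z
      using that
    proof (induction rule: span_induct_alt)
      case (step c x y)
      then show ?case using p(2) by (simp add: inner_add_right)
    qed simp
    note this[OF p(1)]
    ultimately have "inner (a - p) (a - p) = 0" by (simp add: inner_diff_right)
    then show "a \<in> span (set ds)" using p(1) by simp
  qed
  have ind: "independent (\<alpha> ` K)"
    using simple_independent by (rule independent_mono) (use u in auto)
  \<comment> \<open>By equal cardinalities the inclusion of spans is an equality: otherwise
    \<open>y\<close> would give one independent vector too many in the span of
    \<open>ds\<close>.\<close>
  have "y \<in> span (\<alpha> ` K)"
  proof (rule ccontr)
    assume no: "y \<notin> span (\<alpha> ` K)"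
    then have "independent (insert y (\<alpha> ` K))" using ind by (rule independent_insertI)
    moreover have "y \<in> span (set ds)" using y ds by (intro span_base) auto
    ultimately have "card (insert y (\<alpha> ` K)) \<le> card (set ds)"
      using independent_span_bound[of "set ds" "insert y (\<alpha> ` K)"] sub by auto
    moreover have "y \<notin> \<alpha> ` K" using no span_base by blast
    moreover have "card (\<alpha> ` K) = card K"
      using simple_inj u by (intro card_image) (auto intro: inj_on_subset)
    ultimately show False using cardK by (simp add: K_def)
  qed
  moreover have "s \<in> S - K" using s S by (auto simp: Kn)
  ultimately show ?thesis using span_supported u by blast
qed

lemma facet_compat_neg:
  assumes "facet cs F" "distinct cs" "set cs \<subseteq> S" "s \<in> set cs" "- \<alpha> s \<in> F" "y \<in> F"
  shows "compat cs (- \<alpha> s) y"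
proof -
  have "F \<subseteq> AP (set cs)" using assms by (simp add: facet_def)
  then consider "y \<in> Pos" | t where "t \<in> set cs" "y = - \<alpha> t"
    using assms by (auto simp: AP_eq)
  then have "coef s y \<le> 0"
  proof cases
    case 1
    then show ?thesis using facet_neg_simple assms by simp
  next
    case 2
    then have "s \<in> S" "t \<in> S" using assms by auto
    then show ?thesis using 2 by simp
  qed
  then show ?thesis using compat_neg assms by blast
qed

lemma facet_compat:
  assumes "facet cs F" "distinct cs" "set cs \<subseteq> S" "x \<in> F" "y \<in> F"
  shows "compat cs x y"
proof -
  have pos: "compat cs x y"
    if "reach k cs x" "facet cs F" "distinct cs" "set cs \<subseteq> S" "x \<in> F" "y \<in> F" for k cs F x y
    using that
  proof (induction k arbitrary: cs F x y)
    case (0 cs F x y)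
    then obtain s c where cs: "cs = s # c" by (cases cs) auto
    have s: "s \<in> S" "x = \<alpha> s" using 0 cs by auto
    have d: "distinct (s # c)" "set (s # c) \<subseteq> S" using 0 cs by auto
    have F: "F \<subseteq> AP (set (s # c))" using 0 cs by (simp add: facet_def)
    have "facet (c @ [s]) (sig s ` F)" using facet_rotate[OF d F] 0 cs by simp
    moreover have "- \<alpha> s \<in> sig s ` F" using s 0 by (metis image_eqI sig_simple)
    ultimately have "compat (c @ [s]) (sig s x) (sig s y)"
      using facet_compat_neg[of "c @ [s]" "sig s ` F" s "sig s y"] d s 0 by auto
    then show ?case using compat_rotate[OF d, of x y] F 0 cs by auto
  next
    case (Suc k cs F x y)
    then obtain s c where cs: "cs = s # c" by (cases cs) auto
    have r: "reach (Suc k) (s # c) x" using Suc cs by simp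
    have d: "distinct (s # c)" "set (s # c) \<subseteq> S" using Suc cs by auto
    have F: "F \<subseteq> AP (set (s # c))" using Suc cs by (simp add: facet_def)
    have "s \<in> S" using d by simp
    then have "reach k (c @ [s]) (sig s x)" using r by (auto simp: sig_Pos)
    moreover have "facet (c @ [s]) (sig s ` F)" using facet_rotate[OF d F] Suc cs by simp
    ultimately have "compat (c @ [s]) (sig s x) (sig s y)"
      using d Suc.prems by (intro Suc.IH) auto
    then show ?case using compat_rotate[OF d, of x y] F Suc.prems cs by auto
  qed
  have F: "F \<subseteq> AP (set cs)" using assms by (simp add: facet_def)
  show ?thesis
  proof (cases "x \<in> Pos")
    case True
    then have "supported (set cs) x" using F assms AP_Pos_supported by blast
    then obtain k where "reach k cs x" using reach_exists assms True by blast
    then show ?thesis using pos assms by blast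
  next
    case False
    then obtain s where "s \<in> set cs" "x = - \<alpha> s" using F assms by (auto simp: AP_eq)
    then show ?thesis using facet_compat_neg assms by blast
  qed
qed

text \<open>Adding \<open>- \<alpha> s\<close> deletes the letter \<open>s\<close>, so the remaining
  letters and reflections are those of the smaller facet. On roots without a coefficient at
  \<open>\<alpha> s\<close> the Euler forms of both words agree, hence the list stays
  sorted.\<close>

lemma facet_cone:
  assumes d: "distinct cs" and S: "set cs \<subseteq> S" and s: "s \<in> set cs"
    and fac: "facet (filter (\<lambda>t. t \<noteq> s) cs) F"
  shows "facet cs (insert (- \<alpha> s) F)"
proof -
  let ?c = "filter (\<lambda>t. t \<noteq> s) cs"
  have sS: "s \<in> S" using s S by auto
  have setc: "set ?c = set cs - {s}" by auto
  have J: "set cs - {s} \<subseteq> S" using S by auto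
  obtain ds where F: "F \<subseteq> AP (set cs - {s})" "card F = length ?c" and ds: "distinct ds" "set ds = F \<inter> Pos"
    "euler_sorted ?c ds"
    and eq: "\<forall>v\<in>V. act (word_prod G (filter (\<lambda>s. - \<alpha> s \<notin> F) ?c)) (foldr reflection ds v) = v"
    using fac unfolding facet_def setc by blast
  have notin: "- \<alpha> s \<notin> F"
  proof
    assume "- \<alpha> s \<in> F"
    then have "- \<alpha> s \<in> AP (set cs - {s})" using F(1) by blast
    then have "- \<alpha> s \<in> (\<lambda>t. - \<alpha> t) ` (set cs - {s})"
      using neg_simple_not_Pos[OF sS] unfolding AP_eq[OF J] by blast
    then obtain t where "t \<in> set cs - {s}" "- \<alpha> s = - \<alpha> t" by blast
    then show False using J sS simple_eq_iff[of s t] by auto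
  qed
  have APs: "AP (set cs - {s}) \<subseteq> AP (set cs)" "- \<alpha> s \<in> AP (set cs)"
    using S s by (auto simp: AP_eq J supported_def)
  have fin: "finite F" using F(1) finite_AP[OF J] finite_subset by blast
  have "length cs = Suc (length ?c)"
  proof -
    have "length ?c = card (set cs - {s})" using distinct_card[of ?c] d setc by simp
    then show ?thesis using s distinct_card[OF d] by (simp add: card_Suc_Diff1[symmetric] del: card_Diff_insert)
  qed
  then have 1: "card (insert (- \<alpha> s) F) = length cs" using notin fin F(2) by simp
  have 2: "set ds = insert (- \<alpha> s) F \<inter> Pos" using ds sS by simp
  have c0: "coef s x = 0" if "x \<in> set ds" for x
    using that ds F(1) AP_Pos_supported[OF J, of x] sS by (auto simp: supported_def)
  have 3: "euler_sorted cs ds"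
    using ds(3) unfolding euler_sorted_def
    by (rule sorted_wrt_mono_rel[rotated]) (simp add: euler_remove c0)
  have "filter (\<lambda>t. - \<alpha> t \<notin> insert (- \<alpha> s) F) cs = filter (\<lambda>t. - \<alpha> t \<notin> F) ?c"
    unfolding filter_filter using S sS by (intro filter_cong) auto
  then show ?thesis
    unfolding facet_def using F APs 1 2 3 ds(1) eq by (intro conjI exI[of _ ds]) auto
qed

lemma pairwise_compat_rotate:
  assumes d: "distinct (s # cs)" "set (s # cs) \<subseteq> S" and F: "F \<subseteq> AP (set (s # cs))"
    and pw: "pairwise (compat (s # cs)) F"
  shows "pairwise (compat (cs @ [s])) (sig s ` F)"
proof (rule pairwiseI)
  fix a b assume ab: "a \<in> sig s ` F" "b \<in> sig s ` F" "a \<noteq> b"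
  then obtain x y where xy: "x \<in> F" "y \<in> F" "a = sig s x" "b = sig s y" by blast
  then have "compat (s # cs) x y" using pw ab by (auto simp: pairwise_def)
  then show "compat (cs @ [s]) a b" using compat_rotate[OF d, of x y] xy F by blast
qed

lemma facet_unrotate:
  assumes d: "distinct (s # cs)" "set (s # cs) \<subseteq> S" and F: "F \<subseteq> AP (set (s # cs))"
    and F1: "sig s ` F \<subseteq> F1" "facet (cs @ [s]) F1"
  shows "\<exists>F'. F \<subseteq> F' \<and> facet (s # cs) F'"
proof -
  have s: "s \<in> set (s # cs)" by simp
  have sub: "F1 \<subseteq> AP (set (s # cs))" using F1 by (simp add: facet_def)
  have img: "sig s ` F1 \<subseteq> AP (set (s # cs))" using sig_AP(1)[OF d(2) s] sub by blast
  have inv: "sig s (sig s z) = z" if "z \<in> AP (set (s # cs))" for z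
    using sig_AP(2)[OF d(2) s that] .
  have "sig s ` sig s ` F1 = (\<lambda>z. z) ` F1"
    unfolding image_image using sub inv by (intro image_cong) auto
  then have "facet (s # cs) (sig s ` F1)" using facet_rotate[OF d img] F1 by simp
  moreover have "F \<subseteq> sig s ` F1"
  proof
    fix z assume "z \<in> F"
    then have "z = sig s (sig s z)" "sig s z \<in> F1" using inv F F1 by auto
    then show "z \<in> sig s ` F1" by (rule image_eqI)
  qed
  ultimately show ?thesis by blast
qed

lemma compat_extends_to_facet:
  assumes "distinct cs" "set cs \<subseteq> S" "F \<subseteq> AP (set cs)" "\<And>x y. x \<in> F \<Longrightarrow> y \<in> F \<Longrightarrow> x \<noteq> y \<Longrightarrow> compat cs x y"
  shows "\<exists>F'. F \<subseteq> F' \<and> facet cs F'"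
  using assms
proof (induction "length cs" arbitrary: cs F rule: less_induct)
  case less
  \<comment> \<open>Stated for every word of the same length, as it is needed for the rotations of
    \<open>cs\<close>, while the induction hypothesis covers shorter words only.\<close>
  have neg: "\<exists>F'. F \<subseteq> F' \<and> facet c F'"
    if "length c = length cs" "distinct c" "set c \<subseteq> S" "F \<subseteq> AP (set c)" "pairwise (compat c) F"
      "s \<in> set c" "- \<alpha> s \<in> F" for c F s
  proof -
    let ?c = "filter (\<lambda>t. t \<noteq> s) c"
    have sS: "s \<in> S" using that by auto
    have setc: "set ?c = set c - {s}" by auto
    have J: "set c - {s} \<subseteq> S" using that by auto
    define F1 where "F1 = F - {- \<alpha> s}"
    have c0: "coef s x \<le> 0" if "x \<in> F1" for x
      using that \<open>pairwise (compat c) F\<close> \<open>- \<alpha> s \<in> F\<close> compat_neg[OF \<open>set c \<subseteq> S\<close> \<open>s \<in> set c\<close>, of x]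
      by (auto simp: F1_def pairwise_def)
    have eq0: "coef s x = 0" if "x \<in> F1" "x \<in> Pos" for x
      using c0[OF that(1)] Pos_coef[OF that(2) sS] by simp
    have AP1: "F1 \<subseteq> AP (set c - {s})"
    proof
      fix x assume x: "x \<in> F1"
      then have "x \<in> AP (set c)" "x \<noteq> - \<alpha> s" using \<open>F \<subseteq> AP (set c)\<close> by (auto simp: F1_def)
      then consider "x \<in> Pos" "supported (set c) x" | t where "t \<in> set c" "t \<noteq> s" "x = - \<alpha> t"
        by (auto simp: AP_eq[OF \<open>set c \<subseteq> S\<close>])
      then show "x \<in> AP (set c - {s})"
      proof cases
        case 1
        then have "supported (set c - {s}) x" using eq0[OF x] by (auto simp: supported_def)
        then show ?thesis using 1 by (simp add: AP_eq[OF J])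
      next
        case 2
        then show ?thesis by (auto simp: AP_eq[OF J])
      qed
    qed
    have len: "length ?c < length cs"
      using that(1,6) length_filter_less[of s c "\<lambda>t. t \<noteq> s"] by simp
    have cc: "compat ?c x y" if "x \<in> F1" "y \<in> F1" "x \<noteq> y" for x y
    proof -
      have "compat c x y" using that \<open>pairwise (compat c) F\<close> by (auto simp: F1_def pairwise_def)
      then show ?thesis
        using eq0[OF that(1)] eq0[OF that(2)] euler_remove[of s x y c] euler_remove[of s y x c]
        unfolding compat_def setc by auto
    qed
    have "\<exists>F2. F1 \<subseteq> F2 \<and> facet ?c F2"
      using cc by (intro less.hyps[OF len]) (simp add: that, unfold setc, rule J, rule AP1)
    then obtain F2 where "F1 \<subseteq> F2" "facet ?c F2" by blast
    then have "facet c (insert (- \<alpha> s) F2)" "F \<subseteq> insert (- \<alpha> s) F2"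
      using facet_cone that by (auto simp: F1_def)
    then show ?thesis by blast
  qed
  have pos: "\<exists>F'. F \<subseteq> F' \<and> facet c F'"
    if "reach k c x" "length c = length cs" "distinct c" "set c \<subseteq> S" "F \<subseteq> AP (set c)"
      "pairwise (compat c) F" "x \<in> F" for k c x F
    using that
  proof (induction k arbitrary: c x F)
    case (0 c x F)
    then obtain s c' where c: "c = s # c'" by (cases c) auto
    have s: "s \<in> S" "x = \<alpha> s" "s \<in> set (s # c')" using 0 c by auto
    have d: "distinct (s # c')" "set (s # c') \<subseteq> S" using 0 c by auto
    have F: "F \<subseteq> AP (set (s # c'))" using 0 c by simp
    have F': "sig s ` F \<subseteq> AP (set (c' @ [s]))" using sig_AP(1)[OF d(2) s(3)] F by auto
    have pw: "pairwise (compat (c' @ [s])) (sig s ` F)"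
      using pairwise_compat_rotate[OF d F] "0.prems"(6) c by simp
    have "- \<alpha> s \<in> sig s ` F" using s 0 by (metis image_eqI sig_simple)
    then obtain F1 where F1: "sig s ` F \<subseteq> F1" "facet (c' @ [s]) F1"
      using neg[of "c' @ [s]" "sig s ` F" s] d F' pw 0 c by auto
    show ?case using facet_unrotate[OF d F F1] c by simp
  next
    case (Suc k c x F)
    then obtain s c' where c: "c = s # c'" by (cases c) auto
    have r: "reach (Suc k) (s # c') x" using Suc.prems c by simp
    have d: "distinct (s # c')" "set (s # c') \<subseteq> S" using Suc.prems c by auto
    have s: "s \<in> S" "s \<in> set (s # c')" using d by auto
    have r': "reach k (c' @ [s]) (sig s x)" using r s by (auto simp: sig_Pos)
    have F: "F \<subseteq> AP (set (s # c'))" using Suc.prems c by simp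
    have F': "sig s ` F \<subseteq> AP (set (c' @ [s]))" using sig_AP(1)[OF d(2) s(2)] F by auto
    have pw: "pairwise (compat (c' @ [s])) (sig s ` F)"
      using pairwise_compat_rotate[OF d F] Suc.prems(6) c by simp
    obtain F1 where F1: "sig s ` F \<subseteq> F1" "facet (c' @ [s]) F1"
      using Suc.IH[OF r' _ _ _ F' pw] d Suc.prems c by auto
    show ?case using facet_unrotate[OF d F F1] c by simp
  qed
  have pw: "pairwise (compat cs) F" using less.prems by (auto simp: pairwise_def)
  consider "F = {}" | s where "s \<in> set cs" "- \<alpha> s \<in> F" | x where "x \<in> F" "x \<in> Pos"
    using less.prems(3) by (auto simp: AP_eq[OF less.prems(2)])
  then show ?case
  proof cases
    case 1
    \<comment> \<open>The facet of all negative simple roots: every letter is deleted and no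
      reflection occurs, so the product is empty.\<close>
    define N where "N = (\<lambda>t. - \<alpha> t) ` set cs"
    have "card N = length cs" using less.prems(1) inj_on_neg_simple[OF less.prems(2)]
      by (simp add: N_def card_image distinct_card)
    moreover have "N \<inter> Pos = {}" using less.prems(2) by (auto simp: N_def)
    moreover have "filter (\<lambda>t. - \<alpha> t \<notin> N) cs = []" by (auto simp: N_def filter_empty_conv)
    moreover have "N \<subseteq> AP (set cs)" by (auto simp: N_def AP_eq[OF less.prems(2)])
    ultimately have "facet cs N"
      unfolding facet_def by (intro conjI exI[of _ "[]"]) (auto simp: euler_sorted_def act_one)
    then show ?thesis using 1 by blast
  next
    case 2
    then show ?thesis using neg[of cs F s] less.prems pw by blast
  next
    case 3
    then have "supported (set cs) x" using less.prems AP_Pos_supported by blast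
    then obtain k where "reach k cs x" using reach_exists less.prems 3 by blast
    then show ?thesis using pos[of k cs x F] less.prems pw 3 by blast
  qed
qed

subsection \<open>The sorting word of the longest element\<close>

lemma act_eqI:
  assumes "v \<in> carrier G" "w \<in> carrier G" "\<And>x. x \<in> V \<Longrightarrow> act v x = act w x" shows "v = w"
proof -
  have "inv w \<otimes> v = \<one>"
    using assms by (intro act_faithful) (auto simp: act_mult)
  then have "w \<otimes> (inv w \<otimes> v) = w" using assms by simp
  then show ?thesis using assms by (simp flip: m_assoc)
qed

lemma gen_conj:
  assumes w: "w \<in> carrier G" and s: "s \<in> S" and t: "t \<in> S" and "act w (\<alpha> t) = \<alpha> s"
  shows "w \<otimes> t = s \<otimes> w"
proof (rule act_eqI)
  fix x assume x: "x \<in> V"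
  have "act (w \<otimes> t) x = reflection (act w (\<alpha> t)) (act w x)"
    using w t x by (simp add: act_mult act_gen_reflection act_reflection)
  then show "act (w \<otimes> t) x = act (s \<otimes> w) x"
    using assms x by (simp add: act_mult act_gen_reflection)
qed (use assms in auto)

text \<open>Multiplication by a generator in the 0-Hecke monoid. Accordingly,
  \<open>greedy cs p\<close> is the Demazure product of the first \<open>p\<close> letters of the
  infinite word.\<close>

definition greedy_step :: "'a \<Rightarrow> 'a \<Rightarrow> 'a" where
  "greedy_step w s = (if act w (\<alpha> s) \<in> Pos then w \<otimes> s else w)"

fun greedy :: "'a list \<Rightarrow> nat \<Rightarrow> 'a" where
  "greedy cs 0 = \<one>"
| "greedy cs (Suc p) = greedy_step (greedy cs p) (cs ! (p mod length cs))"

lemma greedy_step_closed: "w \<in> carrier G \<Longrightarrow> s \<in> S \<Longrightarrow> greedy_step w s \<in> carrier G"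
  by (simp add: greedy_step_def)

lemma greedy_closed:
  assumes "set cs \<subseteq> S" "cs \<noteq> []" shows "greedy cs p \<in> carrier G"
proof (induction p)
  case (Suc p)
  have "cs ! (p mod length cs) \<in> S" using assms nth_mem[of "p mod length cs" cs] by auto
  then show ?case using Suc by (simp add: greedy_step_closed)
qed simp

lemma inversions_greedy_step:
  "w \<in> carrier G \<Longrightarrow> s \<in> S \<Longrightarrow> inversions (greedy_step w s) =
    (if act w (\<alpha> s) \<in> Pos then insert (act w (\<alpha> s)) (inversions w) else inversions w)"
  by (simp add: greedy_step_def inversions_mult_gen)

text \<open>Putting \<open>s\<close> in front of a Demazure product multiplies it by
  \<open>s\<close> from the left if this makes it longer. The unrotated word has read one letter
  more, hence \<open>Suc q\<close> against \<open>q\<close>; once the rotated product has the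
  inversion \<open>\<alpha> s\<close>, the two products coincide.\<close>

lemma greedy_rotate:
  assumes S: "set (s # cs) \<subseteq> S"
  shows "greedy (s # cs) (Suc q) =
    (if \<alpha> s \<in> inversions (greedy (cs @ [s]) q) then greedy (cs @ [s]) q else s \<otimes> greedy (cs @ [s]) q)"
proof (induction q)
  case 0
  show ?case using S by (simp add: greedy_step_def act_one)
next
  case (Suc q)
  define t where "t = (cs @ [s]) ! (q mod length (cs @ [s]))"
  define w' where "w' = greedy (cs @ [s]) q"
  define w where "w = greedy (s # cs) (Suc q)"
  have tt: "(s # cs) ! (Suc q mod length (s # cs)) = t"
    unfolding t_def using nth_rotate1[of "q mod length (s # cs)" "s # cs"]
    by (simp add: mod_Suc_eq del: nth_Cons_Suc)
  have s: "s \<in> S" using S by simp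
  have t: "t \<in> S" unfolding t_def using S nth_mem[of "q mod length (cs @ [s])" "cs @ [s]"] by auto
  have w': "w' \<in> carrier G" unfolding w'_def using S by (intro greedy_closed) auto
  have IH: "w = (if \<alpha> s \<in> inversions w' then w' else s \<otimes> w')"
    using Suc by (simp only: w_def w'_def)
  have gw: "greedy (s # cs) (Suc (Suc q)) = greedy_step w t"
    by (simp only: greedy.simps(2)[of "s # cs" "Suc q"] tt w_def)
  have gw': "greedy (cs @ [s]) (Suc q) = greedy_step w' t" by (simp add: w'_def t_def)
  define \<gamma> where "\<gamma> = act w' (\<alpha> t)"
  have g: "\<gamma> \<in> \<Phi>" "act (inv w') \<gamma> = \<alpha> t" using w' t by (auto simp: \<gamma>_def)
  show ?case
  proof (cases "\<alpha> s \<in> inversions w'")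
    case True
    then have "\<alpha> s \<in> inversions (greedy_step w' t)"
      using inversions_greedy_step[OF w' t] by simp
    then show ?thesis unfolding gw gw' using IH True by simp
  next
    case False
    then have w: "w = s \<otimes> w'" using IH by simp
    have aw: "act w (\<alpha> t) = act s \<gamma>" using w w' s t by (simp add: act_mult \<gamma>_def)
    consider "\<gamma> = \<alpha> s" | "\<gamma> = - \<alpha> s" | "\<gamma> \<noteq> \<alpha> s" "\<gamma> \<noteq> - \<alpha> s" by blast
    then show ?thesis
    proof cases
      \<comment> \<open>The rotated word takes \<open>t\<close> and gains \<open>\<alpha> s\<close>.
        By \<open>gen_conj\<close> it arrives at \<open>s \<otimes> w'\<close>, where the unrotated
        word already is, and the latter skips \<open>t\<close>.\<close>
      case 1
      then have step': "greedy_step w' t = w' \<otimes> t" "\<alpha> s \<in> inversions (greedy_step w' t)"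
        using s inversions_greedy_step[OF w' t] by (auto simp: greedy_step_def simp flip: \<gamma>_def)
      have "greedy_step w t = w" using aw 1 s by (simp add: greedy_step_def)
      moreover have "w' \<otimes> t = s \<otimes> w'" using gen_conj[OF w' s t] 1 by (simp add: \<gamma>_def)
      ultimately show ?thesis unfolding gw gw' using step' w by simp
    next
      case 2
      then have "- act (inv w') (\<alpha> s) = \<alpha> t"
        using g w' s by (metis act_uminus add.inverse_inverse inv_closed simple_in_V)
      then have "\<alpha> s \<in> inversions w'" using s t by (simp add: inversions_def)
      then show ?thesis using False by blast
    next
      case 3
      have iff: "act s \<gamma> \<in> Pos \<longleftrightarrow> \<gamma> \<in> Pos"
      proof
        assume "\<gamma> \<in> Pos" then show "act s \<gamma> \<in> Pos" using gen_Pos s 3 by blast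
      next
        assume a: "act s \<gamma> \<in> Pos"
        have "act s \<gamma> \<noteq> \<alpha> s"
        proof
          assume "act s \<gamma> = \<alpha> s"
          then have "\<gamma> = - \<alpha> s" using g s by (metis root_in_V act_gen_gen act_gen_simple)
          then show False using 3 by blast
        qed
        then have "act s (act s \<gamma>) \<in> Pos" using gen_Pos s a by blast
        then show "\<gamma> \<in> Pos" using g s by simp
      qed
      have "\<alpha> s \<notin> inversions (greedy_step w' t)"
        using inversions_greedy_step[OF w' t] False 3 by (auto simp flip: \<gamma>_def)
      moreover have "greedy_step w t = s \<otimes> greedy_step w' t"
        using aw iff w w' s t by (simp add: greedy_step_def m_assoc flip: \<gamma>_def)
      ultimately show ?thesis unfolding gw gw' by simp
    qed
  qed
qed

lemma reach_inj: "set cs \<subseteq> S \<Longrightarrow> reach k cs x \<Longrightarrow> reach k cs y \<Longrightarrow> x = y"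
proof (induction k cs x arbitrary: y rule: reach.induct)
  case (3 k s cs x)
  then have "act s x = act s y" by simp
  then show ?case using 3 by (metis Pos_in_V act_gen_gen list.set_intros(1) reach.simps(3) subsetD)
qed simp_all

lemma orthogonal_act: "s \<in> S \<Longrightarrow> x \<in> V \<Longrightarrow> inner x (\<alpha> s) = 0 \<Longrightarrow> act s x = x"
  by (simp add: act_gen_reflection reflection_orthogonal)

text \<open>Since \<open>\<alpha> s\<close> comes before \<open>y\<close>, the two values of the
  Euler form have prescribed signs. Since \<open>s\<close> is the last letter, they have the
  opposite signs. So both vanish and \<open>y\<close> is orthogonal to
  \<open>\<alpha> s\<close>.\<close>

lemma reach_after_last:
  assumes d: "distinct (s # cs)" and S: "set (s # cs) \<subseteq> S"
    and k: "reach k (cs @ [s]) (\<alpha> s)" and l: "reach l (cs @ [s]) y" and "k < l"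
  shows "act s y = y"
proof -
  have dS: "distinct (cs @ [s])" "set (cs @ [s]) \<subseteq> S" and s: "s \<in> S" using d S by auto
  have y: "y \<in> Pos" "supported (set (s # cs)) y" "y \<in> V"
    using reach_Pos[OF dS(2) l] reach_supported[OF dS(2) l] by auto
  have ne: "y \<noteq> \<alpha> s" using reach_unique[OF k] l \<open>k < l\<close> by blast
  have sy: "supported (set (s # cs)) (act s y)" "act s y \<in> Pos" "act s (act s y) = y"
    using supported_act[OF _ S y(2)] gen_Pos[OF s y(1) ne] y s by auto
  have K: "inner (\<alpha> s) (\<alpha> s) > 0" using s by simp
  have e: "0 \<le> euler (cs @ [s]) (\<alpha> s) y" "euler (cs @ [s]) y (\<alpha> s) \<le> 0"
    using reach_sorted[OF dS k l \<open>k < l\<close>] by auto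
  have "coef s y * inner (\<alpha> s) (\<alpha> s) / 2 \<le> 0" using e(2) unfolding euler_last[OF dS] .
  then have y0: "euler (cs @ [s]) y (\<alpha> s) = 0"
    unfolding euler_last[OF dS] using K Pos_coef[OF y(1) s] by (auto simp: mult_le_0_iff)
  have ll: "euler (cs @ [s]) (\<alpha> s) y = - coef s (act s y) * inner (\<alpha> s) (\<alpha> s) / 2"
    using euler_last_left[OF d S sy(1)] sy(3) by simp
  have "euler (cs @ [s]) (\<alpha> s) y \<le> 0"
    unfolding ll using K Pos_coef[OF sy(2) s] by simp
  then have "euler (cs @ [s]) (\<alpha> s) y = 0" using e(1) by simp
  then have "inner y (\<alpha> s) = 0"
    using y0 y euler_orthogonal[OF dS, of y "\<alpha> s"] supported_simple[OF S, of s] by simp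
  then show ?thesis using orthogonal_act s y by blast
qed

lemma reach_rotate_set:
  assumes S: "set (s # cs) \<subseteq> S"
  shows "{x. \<exists>k<Suc p. reach k (s # cs) x} =
    insert (\<alpha> s) (act s ` ({x. \<exists>k<p. reach k (cs @ [s]) x} - {\<alpha> s}))" (is "?L = ?R")
proof (intro Set.set_eqI iffI)
  have s: "s \<in> S" and S': "set (cs @ [s]) \<subseteq> S" using S by auto
  fix x
  {
    assume "x \<in> ?L"
    then obtain k where k: "k < Suc p" "reach k (s # cs) x" by blast
    show "x \<in> ?R"
    proof (cases k)
      case 0
      then show ?thesis using k by simp
    next
      case (Suc j)
      then have x: "x \<in> Pos" "x \<noteq> \<alpha> s" "reach j (cs @ [s]) (act s x)" "j < p" using k by auto
      have "act s x \<noteq> \<alpha> s"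
      proof
        assume "act s x = \<alpha> s"
        then have "x = - \<alpha> s" using x s by (metis Pos_in_V act_gen_gen act_gen_simple)
        then show False using x s by simp
      qed
      moreover have "x = act s (act s x)" using x s by simp
      ultimately show ?thesis using x by blast
    qed
  next
    assume "x \<in> ?R"
    then consider "x = \<alpha> s" | y k where "k < p" "reach k (cs @ [s]) y" "y \<noteq> \<alpha> s" "x = act s y" by blast
    then show "x \<in> ?L"
    proof cases
      case 1
      then show ?thesis by (intro CollectI exI[of _ 0]) simp
    next
      case 2
      have y: "y \<in> Pos" using reach_Pos[OF S' 2(2)] .
      have "x \<noteq> \<alpha> s"
      proof
        assume "x = \<alpha> s"
        then have "y = - \<alpha> s" using 2 y s by (metis Pos_in_V act_gen_gen act_gen_simple)
        then show False using y s by simp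
      qed
      moreover have "x \<in> Pos" "act s x = y" using 2 y s gen_Pos by auto
      ultimately have "reach (Suc k) (s # cs) x" using 2 by simp
      then show ?thesis using 2(1) by blast
    qed
  }
qed

text \<open>If the step at \<open>k\<close> adds the root \<open>\<alpha> s\<close> for the rotated word, then \<open>s\<close> permutes the inversions
  found before, and it fixes those found later, as both values of the Euler form vanish on them.\<close>

lemma inversions_greedy:
  assumes "distinct cs" "set cs \<subseteq> S" "cs \<noteq> []"
  shows "inversions (greedy cs p) = {x. \<exists>k<p. reach k cs x}"
  using assms
proof (induction p arbitrary: cs rule: less_induct)
  case (less p)
  show ?case
  proof (cases p)
    case 0
    then show ?thesis by simp
  next
    case p: (Suc p')
    obtain s c where cs: "cs = s # c" using less.prems by (cases cs) auto
    have d: "distinct (s # c)" and S: "set (s # c) \<subseteq> S" using less.prems cs by auto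
    have s: "s \<in> S" and S': "set (c @ [s]) \<subseteq> S" and d': "distinct (c @ [s])" using S d by auto
    define A where "A q = {x. \<exists>k<q. reach k (c @ [s]) x}" for q
    have IH: "inversions (greedy (c @ [s]) q) = A q" if "q \<le> p'" for q
      unfolding A_def using that p d' S' by (intro less.IH) auto
    let ?w = "greedy (c @ [s]) p'"
    have w: "?w \<in> carrier G" using S' by (intro greedy_closed) auto
    have APos: "A q \<subseteq> Pos" for q using reach_Pos[OF S'] by (auto simp: A_def)
    have goal: "inversions (greedy (s # c) (Suc p')) = insert (\<alpha> s) (act s ` (A p' - {\<alpha> s}))"
    proof (cases "\<alpha> s \<in> A p'")
      case False
      then have "\<alpha> s \<notin> inversions ?w" using IH by simp
      then show ?thesis
        unfolding greedy_rotate[OF S] using inversions_gen_mult[OF w s] IH[of p'] False by simp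
    next
      case True
      then obtain k where k: "k < p'" "reach k (c @ [s]) (\<alpha> s)" by (auto simp: A_def)
      let ?g = "greedy (c @ [s]) k" and ?t = "(c @ [s]) ! (k mod length (c @ [s]))"
      have g: "?g \<in> carrier G" using S' by (intro greedy_closed) auto
      have t: "?t \<in> S" using S' nth_mem[of "k mod length (c @ [s])" "c @ [s]"] by auto
      have notin: "\<alpha> s \<notin> A k"
        using reach_unique[OF k(2)] by (auto simp: A_def)
      have "\<alpha> s \<in> A (Suc k)" using k by (auto simp: A_def)
      moreover have "inversions (greedy (c @ [s]) (Suc k)) = A (Suc k)" "inversions ?g = A k"
        using IH[of "Suc k"] IH[of k] k by auto
      ultimately have taken: "act ?g (\<alpha> ?t) = \<alpha> s" "A (Suc k) = insert (\<alpha> s) (A k)"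
        using inversions_greedy_step[OF g t] notin by (auto split: if_splits)
      \<comment> \<open>The same element is \<open>?g \<otimes> ?t\<close> and
        \<open>s \<otimes> ?g\<close>. Its inversions, computed from the right and from the left,
        are \<open>A k\<close> and the image of \<open>A k\<close> under \<open>s\<close>, each with
        \<open>\<alpha> s\<close> added. So \<open>s\<close> permutes \<open>A k\<close>.\<close>
      then have "greedy (c @ [s]) (Suc k) = s \<otimes> ?g"
        using gen_conj[OF g s t] s by (simp add: greedy_step_def)
      then have "A (Suc k) = insert (\<alpha> s) (act s ` A k)"
        using inversions_gen_mult[OF g s] notin IH[of k] IH[of "Suc k"] k by simp
      then have ins: "insert (\<alpha> s) (A k) = insert (\<alpha> s) (act s ` A k)" using taken by simp
      have ns: "act s y \<noteq> \<alpha> s" if "y \<in> Pos" for y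
      proof
        assume "act s y = \<alpha> s"
        then have "y = - \<alpha> s" using that s by (metis Pos_in_V act_gen_gen act_gen_simple)
        then show False using that s by simp
      qed
      then have "\<alpha> s \<notin> act s ` A k" using APos[of k] by force
      then have stab: "act s ` A k = A k" using ins notin by (simp add: insert_ident)
      have into: "act s y \<in> A p' - {\<alpha> s}" if y: "y \<in> A p' - {\<alpha> s}" for y
      proof -
        obtain l where l: "l < p'" "reach l (c @ [s]) y" using y by (auto simp: A_def)
        have yP: "y \<in> Pos" using y APos by blast
        have "l \<noteq> k"
        proof
          assume "l = k"
          then have "y = \<alpha> s" using reach_inj[OF S' l(2)] k(2) by blast
          then show False using y by blast
        qed
        then consider "l < k" | "k < l" by linarith
        then show ?thesis
        proof cases
          case 1
          then have "y \<in> A k" using l by (auto simp: A_def)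
          then have "act s y \<in> A k" using stab by blast
          moreover have "A k \<subseteq> A p'" unfolding A_def using less_trans[OF _ k(1)] by blast
          ultimately show ?thesis using ns[OF yP] by blast
        next
          case 2
          then show ?thesis using reach_after_last[OF d S k(2) l(2)] y by simp
        qed
      qed
      have "act s ` (A p' - {\<alpha> s}) = A p' - {\<alpha> s}"
      proof (rule subset_antisym)
        show "act s ` (A p' - {\<alpha> s}) \<subseteq> A p' - {\<alpha> s}" by (rule image_subsetI) (rule into)
        show "A p' - {\<alpha> s} \<subseteq> act s ` (A p' - {\<alpha> s})"
        proof
          fix y assume y: "y \<in> A p' - {\<alpha> s}"
          then have "y \<in> V" using APos[of p'] Pos_in_V by blast
          then have "y = act s (act s y)" using s by simp
          then show "y \<in> act s ` (A p' - {\<alpha> s})" using into[OF y] by (rule image_eqI)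
        qed
      qed
      then have "insert (\<alpha> s) (act s ` (A p' - {\<alpha> s})) = A p'" using True by auto
      moreover have "inversions (greedy (s # c) (Suc p')) = A p'"
        unfolding greedy_rotate[OF S] using True IH[of p'] by simp
      ultimately show ?thesis by simp
    qed
    show ?thesis unfolding cs p reach_rotate_set[OF S] goal A_def ..
  qed
qed

lemma set_periodic_subword: "cs \<noteq> [] \<Longrightarrow> set (periodic_subword cs ps) \<subseteq> set cs"
  by (auto simp: periodic_subword_def)

text \<open>A chosen letter always lengthens the product, as prefixes of reduced words are reduced.
  If a letter at \<open>p\<close> that lengthens it were skipped, the prefix together with
  \<open>p\<close> could be completed to a reduced word of the longest element on lexicographically
  smaller positions.\<close>

lemma sorting_word_greedy:
  assumes S: "set cs = S" "cs \<noteq> []" and w\<^sub>0: "longest_element G S w\<^sub>0"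
    and ps: "reduced_positions G S cs w\<^sub>0 ps"
    and min: "\<And>qs. reduced_positions G S cs w\<^sub>0 qs \<Longrightarrow> ps = qs \<or> (ps, qs) \<in> lexord less_than"
  shows "greedy cs p = word_prod G (periodic_subword cs (filter (\<lambda>q. q < p) ps))"
proof (induction p)
  case 0
  show ?case by (simp add: periodic_subword_def)
next
  case (Suc p)
  define t where "t = cs ! (p mod length cs)"
  define pre where "pre = filter (\<lambda>q. q < p) ps"
  define post where "post = filter (\<lambda>q. \<not> q < p) ps"
  define u where "u = periodic_subword cs pre"
  have sorted: "sorted_wrt (<) ps" and red: "word_prod G (periodic_subword cs ps) = w\<^sub>0"
    "length ps = len w\<^sub>0"
    using ps by (auto simp: reduced_positions_def reduced_expression_def periodic_subword_def)
  have wS: "set (periodic_subword cs qs) \<subseteq> S" for qs using set_periodic_subword S by blast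
  have t: "t \<in> S" using S nth_mem[of "p mod length cs" cs] by (auto simp: t_def)
  have split: "ps = pre @ post"
    unfolding pre_def post_def by (rule strict_sorted_split[OF sorted])
  have app: "periodic_subword cs (xs @ ys) = periodic_subword cs xs @ periodic_subword cs ys" for xs ys
    by (simp add: periodic_subword_def)
  let ?w = "word_prod G u"
  have uS: "set u \<subseteq> S" using wS by (simp add: u_def)
  have w: "?w \<in> carrier G" using uS by simp
  have IH: "greedy cs p = ?w" using Suc by (simp add: u_def pre_def)
  have step: "greedy cs (Suc p) = greedy_step ?w t" by (simp add: IH t_def)
  have lenw: "len ?w = length pre"
  proof -
    have "w\<^sub>0 = ?w \<otimes> word_prod G (periodic_subword cs post)"
      using red(1) split app wS uS by (simp add: u_def)
    then have "len w\<^sub>0 \<le> len ?w + length post"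
      using len_mult_le[OF w, of "word_prod G (periodic_subword cs post)"]
        len_word_le[OF wS[of post]] wS by (simp add: periodic_subword_def)
    moreover have "len ?w \<le> length pre" using len_word_le[OF uS] by (simp add: u_def periodic_subword_def)
    ultimately show ?thesis using red(2) split by (metis add_le_cancel_right antisym length_append)
  qed
  show ?case
  proof (cases "p \<in> set ps")
    case True
    then have fil: "filter (\<lambda>q. q < Suc p) ps = pre @ [p]"
      using strict_sorted_filter_Suc[OF sorted, of p] by (simp add: pre_def)
    obtain rest where "ps = (pre @ [p]) @ rest"
      using strict_sorted_split[OF sorted, of "Suc p"] fil by metis
    then have nth: "periodic_subword cs ps ! length pre = t" "length pre < length ps"
      "take (length pre) (periodic_subword cs ps) = u"
      by (auto simp: periodic_subword_def t_def u_def nth_append)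
    have "set (word_roots (periodic_subword cs ps)) = Pos"
      using reduced_word_roots[OF wS[of ps]] red inversions_longest[OF w\<^sub>0]
      by (simp add: periodic_subword_def)
    moreover have "word_roots (periodic_subword cs ps) ! length pre = act ?w (\<alpha> t)"
      using word_roots_nth[OF wS[of ps], of "length pre"] nth by (simp add: periodic_subword_def)
    moreover have "length pre < length (word_roots (periodic_subword cs ps))"
      using nth by (simp add: periodic_subword_def)
    ultimately have "act ?w (\<alpha> t) \<in> Pos" by (metis nth_mem)
    then have "greedy_step ?w t = ?w \<otimes> t" by (simp add: greedy_step_def)
    moreover have "periodic_subword cs (pre @ [p]) = u @ [t]"
      by (simp add: u_def t_def periodic_subword_def)
    ultimately show ?thesis unfolding step fil using uS t by simp
  next
    case False
    then have fil: "filter (\<lambda>q. q < Suc p) ps = pre"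
      using strict_sorted_filter_Suc[OF sorted, of p] by (simp add: pre_def)
    have "act ?w (\<alpha> t) \<notin> Pos"
    proof
      assume pos: "act ?w (\<alpha> t) \<in> Pos"
      define v where "v = ?w \<otimes> t"
      have v: "v \<in> carrier G" "len v = Suc (length pre)"
        using w t len_ascent[OF w t pos] lenw by (auto simp: v_def)
      have cl: "inv v \<otimes> w\<^sub>0 \<in> carrier G" using v longest_closed[OF w\<^sub>0] by simp
      obtain r where r: "set r \<subseteq> S" "word_prod G r = inv v \<otimes> w\<^sub>0" "length r = len (inv v \<otimes> w\<^sub>0)"
        using reduced_exists[OF cl] unfolding reduced_expression_def by metis
      obtain rs where rs: "sorted_wrt (<) rs" "\<forall>q\<in>set rs. p < q" "periodic_subword cs rs = r"
        using periodic_subword_embed[of r cs p] r S by auto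
      define qs where "qs = pre @ p # rs"
      have word: "periodic_subword cs qs = u @ t # r"
        using rs by (simp add: qs_def u_def t_def periodic_subword_def)
      have "word_prod G (u @ t # r) = v \<otimes> (inv v \<otimes> w\<^sub>0)"
        using uS t r w longest_closed[OF w\<^sub>0] by (simp add: v_def m_assoc)
      also have "\<dots> = w\<^sub>0" using v longest_closed[OF w\<^sub>0] by (simp flip: m_assoc)
      finally have prod: "word_prod G (u @ t # r) = w\<^sub>0" .
      have "length (u @ t # r) = len w\<^sub>0"
        using r(3) v(2) len_longest_split[OF w\<^sub>0 v(1)] by (simp add: u_def periodic_subword_def)
      moreover have "sorted_wrt (<) qs"
        using rs sorted by (auto simp: qs_def pre_def sorted_wrt_append sorted_wrt_filter)
      ultimately have "reduced_positions G S cs w\<^sub>0 qs"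
        using prod word uS t r by (simp add: reduced_positions_def reduced_expression_def)
      then have "ps = qs \<or> (ps, qs) \<in> lexord less_than" by (rule min)
      moreover have "ps \<noteq> qs" using False by (auto simp: qs_def)
      ultimately have lx: "(post, p # rs) \<in> lexord less_than"
        using lexord_append_leftD[of pre post "p # rs" less_than] split by (auto simp: qs_def)
      show False
      \<comment> \<open>If \<open>post\<close> is empty, \<open>ps\<close> is a proper prefix of
        \<open>qs\<close> and thus smaller, so minimality does not help. But then the product is
        already the longest element, which has no ascent.\<close>
      proof (cases post)
        case Nil
        then have "?w = w\<^sub>0" using split red by (simp add: u_def)
        then show False using pos longest_act_simple[OF w\<^sub>0 t] Pos_not_uminus by auto
      next
        case (Cons h hs)
        then have "h \<in> set post" by simp
        then have "h \<in> set ps" "\<not> h < p" by (auto simp: post_def)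
        then have "p < h" using False by (metis linorder_neqE_nat)
        then show False using lx Cons by simp
      qed
    qed
    then have "greedy_step ?w t = ?w" by (simp add: greedy_step_def)
    then show ?thesis unfolding step fil u_def by simp
  qed
qed

text \<open>The root of the letter at position \<open>p\<close> is the one inversion that
  \<open>greedy\<close> gains there. By \<open>inversions_greedy\<close>, \<open>p\<close> is then
  the time at which this root turns negative, and the positions increase along the word.\<close>

lemma sorting_word_euler_sorted:
  assumes d: "distinct cs" and S: "set cs = S" and w\<^sub>0: "longest_element G S w\<^sub>0"
    and sw: "sorting_word G S cs w\<^sub>0 ws"
  shows "euler_sorted cs (word_roots ws)"
proof -
  obtain ps where ps: "reduced_positions G S cs w\<^sub>0 ps"
    and min: "\<And>qs. reduced_positions G S cs w\<^sub>0 qs \<Longrightarrow> ps = qs \<or> (ps, qs) \<in> lexord less_than"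
    and ws: "ws = periodic_subword cs ps"
    using sw by (auto simp: sorting_word_def)
  have wsS: "set ws \<subseteq> S" and sorted: "sorted_wrt (<) ps" and len: "length ws = length ps"
    using ps by (auto simp: reduced_positions_def reduced_expression_def ws periodic_subword_def)
  show ?thesis
  proof (cases "cs = []")
    case True
    then have "ws = []" using S wsS by simp
    then show ?thesis by (simp add: euler_sorted_def)
  next
    case False
    have S': "set cs \<subseteq> S" using S by simp
    note greedy = sorting_word_greedy[OF S False w\<^sub>0 ps min]
    have reach: "reach (ps ! i) cs (word_roots ws ! i)" if i: "i < length ps" for i
    proof -
      let ?p = "ps ! i" and ?w = "word_prod G (take i ws)" and ?t = "ws ! i"
      have wp: "periodic_subword cs (take i ps) = take i ws"
        by (simp add: ws periodic_subword_def take_map)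
      have g: "greedy cs ?p = ?w"
        using greedy[of ?p] strict_sorted_filter_nth[OF sorted i] wp by simp
      have t: "?t = cs ! (?p mod length cs)" "?t \<in> S"
        using i wsS len by (auto simp: ws periodic_subword_def)
      have "filter (\<lambda>q. q < Suc ?p) ps = take (Suc i) ps"
        using strict_sorted_filter_Suc[OF sorted, of ?p] strict_sorted_filter_nth[OF sorted i] i
        by (simp add: take_Suc_conv_app_nth)
      then have g': "greedy cs (Suc ?p) = word_prod G (take (Suc i) ws)"
        using greedy[of "Suc ?p"] by (simp add: ws periodic_subword_def take_map)
      have takeS: "set (take i ws) \<subseteq> S" using wsS by (auto dest: in_set_takeD)
      then have w: "?w \<in> carrier G" by simp
      have "word_prod G (take (Suc i) ws) = ?w \<otimes> ?t"
        using i len takeS t(2) by (simp add: take_Suc_conv_app_nth)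
      then have st: "greedy_step ?w ?t = ?w \<otimes> ?t" using g' g t(1) by simp
      have "?w \<noteq> ?w \<otimes> ?t"
      proof
        assume eq: "?w = ?w \<otimes> ?t"
        have "?t = inv ?w \<otimes> (?w \<otimes> ?t)" using w t(2) by (simp flip: m_assoc)
        also have "\<dots> = \<one>" unfolding eq[symmetric] using w by simp
        finally have "?t = \<one>" .
        then show False using gens_involutions[OF t(2)] by simp
      qed
      then have pos: "act ?w (\<alpha> ?t) \<in> Pos" using st by (auto simp: greedy_step_def split: if_splits)
      have "act ?w (\<alpha> ?t) \<in> inversions (greedy cs (Suc ?p))" "act ?w (\<alpha> ?t) \<notin> inversions (greedy cs ?p)"
        using inversions_mult_gen[OF w t(2) pos] g g' st \<open>word_prod G (take (Suc i) ws) = ?w \<otimes> ?t\<close> by auto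
      then obtain k where k: "k < Suc ?p" "reach k cs (act ?w (\<alpha> ?t))" "\<not> k < ?p"
        unfolding inversions_greedy[OF d S' False] by blast
      then have "k = ?p" by simp
      then show ?thesis using k(2) word_roots_nth[OF wsS, of i] i len by simp
    qed
    show ?thesis
      unfolding euler_sorted_def sorted_wrt_iff_nth_less
    proof (intro allI impI)
      fix i j assume ij: "i < j" "j < length (word_roots ws)"
      then have l: "i < length ps" "j < length ps" using len by auto
      then have "ps ! i < ps ! j" using sorted ij by (auto simp: sorted_wrt_iff_nth_less)
      then show "0 \<le> euler cs (word_roots ws ! i) (word_roots ws ! j) \<and>
          euler cs (word_roots ws ! j) (word_roots ws ! i) \<le> 0"
        using reach_sorted[OF d S' reach[OF l(1)] reach[OF l(2)]] by blast
    qed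
  qed
qed

text \<open>The roots are those of the full word, however many letters are deleted. A letter
  \<open>s\<close> that is kept conjugates the reflections of the tail; a deleted one cancels
  against the reflection in \<open>\<alpha> s\<close>, which stands in front of them.\<close>

lemma act_nths_word:
  "set ws \<subseteq> S \<Longrightarrow> v \<in> V \<Longrightarrow>
    act (word_prod G (nths ws A)) v = foldr reflection (nths (word_roots ws) (- A)) (act (word_prod G ws) v)"
proof (induction ws arbitrary: A)
  case Nil
  then show ?case by (simp add: act_one)
next
  case (Cons s ws)
  let ?B = "{j. Suc j \<in> A}"
  have s: "s \<in> S" "set ws \<subseteq> S" using Cons.prems by auto
  define ds where "ds = nths (word_roots ws) (- ?B)"
  define z where "z = act (word_prod G ws) v"
  have z: "z \<in> V" using s Cons.prems by (simp add: z_def)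
  have dsV: "set ds \<subseteq> V"
    using word_roots_roots[OF s(2)] set_nths_subset[of "word_roots ws" "- ?B"] root_in_V unfolding ds_def by blast
  have IH: "act (word_prod G (nths ws ?B)) v = foldr reflection ds z"
    using Cons.IH[of ?B] s Cons.prems by (simp add: ds_def z_def)
  have subS: "set (nths ws ?B) \<subseteq> S" using s(2) set_nths_subset[of ws ?B] by blast
  have roots: "nths (word_roots (s # ws)) (- A) = (if 0 \<in> A then [] else [\<alpha> s]) @ map (act s) ds"
    by (simp add: nths_Cons nths_map Collect_neg_eq ds_def)
  have full: "act (word_prod G (s # ws)) v = act s z" using s Cons.prems by (simp add: act_mult z_def)
  have conj: "foldr reflection (map (act s) ds) (act s z) = act s (foldr reflection ds z)"
    using foldr_reflection_conj[OF s(1) dsV z] .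
  have fV: "foldr reflection ds z \<in> V" using foldr_reflection_in_V[OF dsV z] .
  show ?case
  proof (cases "0 \<in> A")
    case True
    then have "act (word_prod G (nths (s # ws) A)) v = act s (foldr reflection ds z)"
      using s subS Cons.prems IH by (simp add: nths_Cons act_mult)
    then show ?thesis unfolding roots full using True conj by simp
  next
    case False
    then have "act (word_prod G (nths (s # ws) A)) v = foldr reflection ds z"
      using IH by (simp add: nths_Cons)
    moreover have "reflection (\<alpha> s) (act s (foldr reflection ds z)) = foldr reflection ds z"
      using fV s by (metis act_gen_gen act_gen_reflection act_in_V gen_in_carrier)
    ultimately show ?thesis unfolding roots full using False conj by simp
  qed
qed

end

section \<open>From positions of the word to almost positive roots\<close>

theorem theorem2p2:
  fixes G :: "('a, 'm) monoid_scheme" and S :: "'a set"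
    and act :: "'a \<Rightarrow> 'v::real_inner \<Rightarrow> 'v" and \<alpha> :: "'a \<Rightarrow> 'v"
    and cpt :: "'a \<Rightarrow> 'v \<Rightarrow> 'v \<Rightarrow> bool"
    and c w\<^sub>0 :: 'a and cs ws :: "'a list"
  assumes "coxeter_root_system G S act \<alpha>"
    and "coxeter_element G S c"
    and "reduced_expression G S cs c"
    and "longest_element G S w\<^sub>0"
    and "sorting_word G S cs w\<^sub>0 ws"
    and "compatibility_family G S act \<alpha> cpt"
  shows "simplicial_isomorphism (letter_root G act \<alpha> cs ws)
           {..<length (cs @ ws)} (subword_complex G S (cs @ ws) w\<^sub>0)
           (almost_positive_roots G act \<alpha> S) (cluster_complex G S act \<alpha> cpt c)"
proof -
  interpret coxeter_root_system G S act \<alpha> by fact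
  note w\<^sub>0 = assms(4)
  note cs = coxeter_word[OF assms(2,3)]
  have csS: "set cs \<subseteq> S" using cs by simp
  let ?n = "length cs" and ?Q = "cs @ ws" and ?U = "{..<length (cs @ ws)}"
  let ?f = "letter_root G act \<alpha> cs ws"
  obtain ps where "reduced_positions G S cs w\<^sub>0 ps" "ws = periodic_subword cs ps"
    using assms(5) by (auto simp: sorting_word_def)
  then have ws: "set ws \<subseteq> S" "word_prod G ws = w\<^sub>0" "length ws = len w\<^sub>0"
    by (auto simp: reduced_positions_def reduced_expression_def)
  have roots: "set (word_roots ws) = Pos" "distinct (word_roots ws)"
    using reduced_word_roots[OF ws(1)] ws inversions_longest[OF w\<^sub>0] by auto
  have sorted: "euler_sorted cs (word_roots ws)"
    using sorting_word_euler_sorted[OF cs(1,2) w\<^sub>0 assms(5)] .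
  \<comment> \<open>The roots of all positions as one list, so that bijectivity amounts to distinct
    entries and the right set of them.\<close>
  define L where "L = map (\<lambda>s. - \<alpha> s) cs @ word_roots ws"
  have L: "?f p = L ! p" if "p \<in> ?U" for p
    using that word_roots_nth[OF ws(1), of "p - ?n"] by (auto simp: letter_root_def L_def nth_append)
  have "set (map (\<lambda>s. - \<alpha> s) cs) \<inter> Pos = {}" using csS by auto
  then have "distinct L"
    unfolding L_def using cs(1) roots inj_on_neg_simple[OF csS] by (simp add: distinct_map)
  moreover have "set L = AP S"
    by (simp add: L_def roots(1) cs(2) almost_positive_roots_def Un_commute)
  ultimately have "bij_betw ((!) L) ?U (AP S)"
    by (intro bij_betw_nth) (auto simp: L_def)
  then have bij: "bij_betw ?f ?U (AP S)" using bij_betw_cong[of ?U ?f "(!) L" "AP S"] L by blast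
  then have inj: "inj_on ?f ?U" by (simp add: bij_betw_def)
  have in_img: "?f p \<in> ?f ` P \<longleftrightarrow> p \<in> P" if "P \<subseteq> ?U" "p \<in> ?U" for p P
    using inj that by (meson inj_on_image_mem_iff)

  have facet_iff: "word_prod G (nths ?Q (?U - P)) = w\<^sub>0 \<longleftrightarrow> facet cs (?f ` P)"
    if P: "P \<subseteq> ?U" and card: "card P = ?n" for P
  proof -
    let ?F = "?f ` P"
    have FAP: "?F \<subseteq> AP S" using bij P by (auto simp: bij_betw_def)
    have cardF: "card ?F = ?n" using card card_image[OF inj_on_subset[OF inj P]] by simp
    define K where "K = filter (\<lambda>s. - \<alpha> s \<notin> ?F) cs"
    define ds where "ds = filter (\<lambda>x. x \<in> ?F) (word_roots ws)"
    have ds: "distinct ds" "set ds = ?F \<inter> Pos" "euler_sorted cs ds"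
      using roots sorted by (auto simp: ds_def euler_sorted_def intro: sorted_wrt_filter)
    have K: "nths cs (?U - P) = K"
      unfolding K_def filter_eq_nths
    proof (rule nths_cong)
      fix i assume i: "i < ?n"
      then have "?f i = - \<alpha> (cs ! i)" by (simp add: letter_root_def)
      then show "i \<in> ?U - P \<longleftrightarrow> i \<in> {i. i < ?n \<and> - \<alpha> (cs ! i) \<notin> ?F}"
        using in_img[OF P, of i] i by auto
    qed
    let ?A = "{j. j + ?n \<in> ?U - P}"
    have D: "nths (word_roots ws) (- ?A) = ds"
      unfolding ds_def filter_eq_nths
    proof (rule nths_cong)
      fix j assume "j < length (word_roots ws)"
      then have j: "j < length ws" by simp
      then have "?f (j + ?n) = word_roots ws ! j" by (simp add: letter_root_def word_roots_nth[OF ws(1)])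
      then show "j \<in> - ?A \<longleftrightarrow> j \<in> {i. i < length (word_roots ws) \<and> word_roots ws ! i \<in> ?F}"
        using in_img[OF P, of "j + ?n"] j by auto
    qed
    have KS: "set K \<subseteq> S" using csS by (auto simp: K_def)
    have AS: "set (nths ws ?A) \<subseteq> S" using ws(1) set_nths_subset[of ws ?A] by blast
    have dsV: "set ds \<subseteq> V" using ds(2) Pos_in_V by blast
    have word: "word_prod G (nths ?Q (?U - P)) = word_prod G K \<otimes>\<^bsub>G\<^esub> word_prod G (nths ws ?A)"
      unfolding nths_append K using KS AS by simp
    have act: "act (word_prod G (nths ?Q (?U - P))) v = act (word_prod G K) (foldr reflection ds (act w\<^sub>0 v))"
      if "v \<in> V" for v
      unfolding word using KS AS that act_nths_word[OF ws(1) that, of ?A] D ws(2) by (simp add: act_mult)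
    have w\<^sub>0c: "w\<^sub>0 \<in> carrier G" using longest_closed[OF w\<^sub>0] .
    show ?thesis
    proof
      assume eq: "word_prod G (nths ?Q (?U - P)) = w\<^sub>0"
      \<comment> \<open>Taking \<open>act\<close> at \<open>inv w\<^sub>0\<close> applied to
        \<open>v\<close> removes the longest element from both sides, leaving the condition in
        \<open>facet\<close>.\<close>
      have "act (word_prod G K) (foldr reflection ds v) = v" if "v \<in> V" for v
        using act[of "act (inv\<^bsub>G\<^esub> w\<^sub>0) v"] eq that w\<^sub>0c by simp
      then show "facet cs ?F"
        unfolding facet_def using FAP cs(2) cardF ds by (auto simp: K_def)
    next
      assume "facet cs ?F"
      from facet_sorted[OF this cs(1) csS ds]
      have "act (word_prod G (nths ?Q (?U - P))) v = act w\<^sub>0 v" if "v \<in> V" for v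
        using act[OF that] that w\<^sub>0c by (simp add: K_def)
      then show "word_prod G (nths ?Q (?U - P)) = w\<^sub>0"
        using w\<^sub>0c word KS AS by (intro act_eqI) auto
    qed
  qed
  have len_nths: "length (nths ?Q B) = card B" if "B \<subseteq> ?U" for B
    using that by (auto simp: length_nths intro!: arg_cong[where f = card])
  have face_iff: "P \<in> subword_complex G S ?Q w\<^sub>0 \<longleftrightarrow> (\<exists>F. ?f ` P \<subseteq> F \<and> facet cs F)"
    if P: "P \<subseteq> ?U" for P
  proof
    assume "P \<in> subword_complex G S ?Q w\<^sub>0"
    then obtain u where u: "subseq u (nths ?Q (?U - P))" "reduced_expression G S u w\<^sub>0"
      by (auto simp: subword_complex_def)
    obtain B where B: "B \<subseteq> ?U - P" "u = nths ?Q B" using u(1) by (rule subseq_nthsE)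
    have BU: "B \<subseteq> ?U" using B(1) by blast
    then have "finite B" by (rule finite_subset) simp
    \<comment> \<open>A reduced word of the longest element has as many letters as
      \<open>ws\<close>. So exactly \<open>?n\<close> positions are left over, and they form a facet
      around \<open>P\<close>.\<close>
    moreover have "card B = length ws"
      using len_nths[OF BU] B(2) u(2) ws(3) by (simp add: reduced_expression_def)
    ultimately have "card (?U - B) = ?n"
      using BU by (simp add: card_Diff_subset)
    moreover have "?U - (?U - B) = B" using B by auto
    ultimately have "facet cs (?f ` (?U - B))"
      using facet_iff[of "?U - B"] u(2) B(2) by (simp add: reduced_expression_def)
    moreover have "?f ` P \<subseteq> ?f ` (?U - B)" using B P by blast
    ultimately show "\<exists>F. ?f ` P \<subseteq> F \<and> facet cs F" by blast
  next
    assume "\<exists>F. ?f ` P \<subseteq> F \<and> facet cs F"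
    then obtain F where F: "?f ` P \<subseteq> F" "facet cs F" by blast
    then have "F \<subseteq> ?f ` ?U" using bij cs(2) by (auto simp: facet_def bij_betw_def)
    then obtain P' where P': "P' \<subseteq> ?U" "F = ?f ` P'" by (meson subset_imageE)
    have card: "card P' = ?n"
      using F(2) P' card_image[OF inj_on_subset[OF inj P'(1)]] by (simp add: facet_def)
    have "P \<subseteq> P'" using F(1) P' P in_img by blast
    then have "subseq (nths ?Q (?U - P')) (nths ?Q (?U - P))" by (intro subseq_nths_mono) auto
    moreover have "set (nths ?Q (?U - P')) \<subseteq> S"
      using set_nths_subset[of ?Q "?U - P'"] csS ws(1) by auto
    \<comment> \<open>The cardinality of a facet makes this word as long as a reduced one, so the
      correct product alone makes it reduced.\<close>
    moreover have "length (nths ?Q (?U - P')) = len w\<^sub>0"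
      using len_nths[of "?U - P'"] card P'(1) ws(3) by (simp add: card_Diff_subset finite_subset)
    ultimately show "P \<in> subword_complex G S ?Q w\<^sub>0"
      unfolding subword_complex_def reduced_expression_def
      using P facet_iff[OF P'(1) card] F(2) P'(2) by blast
  qed
  \<comment> \<open>Agreement on distinct roots is enough, since \<open>pairwise\<close> inspects no
    others.\<close>
  have pw_iff: "pairwise (cpt c) F \<longleftrightarrow> pairwise (compat cs) F" if "F \<subseteq> AP S" for F
    using compatibility_unique[OF assms(6) cs(1,2)] cs(3) that unfolding pairwise_def by blast
  have "P \<in> subword_complex G S ?Q w\<^sub>0 \<longleftrightarrow> ?f ` P \<in> cluster_complex G S act \<alpha> cpt c" if P: "P \<subseteq> ?U" for P
  proof -
    have FAP: "?f ` P \<subseteq> AP S" using bij P by (auto simp: bij_betw_def)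
    have "(\<exists>F. ?f ` P \<subseteq> F \<and> facet cs F) \<longleftrightarrow> pairwise (compat cs) (?f ` P)"
    proof
      assume "\<exists>F. ?f ` P \<subseteq> F \<and> facet cs F"
      then obtain F where F: "?f ` P \<subseteq> F" "facet cs F" by blast
      show "pairwise (compat cs) (?f ` P)"
      proof (rule pairwiseI)
        fix x y assume "x \<in> ?f ` P" "y \<in> ?f ` P"
        then have "x \<in> F" "y \<in> F" using F(1) by blast+
        then show "compat cs x y" by (rule facet_compat[OF F(2) cs(1) csS])
      qed
    next
      assume "pairwise (compat cs) (?f ` P)"
      then have "compat cs x y" if "x \<in> ?f ` P" "y \<in> ?f ` P" "x \<noteq> y" for x y
        using that unfolding pairwise_def by blast
      then show "\<exists>F. ?f ` P \<subseteq> F \<and> facet cs F"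
        using FAP by (intro compat_extends_to_facet[OF cs(1) csS]) (simp_all only: cs(2))
    qed
    then show ?thesis
      unfolding face_iff[OF P] cluster_complex_def using pw_iff[OF FAP] FAP by simp
  qed
  then show ?thesis unfolding simplicial_isomorphism_def using bij by blast
qed

end
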